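(* Let $p$ be a prime, let $(t_n)_{n=1}^{\infty}$ be a sequence of positive integers with $t_n \le n$ for all $n$, and let $X_n \in \mathrm{M}_n(\mathbb{Z}_p)$ be the Haar-random band matrix of width $t_n$. Then $\mathrm{cok}(X_n)$ converges to CL if and only if $$\lim_{n\to\infty} \mathbb{P}(\det(\overline{X_n}) \neq 0) = \prod_{i=1}^{\infty}(1-p^{-i}).$$
   Context: $[n] = \{1,\ldots,n\}$; $\mathbb{Z}_p$ is the ring of $p$-adic integers, $\mathbb{F}_p$ the field with $p$ elements; $\mathrm{cok}(A) = \mathbb{Z}_p^n / A\mathbb{Z}_p^n$ and $\overline{A} \in \mathrm{M}_n(\mathbb{F}_p)$ is the reduction of $A$ modulo $p$, for $A \in \mathrm{M}_n(\mathbb{Z}_p)$. A $\mathbb{Z}_p$-valued random variable is Haar-random if it is distributed according to the Haar probability measure on $\mathbb{Z}_p$. For subsets $\sigma_{n,1},\ldots,\sigma_{n,n}$ of $[n]$ and $\Sigma_n = (\sigma_{n,1},\ldots,\sigma_{n,n})$, the Haar-random matrix supported on $\Sigma_n$ is the random matrix $X_n \in \mathrm{M}_n(\mathbb{Z}_p)$ whose entries $(X_n)_{i,j}$ (row $i$, column $j$) with $i \in \sigma_{n,j}$ are Haar-random and independent, and $(X_n)_{i,j} = 0$ whenever $i \notin \sigma_{n,j}$. The Haar-random band matrix of width $t_n$ is the Haar-random matrix supported on $\Sigma_n = (\sigma_{n,1},\ldots,\sigma_{n,n})$ with $\sigma_{n,i} = \{ j \in [n] : |j-i| \le t_n\}$.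 For a finite abelian $p$-group $G$ put $\mathrm{CL}(G) = \frac{1}{\#\mathrm{Aut}(G)} \prod_{i=1}^{\infty}(1-p^{-i})$. A sequence $(Y_n)_{n\ge1}$ of random finitely generated $\mathbb{Z}_p$-modules converges to CL if $\lim_{n\to\infty}\mathbb{P}(Y_n \cong G) = \mathrm{CL}(G)$ for every finite abelian $p$-group $G$. *)

theory Defs
  imports
    "HOL-Probability.Probability"
    "HOL-Algebra.Bij"
    "Berlekamp_Zassenhaus.Finite_Field"
    "Jordan_Normal_Form.Determinant"
begin

section \<open>The ring of p-adic integers\<close>

text \<open>
  The prime is p = CARD('p) for a type 'p of class \<^class>\<open>prime_card\<close>, as for the field
  'p mod_ring with p elements. An element of the inverse limit of the rings Z/p^k is given by the
  sequence of its canonical representatives in {0..<p^k}.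
\<close>

typedef ('p::prime_card) padic_int =
  "{x :: nat \<Rightarrow> int. \<forall>k. x k \<in> {0..<int CARD('p) ^ k} \<and> x (Suc k) mod int CARD('p) ^ k = x k}"
  morphisms residue Abs_padic_int
  by (rule exI[of _ "\<lambda>_. 0"]) simp

setup_lifting type_definition_padic_int

lemma padic_seq_of_mod:
  assumes "a mod int CARD('p::prime_card) ^ k = b mod int CARD('p) ^ k"
  shows "b mod int CARD('p) ^ k \<in> {0..<int CARD('p) ^ k} \<and>
    a mod int CARD('p) ^ Suc k mod int CARD('p) ^ k = b mod int CARD('p) ^ k"
  using assms by (simp add: mod_mod_cancel)

instantiation padic_int :: (prime_card) comm_ring_1
begin

lift_definition zero_padic_int :: "'a padic_int" is "\<lambda>_. 0" by simp

lift_definition one_padic_int :: "'a padic_int" is "\<lambda>k. 1 mod int CARD('a) ^ k"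
  by (rule padic_seq_of_mod) simp

lift_definition plus_padic_int :: "'a padic_int \<Rightarrow> 'a padic_int \<Rightarrow> 'a padic_int"
  is "\<lambda>x y k. (x k + y k) mod int CARD('a) ^ k"
  by (rule padic_seq_of_mod) (metis mod_add_eq)

lift_definition times_padic_int :: "'a padic_int \<Rightarrow> 'a padic_int \<Rightarrow> 'a padic_int"
  is "\<lambda>x y k. (x k * y k) mod int CARD('a) ^ k"
  by (rule padic_seq_of_mod) (metis mod_mult_eq)

lift_definition uminus_padic_int :: "'a padic_int \<Rightarrow> 'a padic_int"
  is "\<lambda>x k. (- x k) mod int CARD('a) ^ k"
  by (rule padic_seq_of_mod) (metis mod_minus_eq)

lift_definition minus_padic_int :: "'a padic_int \<Rightarrow> 'a padic_int \<Rightarrow> 'a padic_int"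
  is "\<lambda>x y k. (x k - y k) mod int CARD('a) ^ k"
  by (rule padic_seq_of_mod) (metis mod_diff_eq)

lemmas residue_arith = zero_padic_int.rep_eq one_padic_int.rep_eq plus_padic_int.rep_eq
  times_padic_int.rep_eq uminus_padic_int.rep_eq minus_padic_int.rep_eq

instance
proof
  have residue_mod: "residue x k mod int CARD('a) ^ k = residue x k" for x :: "'a padic_int" and k
    using residue[of x] by (simp add: mod_pos_pos_trivial)
  note eqI = residue_inject[THEN iffD1, OF ext]
  fix a b c :: "'a padic_int"
  show "a * b * c = a * (b * c)"
    by (rule eqI) (simp add: residue_arith mod_simps mult.assoc)
  show "a * b = b * a"
    by (rule eqI) (simp add: residue_arith mult.commute)
  show "1 * a = a"
    by (rule eqI) (simp add: residue_arith mod_simps residue_mod)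
  show "a + b + c = a + (b + c)"
    by (rule eqI) (simp add: residue_arith mod_simps add.assoc)
  show "a + b = b + a"
    by (rule eqI) (simp add: residue_arith add.commute)
  show "0 + a = a"
    by (rule eqI) (simp add: residue_arith residue_mod)
  show "- a + a = 0"
    by (rule eqI) (simp add: residue_arith mod_simps)
  show "a - b = a + - b"
    by (rule eqI) (simp add: residue_arith mod_simps)
  show "(a + b) * c = a * c + b * c"
    by (rule eqI) (simp add: residue_arith mod_simps distrib_right)
  show "(0 :: 'a padic_int) \<noteq> 1"
  proof
    assume "(0 :: 'a padic_int) = 1"
    then have "residue (0 :: 'a padic_int) 1 = residue (1 :: 'a padic_int) 1" by simp
    then show False
      using prime_card[where 'a='a] by (simp add: residue_arith prime_gt_1_nat)
  qed
qed

end

lemma residue_Suc_mod: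
  "residue x (Suc k) mod int CARD('p) ^ k = residue (x :: 'p::prime_card padic_int) k"
  using residue[of x] by simp

text \<open>The profinite topology: the residue classes modulo the powers of p are a base.\<close>

instantiation padic_int :: (prime_card) topological_space
begin

definition open_padic_int :: "'a padic_int set \<Rightarrow> bool" where
  "open U \<longleftrightarrow> (\<forall>x\<in>U. \<exists>k. \<forall>y. residue y k = residue x k \<longrightarrow> y \<in> U)"

instance
proof
  have mono: "residue y j = residue x j" if "residue y k = residue x k" "j \<le> k"
    for x y :: "'a padic_int" and j k
    using that(2,1)
  proof (induction k rule: dec_induct)
    case (step k)
    then show ?case
      using residue_Suc_mod[of x k] residue_Suc_mod[of y k] by simp
  qed
  show "open (S \<inter> T)" if "open S" "open T" for S T :: "'a padic_int set"
    unfolding open_padic_int_def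
  proof
    fix x assume "x \<in> S \<inter> T"
    then obtain k l where "\<forall>y. residue y k = residue x k \<longrightarrow> y \<in> S"
      "\<forall>y. residue y l = residue x l \<longrightarrow> y \<in> T"
      using \<open>open S\<close> \<open>open T\<close> unfolding open_padic_int_def by blast
    then have "\<forall>y. residue y (max k l) = residue x (max k l) \<longrightarrow> y \<in> S \<inter> T"
      by (meson IntI mono max.cobounded1 max.cobounded2)
    then show "\<exists>m. \<forall>y. residue y m = residue x m \<longrightarrow> y \<in> S \<inter> T" by blast
  qed
  show "open (UNIV :: 'a padic_int set)"
    by (simp add: open_padic_int_def)
  show "open (\<Union> K)" if "\<forall>S\<in>K. open S" for K :: "'a padic_int set set"
    using that unfolding open_padic_int_def by (meson Union_iff)
qed

end

definition padic_reduction :: "'p::prime_card padic_int \<Rightarrow> 'p mod_ring" where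
  "padic_reduction x = of_int_mod_ring (residue x 1)"

section \<open>Haar-random matrices\<close>

definition haar_prob_measure :: "'p::prime_card padic_int measure \<Rightarrow> bool" where
  "haar_prob_measure P \<longleftrightarrow> prob_space P \<and> sets P = sets borel \<and>
    (\<forall>a. \<forall>A\<in>sets borel. emeasure P ((\<lambda>x. a + x) ` A) = emeasure P A)"

definition haar_random :: "'w measure \<Rightarrow> ('w \<Rightarrow> 'p::prime_card padic_int) \<Rightarrow> bool" where
  "haar_random M Y \<longleftrightarrow> Y \<in> borel_measurable M \<and> haar_prob_measure (distr M borel Y)"

text \<open>
  Matrices of the library have row and column indices in {0..<n}, so the sets
  \<sigma> j describing the support of column j are subsets of {0..<n} instead of {1..n}.
\<close>

definition haar_random_matrix_on ::
  "'w measure \<Rightarrow> nat \<Rightarrow> (nat \<Rightarrow> nat set) \<Rightarrow> ('w \<Rightarrow> 'p::prime_card padic_int Matrix.mat) \<Rightarrow> bool"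
where
  "haar_random_matrix_on M n \<sigma> X \<longleftrightarrow>
    prob_space M \<and>
    (\<forall>\<omega>\<in>space M. X \<omega> \<in> carrier_mat n n) \<and>
    (\<forall>i<n. \<forall>j<n. i \<in> \<sigma> j \<longrightarrow> haar_random M (\<lambda>\<omega>. X \<omega> $$ (i, j))) \<and>
    prob_space.indep_vars M (\<lambda>_. borel) (\<lambda>(i, j) \<omega>. X \<omega> $$ (i, j))
      {(i, j). i < n \<and> j < n \<and> i \<in> \<sigma> j} \<and>
    (\<forall>i<n. \<forall>j<n. i \<notin> \<sigma> j \<longrightarrow> (\<forall>\<omega>\<in>space M. X \<omega> $$ (i, j) = 0))"

definition band_support :: "nat \<Rightarrow> nat \<Rightarrow> nat \<Rightarrow> nat set" where
  "band_support n t i = {j \<in> {0..<n}. \<bar>int j - int i\<bar> \<le> int t}"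

definition haar_random_band_matrix ::
  "'w measure \<Rightarrow> nat \<Rightarrow> nat \<Rightarrow> ('w \<Rightarrow> 'p::prime_card padic_int Matrix.mat) \<Rightarrow> bool"
where
  "haar_random_band_matrix M n t X \<longleftrightarrow> haar_random_matrix_on M n (band_support n t) X"

section \<open>Cokernels and convergence to the Cohen-Lenstra distribution\<close>

text \<open>
  Only the additive group of the cokernel is recorded: if a module over the p-adic integers is
  isomorphic as a group to a finite abelian p-group, then it is killed by a power of p, and the
  group isomorphism is linear over the p-adic integers.
\<close>

definition cok :: "'p::prime_card padic_int Matrix.mat \<Rightarrow> 'p padic_int Matrix.vec set monoid" where
  "cok A = monoid_vec TYPE('p padic_int) (dim_row A) Mod ((\<lambda>v. A *\<^sub>v v) ` carrier_vec (dim_col A))"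

definition finite_abelian_p_group :: "nat \<Rightarrow> ('g, 'b) monoid_scheme \<Rightarrow> bool" where
  "finite_abelian_p_group p G \<longleftrightarrow>
    comm_group G \<and> finite (carrier G) \<and> (\<exists>k. order G = p ^ k)"

definition CL :: "nat \<Rightarrow> ('g, 'b) monoid_scheme \<Rightarrow> real" where
  "CL p G = 1 / real (card (auto G)) * (\<Prod>i. 1 - 1 / real p ^ Suc i)"

text \<open>
  The groups G are taken with carrier in nat because HOL cannot quantify over types inside a
  formula; by the lemma below this covers every finite group up to isomorphism.
\<close>

definition converges_to_CL ::
  "nat \<Rightarrow> (nat \<Rightarrow> 'w measure) \<Rightarrow> (nat \<Rightarrow> 'w \<Rightarrow> ('g, 'b) monoid_scheme) \<Rightarrow> bool"
where
  "converges_to_CL p M Y \<longleftrightarrow>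
    (\<forall>G :: nat monoid. finite_abelian_p_group p G \<longrightarrow>
      (\<lambda>n. measure (M n) {\<omega> \<in> space (M n). Y n \<omega> \<cong> G}) \<longlonglongrightarrow> CL p G)"

lemma finite_group_iso_nat:
  fixes G :: "('g, 'b) monoid_scheme"
  assumes "group G" "finite (carrier G)"
  shows "\<exists>H :: nat monoid. group H \<and> G \<cong> H"
proof -
  interpret group G by fact
  obtain f :: "'g \<Rightarrow> nat" where f: "inj_on f (carrier G)"
    using assms(2) finite_imp_inj_to_nat_seg by blast
  define g where "g = inv_into (carrier G) f"
  define H :: "nat monoid" where
    "H = \<lparr>carrier = f ` carrier G, mult = (\<lambda>x y. f (g x \<otimes>\<^bsub>G\<^esub> g y)), one = f \<one>\<^bsub>G\<^esub>\<rparr>"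
  have g: "g (f x) = x" if "x \<in> carrier G" for x
    using f that by (simp add: g_def)
  have "group H"
  proof (rule groupI)
    fix x assume "x \<in> carrier H"
    then obtain a where "a \<in> carrier G" "x = f a" by (auto simp: H_def)
    then show "\<exists>y\<in>carrier H. y \<otimes>\<^bsub>H\<^esub> x = \<one>\<^bsub>H\<^esub>"
      by (intro bexI[of _ "f (inv\<^bsub>G\<^esub> a)"]) (auto simp: H_def g)
  qed (auto simp: H_def g m_assoc)
  moreover have "f \<in> iso G H"
    using f by (auto simp: iso_def hom_def bij_betw_def H_def g)
  ultimately show ?thesis
    by (auto intro: is_isoI)
qed

end

theory Submission
  imports Defs "HOL-Algebra.Product_Groups"
begin

text \<open>
The cokernel of a matrix is trivial exactly if the determinant of its reduction is nonzero, so the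
trivial group gives one direction. For the other one, let \<open>c\<^sub>k\<close> be the product of
\<open>1 - p\<^sup>-\<^sup>i\<close> over \<open>1 \<le> i \<le> k\<close>, let \<open>c\<close> be its limit, and let \<open>d\<^sub>n\<close> be the probability that the
reduction of \<open>X\<^sub>n\<close> is invertible. The hypothesis \<open>d\<^sub>n \<longlonglongrightarrow> c\<close> is strong because \<open>c\<close> is, asymptotically, the
largest possible value: whatever its support, a random vector avoids a given subgroup of index
\<open>p\<^sup>i\<close> with probability at most \<open>1 - p\<^sup>-\<^sup>i\<close> (\<open>card_outside_subgroup_le\<close>). Exposing the vectors one by
one gives the following upper bounds for \<open>d\<^sub>n\<close>.

\<^item> If \<open>k\<close> columns come last, then \<open>d\<^sub>n\<close> is at most \<open>c\<^sub>k\<close> times the probability that the other \<open>n - k\<close>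
  columns are independent modulo \<open>p\<close> (\<open>prob_generating_le\<close>).
\<^item> If \<open>s\<close> rows come last, then \<open>d\<^sub>n\<close> is at most \<open>c\<^sub>s\<close> times the probability that the other \<open>n - s\<close>
  rows have full rank. If these rows do not have full rank after the removal of \<open>k\<close> columns, then
  the \<open>k\<close> columns fail to repair this with probability at least \<open>p\<^sup>-\<^sup>k\<close>
  (\<open>prob_full_rank_le_row_block\<close>).

So the block of \<open>n - k\<close> columns is independent, and after removal of \<open>s\<close> rows it still has full row rank,
outside an event of probability at most \<open>(1 - d\<^sub>n / c\<^sub>k) + p\<^sup>k (1 - d\<^sub>n / c\<^sub>s)\<close>. In the limit this is
small if first \<open>k\<close> and then \<open>s\<close> is taken large. Outside this event the quotient by the
\<open>n - k\<close> columns is free of rank \<open>k\<close>, and the vectors supported on the \<open>s\<close> removed rows already map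
onto it. If the band is so wide that the remaining \<open>k\<close> columns are unrestricted in these \<open>s\<close>
rows, their images in the quotient are uniform. Hence the cokernel is distributed
exactly as that of a uniform \<open>k \<times> k\<close> matrix (\<open>prob_cok_approx\<close>). The band does become that wide: a row
with at most \<open>t + 1\<close> entries in the support vanishes modulo \<open>p\<close> with probability at least
\<open>p\<^sup>-\<^sup>(\<^sup>t\<^sup>+\<^sup>1\<^sup>)\<close>, which keeps \<open>d\<^sub>n\<close> away from \<open>c\<close> (\<open>prob_full_rank_narrow_le\<close>).

For a uniform \<open>k \<times> k\<close> matrix, the columns generate a given subgroup \<open>L\<close> with quotient \<open>G\<close> with
probability \<open>c\<^sub>k / |G|\<^sup>k\<close>, and the number of such \<open>L\<close> is the number of generating \<open>k\<close>-tuples of \<open>G\<close>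
divided by \<open>|Aut G|\<close>. Almost all \<open>k\<close>-tuples generate \<open>G\<close> for large \<open>k\<close>, so the limit is
\<open>CL(G)\<close> (\<open>square_cok_prob_LIMSEQ\<close>).

All counting takes place in the finite groups \<open>(\<int>/q)\<^sup>I\<close> with \<open>q = p\<^sup>m\<^sup>+\<^sup>1\<close>, where \<open>p\<^sup>m\<close> kills \<open>G\<close>. By
Nakayama's lemma it is decided modulo \<open>q\<close> whether the cokernel is isomorphic to \<open>G\<close>
(\<open>cok_iso_iff_residues\<close>), and the residues of a Haar-random matrix are uniform
(\<open>haar_random_matrix_residue_prob\<close>).
\<close>

section \<open>Generating tuples of finite abelian p-groups\<close>

text \<open>
The probability that a uniform \<open>k \<times> k\<close> matrix over the field with \<open>p\<close> elements is invertible.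
\<close>

definition inverse_power_prod :: "nat \<Rightarrow> nat \<Rightarrow> real" where
  "inverse_power_prod p k = (\<Prod>i<k. 1 - 1 / real p ^ Suc i)"

lemma inverse_power_prod_pos: "1 < p \<Longrightarrow> 0 < inverse_power_prod p k"
  unfolding inverse_power_prod_def
  by (intro prod_pos) (use one_less_power[of "real p"] in \<open>auto simp del: power_Suc\<close>)

lemma card_PiE_insert_filter:
  assumes "finite J" "j \<notin> J" "finite (B j)" "\<And>i. i \<in> J \<Longrightarrow> finite (B i)"
  shows "card {w \<in> PiE (insert j J) B. Q w} = (\<Sum>b\<in>B j. card {w \<in> PiE J B. Q (w(j := b))})"
proof -
  have inj: "inj_on (\<lambda>(b, w). w(j := b)) (B j \<times> PiE J B)"
    using inj_combinator[OF assms(2), of B] by (auto simp: inj_on_def)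
  have "{w \<in> PiE (insert j J) B. Q w} =
      (\<lambda>(b, w). w(j := b)) ` (SIGMA b:B j. {w \<in> PiE J B. Q (w(j := b))})"
    by (auto simp: PiE_insert_eq)
  moreover have "inj_on (\<lambda>(b, w). w(j := b)) (SIGMA b:B j. {w \<in> PiE J B. Q (w(j := b))})"
    by (rule inj_on_subset[OF inj]) auto
  moreover have "finite (PiE J B)" using assms by (intro finite_PiE) auto
  ultimately show ?thesis using assms by (simp add: card_image)
qed

locale finite_abelian_pgroup = comm_group G for G (structure) +
  fixes p :: nat
  assumes finite_carrier [simp]: "finite (carrier G)"
    and prime_p: "Factorial_Ring.prime p"
    and order_power: "\<exists>N. order G = p ^ N"
begin

lemma p_gt_1: "1 < p" using prime_p by (rule prime_gt_1_nat)

lemma finite_subgroup [intro]: "subgroup H G \<Longrightarrow> finite H"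
  using finite_subset subgroup.subset finite_carrier by metis

lemma card_subgroup_power:
  assumes "subgroup H G"
  obtains a where "card H = p ^ a"
proof -
  have "card H dvd order G"
    using lagrange_finite[OF finite_carrier assms] by (metis dvd_triv_right)
  then show ?thesis using order_power prime_p that by (metis divides_primepow_nat)
qed

lemma subgroup_pgroup:
  assumes "subgroup H G"
  shows "finite_abelian_pgroup (G\<lparr>carrier := H\<rparr>) p"
proof -
  interpret H: group "G\<lparr>carrier := H\<rparr>" using assms by (rule subgroup_imp_group)
  have "comm_group (G\<lparr>carrier := H\<rparr>)"
    using subgroup.subset[OF assms] by (intro H.group_comm_groupI) (auto simp: m_comm subset_iff)
  then show ?thesis
    using finite_subgroup[OF assms] card_subgroup_power[OF assms] prime_p
    by (auto simp: finite_abelian_pgroup_def finite_abelian_pgroup_axioms_def order_def)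
qed

lemma card_generate_insert_le:
  assumes S: "subgroup S G" and b: "b \<in> carrier G" and pb: "b [^] p \<in> S"
  shows "card (generate G (insert b S)) \<le> p * card S"
proof -
  let ?T = "(\<lambda>(i, s). b [^] i \<otimes> s) ` ({..<p} \<times> S)"
  have Sc: "S \<subseteq> carrier G" using S by (rule subgroup.subset)
  have gen: "generate G {b} = {b [^] k |k. k \<in> (UNIV::nat set)}"
    using generate_pow_on_finite_carrier[OF finite_carrier b] .
  have sub: "subgroup (generate G {b} <#> S) G"
    using b S by (intro mult_subgroups generate_is_subgroup) auto
  have "generate G (insert b S) \<subseteq> generate G {b} <#> S"
  proof (rule generate_subgroup_incl[OF _ sub])
    have "b \<otimes> \<one> \<in> generate G {b} <#> S"
      using S unfolding set_mult_def by (blast intro: generate.incl subgroup.one_closed)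
    moreover have "\<one> \<otimes> s \<in> generate G {b} <#> S" if "s \<in> S" for s
      using that unfolding set_mult_def by (blast intro: generate.one)
    ultimately show "insert b S \<subseteq> generate G {b} <#> S"
      using b Sc by (auto simp: subset_iff)
  qed
  also have "\<dots> \<subseteq> ?T"
  proof
    fix x assume "x \<in> generate G {b} <#> S"
    then obtain n :: nat and s where x: "x = b [^] n \<otimes> s" and s: "s \<in> S"
      unfolding gen set_mult_def by blast
    have "b [^] n = b [^] (n mod p) \<otimes> (b [^] p) [^] (n div p)"
      using b by (simp add: nat_pow_mult nat_pow_pow)
    moreover have "(b [^] p) [^] (n div p) \<in> S"
      using S pb by (metis subgroup_int_pow_closed int_pow_int)
    ultimately have "x = b [^] (n mod p) \<otimes> ((b [^] p) [^] (n div p) \<otimes> s)"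
      "(b [^] p) [^] (n div p) \<otimes> s \<in> S"
      using s S Sc b x by (auto simp: m_assoc subgroup.m_closed subset_iff)
    then show "x \<in> ?T" using p_gt_1 by (auto intro!: image_eqI[where x="(n mod p, (b [^] p) [^] (n div p) \<otimes> s)"])
  qed
  finally have "card (generate G (insert b S)) \<le> card ?T"
    using finite_subgroup[OF S] by (intro card_mono) auto
  also have "card ?T \<le> p * card S"
    using card_image_le[of "{..<p} \<times> S"] finite_subgroup[OF S] by (simp add: card_cartesian_product)
  finally show ?thesis .
qed

text \<open>
The order grows by a factor of at most \<open>p\<close>, because the cosets \<open>b\<^sup>i S\<close> with \<open>i < p\<close> exhaust the
generated subgroup. Both orders are powers of \<open>p\<close>, so a proper growth is a growth by exactly \<open>p\<close>.
\<close>

lemma card_generate_insert: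
  assumes S: "subgroup S G" and b: "b \<in> carrier G" "b \<notin> S" and pb: "b [^] p \<in> S"
  shows "card (generate G (insert b S)) = p * card S"
proof -
  let ?T = "generate G (insert b S)"
  have sub: "subgroup ?T G" using S b by (intro generate_is_subgroup) (auto dest: subgroup.subset)
  obtain a c where a: "card S = p ^ a" and c: "card ?T = p ^ c"
    using card_subgroup_power[OF S] card_subgroup_power[OF sub] by metis
  have "S \<subset> ?T" using b by (auto intro: generate.incl)
  then have "card S < card ?T" using finite_subgroup[OF sub] by (rule psubset_card_mono[rotated])
  then have "a < c" using a c p_gt_1 by simp
  then have "p ^ Suc a \<le> p ^ c" using p_gt_1 by (intro power_increasing) auto
  then show ?thesis using card_generate_insert_le[OF S b(1) pb] a c by simp
qed

lemma generate_subgroup_insert_mem: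
  assumes "subgroup S G" "b \<in> S"
  shows "generate G (insert b S) = S"
  using assms by (metis generateI insert_absorb subset_refl)

lemma generate_generate_Un:
  assumes "A \<subseteq> carrier G" "B \<subseteq> carrier G"
  shows "generate G (generate G A \<union> B) = generate G (A \<union> B)"
proof (rule equalityI)
  show "generate G (generate G A \<union> B) \<subseteq> generate G (A \<union> B)"
    using assms by (intro generate_subgroup_incl generate_is_subgroup Un_least mono_generate)
      (auto intro: generate.incl)
  show "generate G (A \<union> B) \<subseteq> generate G (generate G A \<union> B)"
    by (intro mono_generate) (auto intro: generate.incl)
qed

text \<open>
The quotients \<open>b s\<^sup>-\<^sup>1\<close> take at most \<open>order G\<close> values on \<open>B \<times> S\<close>, and the pairs with a given value
are the translates of one of them by elements of \<open>B \<inter> S\<close>.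
\<close>

lemma subgroup_inter_card_le:
  assumes "subgroup B G" "subgroup S G"
  shows "card B * card S \<le> order G * card (B \<inter> S)"
proof -
  note [simp] = finite_subgroup[OF assms(1)] finite_subgroup[OF assms(2)]
  let ?f = "\<lambda>(b, s). b \<otimes> inv s"
  have Bc: "B \<subseteq> carrier G" and Sc: "S \<subseteq> carrier G" using assms by (auto dest: subgroup.subset)
  have "card (B \<times> S) = (\<Sum>a\<in>?f ` (B \<times> S). card {x \<in> B \<times> S. ?f x = a})"
    using sum.image_gen[of "B \<times> S" "\<lambda>_. 1::nat" ?f] unfolding card_eq_sum by simp
  also have "\<dots> \<le> (\<Sum>a\<in>?f ` (B \<times> S). card (B \<inter> S))"
  proof (rule sum_mono)
    fix a assume "a \<in> ?f ` (B \<times> S)"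
    then obtain b s where bs: "b \<in> B" "s \<in> S" "a = b \<otimes> inv s" by auto
    have "{x \<in> B \<times> S. ?f x = a} \<subseteq> (\<lambda>d. (d \<otimes> b, d \<otimes> s)) ` (B \<inter> S)"
    proof
      fix x assume "x \<in> {x \<in> B \<times> S. ?f x = a}"
      then obtain b' s' where x: "b' \<in> B" "s' \<in> S" "b' \<otimes> inv s' = a" "x = (b', s')" by auto
      have c: "b' \<in> carrier G" "s' \<in> carrier G" "b \<in> carrier G" "s \<in> carrier G"
        using x bs Bc Sc by auto
      have eq: "b' \<otimes> inv b = s' \<otimes> inv s"
      proof -
        have "b' = b \<otimes> inv s \<otimes> s'"
          using inv_solve_right[of "b \<otimes> inv s" b' s'] x(3) bs(3) c by simp
        also have "\<dots> = (s' \<otimes> inv s) \<otimes> b" using c by (simp add: m_ac)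
        finally show ?thesis using c by (metis inv_solve_right inv_closed m_closed)
      qed
      have "b' \<otimes> inv b \<in> B \<inter> S"
        using x bs assms eq by (metis IntI subgroup.m_closed subgroup.m_inv_closed)
      moreover have "b' \<otimes> inv b \<otimes> b = b'" using c by (simp add: m_assoc)
      moreover have "b' \<otimes> inv b \<otimes> s = s'" unfolding eq using c by (simp add: m_assoc)
      ultimately show "x \<in> (\<lambda>d. (d \<otimes> b, d \<otimes> s)) ` (B \<inter> S)" unfolding x(4) by (metis (no_types, lifting) image_eqI)
    qed
    then have "card {x \<in> B \<times> S. ?f x = a} \<le> card ((\<lambda>d. (d \<otimes> b, d \<otimes> s)) ` (B \<inter> S))"
      by (intro card_mono) auto
    also have "\<dots> \<le> card (B \<inter> S)" by (rule card_image_le) auto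
    finally show "card {x \<in> B \<times> S. ?f x = a} \<le> card (B \<inter> S)" .
  qed
  also have "\<dots> = card (?f ` (B \<times> S)) * card (B \<inter> S)" by simp
  also have "\<dots> \<le> order G * card (B \<inter> S)"
    unfolding order_def using Bc Sc by (intro mult_right_mono card_mono) auto
  finally show ?thesis by (simp add: card_cartesian_product)
qed

lemma card_generate_Un_le:
  assumes "subgroup S G" "\<And>x. x \<in> carrier G \<Longrightarrow> x [^] p \<in> S" "finite J" "Y ` J \<subseteq> carrier G"
  shows "card (generate G (S \<union> Y ` J)) \<le> p ^ card J * card S"
  using assms(3,4)
proof (induction J rule: finite_induct)
  case empty
  then show ?case using generateI[of S S] assms(1) by simp
next
  case (insert j J)
  let ?H = "generate G (S \<union> Y ` J)"
  have Sc: "S \<subseteq> carrier G" using assms(1) by (rule subgroup.subset)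
  have H: "subgroup ?H G" using Sc insert.prems by (intro generate_is_subgroup) auto
  have "generate G (S \<union> Y ` insert j J) = generate G (?H \<union> {Y j})"
    using Sc insert.prems by (subst generate_generate_Un) auto
  then have "card (generate G (S \<union> Y ` insert j J)) = card (generate G (insert (Y j) ?H))" by simp
  also have "\<dots> \<le> p * card ?H"
    using insert.prems assms(2) by (intro card_generate_insert_le H) (auto intro: generate.incl)
  also have "\<dots> \<le> p * (p ^ card J * card S)" using insert by (intro mult_left_mono) auto
  finally show ?case using insert.hyps by (simp add: mult.assoc)
qed

text \<open>
The index of \<open>B \<inter> S\<close> in \<open>B\<close> is at most the index of \<open>S\<close> in \<open>G\<close>. This is why no choice of supports
makes full rank more likely than the full support does.
\<close>

lemma card_outside_subgroup_le:
  assumes "subgroup B G" "subgroup S G" "order G = q * card S" "0 < q"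
  shows "real (card (B - S)) \<le> real (card B) * (1 - 1 / q)"
proof -
  have S: "0 < card S" using assms(2) by (meson finite_carrier subgroup.finite_imp_card_positive)
  have "card B * card S \<le> q * card S * card (B \<inter> S)"
    using subgroup_inter_card_le[OF assms(1,2)] assms(3) by simp
  then have "card B \<le> q * card (B \<inter> S)" using S by (simp add: mult.commute mult.left_commute)
  then have "real (card B) / q \<le> real (card (B \<inter> S))"
    using assms(4) by (simp add: field_simps flip: of_nat_mult)
  moreover have "card (B - S) + card (B \<inter> S) = card B"
    using finite_subgroup[OF assms(1)] by (metis add.commute card_Int_Diff)
  then have "real (card (B - S)) = real (card B) - real (card (B \<inter> S))" by linarith
  ultimately show ?thesis by (simp add: right_diff_distrib)
qed

lemma generate_insert_step:
  assumes "subgroup S G" "b \<in> carrier G" "W \<subseteq> carrier G"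
  shows "generate G (S \<union> insert b W) = generate G (generate G (insert b S) \<union> W)"
  using assms by (subst generate_generate_Un) (auto dest: subgroup.subset)

lemma card_tuples_step:
  assumes "finite J" "j \<notin> J" "subgroup S G" "\<And>i. i \<in> insert j J \<Longrightarrow> subgroup (B i) G"
  shows "card {w \<in> PiE (insert j J) B. generate G (S \<union> w ` insert j J) = carrier G}
    = (\<Sum>b\<in>B j. card {w \<in> PiE J B. generate G (generate G (insert b S) \<union> w ` J) = carrier G})"
proof -
  have Bc: "B i \<subseteq> carrier G" if "i \<in> insert j J" for i
    using assms(4)[OF that] by (rule subgroup.subset)
  have "card {w \<in> PiE J B. generate G (S \<union> (w(j := b)) ` insert j J) = carrier G} =
      card {w \<in> PiE J B. generate G (generate G (insert b S) \<union> w ` J) = carrier G}"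
    if b: "b \<in> B j" for b
  proof -
    have "generate G (S \<union> (w(j := b)) ` insert j J) = generate G (generate G (insert b S) \<union> w ` J)"
      if "w \<in> PiE J B" for w
    proof -
      have "w ` J \<subseteq> carrier G" using that Bc by (auto simp: PiE_def Pi_def)
      moreover have "(w(j := b)) ` insert j J = insert b (w ` J)"
        using assms(2) by (auto simp: image_def)
      moreover have "b \<in> carrier G" using b Bc by blast
      ultimately show ?thesis using generate_insert_step[OF assms(3)] by simp
    qed
    then show ?thesis by (metis (no_types, lifting))
  qed
  then show ?thesis
    using assms by (subst card_PiE_insert_filter) auto
qed

text \<open>
Choose the elements one by one. The index of the subgroup generated so far is a power of \<open>p\<close> that
each element divides by \<open>p\<close> or leaves unchanged. If it starts at \<open>p\<close> to the number of elements, then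
every element has to fall outside of the current subgroup; if it starts higher, the elements are too few.
\<close>

lemma card_generating_tuples_le:
  assumes "finite J" "\<And>j. j \<in> J \<Longrightarrow> subgroup (B j) G" "subgroup S G"
    and "\<And>x. x \<in> carrier G \<Longrightarrow> x [^] p \<in> S" "p ^ card J * card S \<le> order G"
  shows "real (card {w \<in> PiE J B. generate G (S \<union> w ` J) = carrier G}) \<le>
    (if order G = p ^ card J * card S then inverse_power_prod p (card J) else 0)
      * (\<Prod>j\<in>J. real (card (B j)))"
  using assms
proof (induction J arbitrary: S rule: finite_induct)
  case empty
  have "{w \<in> PiE {} B. generate G S = carrier G} = (if order G = card S then {\<lambda>_. undefined} else {})"
    using empty.prems(2) generateI[of S S] card_subset_eq[OF finite_carrier subgroup.subset[OF empty.prems(2)]]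
    by (auto simp: order_def)
  then show ?case by (auto simp: inverse_power_prod_def)
next
  case (insert j J)
  let ?k = "card J"
  let ?P = "\<Prod>j\<in>J. real (card (B j))"
  let ?N = "\<lambda>S. real (card {w \<in> PiE J B. generate G (S \<union> w ` J) = carrier G})"
  let ?c = "if order G = p ^ Suc ?k * card S then inverse_power_prod p ?k else 0"
  have S: "subgroup S G" and Bj: "subgroup (B j) G" using insert.prems by auto
  have Sc: "S \<subseteq> carrier G" and Bc: "B j \<subseteq> carrier G" using S Bj by (auto dest: subgroup.subset)
  have posS: "0 < card S" using S by (meson finite_carrier subgroup.finite_imp_card_positive)
  have ck: "card (insert j J) = Suc ?k" using insert.hyps by simp
  have IH: "?N S' \<le> (if order G = p ^ ?k * card S' then inverse_power_prod p ?k else 0) * ?P"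
    if "subgroup S' G" "S \<subseteq> S'" "p ^ ?k * card S' \<le> order G" for S'
  proof -
    have "x [^] p \<in> S'" if "x \<in> carrier G" for x using insert.prems(3)[OF that] \<open>S \<subseteq> S'\<close> by blast
    then show ?thesis using insert.IH[OF _ that(1) _ that(3)] insert.prems(1) by blast
  qed
  have stay: "?N (generate G (insert b S)) = 0" if "b \<in> B j \<inter> S" for b
  proof -
    have "p ^ ?k * card S < p * (p ^ ?k * card S)"
      using p_gt_1 posS by (intro n_less_m_mult_n) auto
    also have "\<dots> \<le> order G" using insert.prems(4) ck by (simp add: mult.assoc)
    finally have "p ^ ?k * card S < order G" .
    then have "?N S \<le> 0" using IH[OF S] by simp
    then show ?thesis using that generate_subgroup_insert_mem[OF S] by simp
  qed
  have grow: "?N (generate G (insert b S)) \<le> ?c * ?P" if "b \<in> B j - S" for b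
  proof -
    have "card (generate G (insert b S)) = p * card S"
      using that Bc insert.prems(3) by (intro card_generate_insert S) auto
    moreover have "subgroup (generate G (insert b S)) G"
      using that Bc Sc by (intro generate_is_subgroup) auto
    moreover have "S \<subseteq> generate G (insert b S)" by (auto intro: generate.incl)
    ultimately show ?thesis
      using IH[of "generate G (insert b S)"] insert.prems(4) ck by (simp add: mult.assoc mult.left_commute)
  qed
  have "real (card {w \<in> PiE (insert j J) B. generate G (S \<union> w ` insert j J) = carrier G})
      = (\<Sum>b\<in>B j. ?N (generate G (insert b S)))"
    using insert by (subst card_tuples_step) auto
  also have "\<dots> = (\<Sum>b\<in>B j - S. ?N (generate G (insert b S)))"
    using stay finite_subgroup[OF Bj] by (intro sum.mono_neutral_right) auto
  also have "\<dots> \<le> (\<Sum>b\<in>B j - S. ?c * ?P)" by (intro sum_mono grow)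
  also have "\<dots> = real (card (B j - S)) * (?c * ?P)" by simp
  also have "\<dots> \<le> (if order G = p ^ Suc ?k * card S then inverse_power_prod p (Suc ?k) else 0)
      * (real (card (B j)) * ?P)"
  proof (cases "order G = p ^ Suc ?k * card S")
    case True
    have "real (card (B j - S)) \<le> real (card (B j)) * (1 - 1 / (p ^ Suc ?k))"
      using card_outside_subgroup_le[OF Bj S True] p_gt_1 by simp
    moreover have "0 \<le> inverse_power_prod p ?k * ?P"
      using inverse_power_prod_pos[OF p_gt_1] by (intro mult_nonneg_nonneg prod_nonneg) (auto intro: less_imp_le)
    ultimately have "real (card (B j - S)) * (inverse_power_prod p ?k * ?P) \<le>
      real (card (B j)) * (1 - 1 / (p ^ Suc ?k)) * (inverse_power_prod p ?k * ?P)"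
      by (rule mult_right_mono)
    then show ?thesis using True by (simp add: inverse_power_prod_def mult_ac)
  qed simp
  finally show ?case unfolding ck prod.insert[OF insert.hyps] .
qed

text \<open>
For elements of the whole group, the estimate \<open>card_outside_subgroup_le\<close> is an equality at each step.
\<close>

lemma card_generating_tuples_full:
  assumes "finite J" "subgroup S G"
    and "\<And>x. x \<in> carrier G \<Longrightarrow> x [^] p \<in> S" "order G = p ^ card J * card S"
  shows "real (card {w \<in> PiE J (\<lambda>_. carrier G). generate G (S \<union> w ` J) = carrier G}) =
    inverse_power_prod p (card J) * real (order G) ^ card J"
  using assms
proof (induction J arbitrary: S rule: finite_induct)
  case empty
  then have "S = carrier G"
    using card_subset_eq[OF finite_carrier subgroup.subset[OF empty.prems(1)]] by (auto simp: order_def)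
  then have "{w \<in> PiE {} (\<lambda>_. carrier G). generate G S = carrier G} = {\<lambda>_. undefined}"
    using generateI[of S S] empty.prems(1) by auto
  then have "card {w \<in> PiE {} (\<lambda>_. carrier G). generate G S = carrier G} = 1"
    by (subst \<open>_ = {\<lambda>_. undefined}\<close>) simp
  then show ?case by (simp add: inverse_power_prod_def)
next
  case (insert j J)
  let ?k = "card J"
  let ?B = "\<lambda>_. carrier G"
  let ?N = "\<lambda>S. real (card {w \<in> PiE J ?B. generate G (S \<union> w ` J) = carrier G})"
  have S: "subgroup S G" using insert.prems by auto
  have Sc: "S \<subseteq> carrier G" using S by (auto dest: subgroup.subset)
  have posS: "0 < card S" using S by (meson finite_carrier subgroup.finite_imp_card_positive)
  have ord: "order G = p ^ Suc ?k * card S" using insert by simp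
  have stay: "?N (generate G (insert b S)) = 0" if "b \<in> S" for b
  proof -
    have "p ^ ?k * card S < p * (p ^ ?k * card S)"
      using p_gt_1 posS by (intro n_less_m_mult_n) auto
    then have "p ^ ?k * card S < order G" using ord by (simp add: mult.assoc)
    then have "?N S \<le> 0"
      using card_generating_tuples_le[OF insert.hyps(1) _ S insert.prems(2), of ?B] subgroup_self
      by simp
    then show ?thesis using that generate_subgroup_insert_mem[OF S] by simp
  qed
  have grow: "?N (generate G (insert b S)) = inverse_power_prod p ?k * real (order G) ^ ?k"
    if "b \<in> carrier G - S" for b
  proof -
    have "card (generate G (insert b S)) = p * card S"
      using that insert.prems(2) by (intro card_generate_insert S) auto
    moreover have "subgroup (generate G (insert b S)) G"
      using that Sc by (intro generate_is_subgroup) auto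
    moreover have "S \<subseteq> generate G (insert b S)" by (auto intro: generate.incl)
    ultimately show ?thesis
      using insert.IH[of "generate G (insert b S)"] insert.prems(2) ord
      by (auto simp: mult.assoc mult.left_commute)
  qed
  have "real (card {w \<in> PiE (insert j J) ?B. generate G (S \<union> w ` insert j J) = carrier G})
      = (\<Sum>b\<in>carrier G. ?N (generate G (insert b S)))"
    using insert subgroup_self by (subst card_tuples_step) auto
  also have "\<dots> = (\<Sum>b\<in>carrier G - S. ?N (generate G (insert b S)))"
    using stay by (intro sum.mono_neutral_right) auto
  also have "\<dots> = (\<Sum>b\<in>carrier G - S. inverse_power_prod p ?k * real (order G) ^ ?k)"
    by (intro sum.cong grow) auto
  also have "\<dots> = real (card (carrier G - S)) * (inverse_power_prod p ?k * real (order G) ^ ?k)" by simp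
  also have "real (card (carrier G - S)) = real (order G) * (1 - 1 / (p ^ Suc ?k))"
  proof -
    have "card (carrier G - S) = order G - card S" "card S \<le> order G"
      using Sc finite_subgroup[OF S] by (auto simp: order_def card_Diff_subset intro: card_mono)
    then have "real (card (carrier G - S)) = real (order G) - real (card S)" by simp
    also have "\<dots> = real (order G) * (1 - 1 / (p ^ Suc ?k))"
      using p_gt_1 by (simp add: ord field_simps)
    finally show ?thesis .
  qed
  finally show ?case using insert.hyps by (simp add: inverse_power_prod_def mult_ac)
qed

text \<open>
Nakayama's lemma for finite abelian \<open>p\<close>-groups: every element has the form \<open>h y\<^sup>p\<close> with \<open>h \<in> H\<close>.
Applying this to \<open>y\<close> repeatedly replaces \<open>y\<^sup>p\<close> by the \<open>p\<^sup>i\<close>-th power of an element, which is trivial for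
large \<open>i\<close>.
\<close>

lemma generate_with_powers_imp:
  assumes H: "subgroup H G"
    and gen: "generate G (H \<union> (\<lambda>x. x [^] p) ` carrier G) = carrier G"
  shows "H = carrier G"
proof -
  let ?P = "(\<lambda>x. x [^] p) ` carrier G"
  have Hc: "H \<subseteq> carrier G" using H by (rule subgroup.subset)
  have "subgroup ?P G"
  proof (rule subgroup.intro)
    show "?P \<subseteq> carrier G" by auto
    show "x \<otimes> y \<in> ?P" if "x \<in> ?P" "y \<in> ?P" for x y
      using that by (auto simp flip: pow_mult_distrib simp: m_comm)
    show "\<one> \<in> ?P" by (rule image_eqI[of _ _ "\<one>"]) auto
    show "inv x \<in> ?P" if "x \<in> ?P" for x
      using that by (auto simp: nat_pow_inv[symmetric])
  qed
  then have sub: "subgroup (H <#> ?P) G" by (intro mult_subgroups H)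
  have "H \<subseteq> H <#> ?P" "?P \<subseteq> H <#> ?P"
  proof -
    show "H \<subseteq> H <#> ?P"
    proof
      fix x assume "x \<in> H"
      moreover have "\<one> \<in> ?P" by (rule image_eqI[of _ _ "\<one>"]) auto
      ultimately have "x \<otimes> \<one> \<in> H <#> ?P" unfolding set_mult_def by blast
      then show "x \<in> H <#> ?P" using \<open>x \<in> H\<close> Hc by auto
    qed
    show "?P \<subseteq> H <#> ?P"
    proof
      fix x assume "x \<in> ?P"
      then have "\<one> \<otimes> x \<in> H <#> ?P"
        using subgroup.one_closed[OF H] unfolding set_mult_def by blast
      then show "x \<in> H <#> ?P" using \<open>x \<in> ?P\<close> by auto
    qed
  qed
  then have "carrier G \<subseteq> H <#> ?P" using gen generate_subgroup_incl[OF _ sub] by (metis Un_least)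
  then have step: "\<exists>h\<in>H. \<exists>y\<in>carrier G. x = h \<otimes> y [^] p" if "x \<in> carrier G" for x
    using that unfolding set_mult_def by blast
  have iter: "\<exists>h\<in>H. \<exists>y\<in>carrier G. x = h \<otimes> y [^] (p ^ i)" if "x \<in> carrier G" for x i
  proof (induction i)
    case 0
    show ?case using that subgroup.one_closed[OF H] by (intro bexI[of _ \<one>] bexI[of _ x]) auto
  next
    case (Suc i)
    then obtain h y where hy: "h \<in> H" "y \<in> carrier G" "x = h \<otimes> y [^] (p ^ i)" by blast
    obtain h' z where hz: "h' \<in> H" "z \<in> carrier G" "y = h' \<otimes> z [^] p" using step[OF hy(2)] by blast
    have h': "h' [^] (p ^ i) \<in> H" using hz(1) H by (metis subgroup_int_pow_closed int_pow_int)
    have "x = (h \<otimes> h' [^] (p ^ i)) \<otimes> z [^] (p ^ Suc i)"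
      using hy(1,2) hz(1,2) Hc unfolding hy(3) hz(3)
      by (simp add: nat_pow_distrib nat_pow_pow m_assoc subset_iff)
    then show ?case using hy hz h' subgroup.m_closed[OF H] by blast
  qed
  obtain N where N: "order G = p ^ N" using order_power by blast
  have "carrier G \<subseteq> H"
  proof
    fix x assume "x \<in> carrier G"
    then obtain h y where "h \<in> H" "y \<in> carrier G" "x = h \<otimes> y [^] (p ^ N)" using iter by blast
    then show "x \<in> H" using pow_order_eq_1 Hc by (auto simp flip: N)
  qed
  then show ?thesis using Hc by blast
qed

text \<open>
A maximal proper subgroup contains all \<open>p\<close>-th powers by Nakayama's lemma, so adjoining one
element to it multiplies its order by \<open>p\<close>.
\<close>

lemma obtain_index_p_subgroup:
  assumes H: "subgroup H G" "H \<noteq> carrier G"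
  obtains M where "subgroup M G" "H \<subseteq> M" "order G = p * card M"
proof -
  let ?F = "{M. subgroup M G \<and> H \<subseteq> M \<and> M \<noteq> carrier G}"
  have "?F \<subseteq> Pow (carrier G)" by (auto dest: subgroup.subset)
  then have "finite ?F" by (rule finite_subset) simp
  moreover have "H \<in> ?F" using H by auto
  ultimately obtain M where M: "M \<in> ?F" and max: "\<And>M'. M' \<in> ?F \<Longrightarrow> M \<subseteq> M' \<Longrightarrow> M = M'"
    using finite_has_maximal2[of ?F H] by auto
  have Mc: "M \<subset> carrier G" using M by (auto dest: subgroup.subset)
  \<comment> \<open>Otherwise \<open>M\<close> and the powers would generate a larger subgroup, hence everything.\<close>
  have pow: "x [^] p \<in> M" if "x \<in> carrier G" for x
  proof (rule ccontr)
    assume n: "x [^] p \<notin> M"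
    have s: "subgroup (generate G (M \<union> (\<lambda>x. x [^] p) ` carrier G)) G"
      using Mc by (intro generate_is_subgroup) auto
    have "M \<subset> generate G (M \<union> (\<lambda>x. x [^] p) ` carrier G)"
      using n that by (auto intro!: generate.incl)
    then have "generate G (M \<union> (\<lambda>x. x [^] p) ` carrier G) = carrier G"
      using max[of "generate G (M \<union> (\<lambda>x. x [^] p) ` carrier G)"] s M by blast
    then show False using generate_with_powers_imp M by blast
  qed
  obtain b where b: "b \<in> carrier G" "b \<notin> M" using Mc by blast
  have "subgroup (generate G (insert b M)) G" using Mc b by (intro generate_is_subgroup) auto
  moreover have "M \<subset> generate G (insert b M)" using b by (auto intro: generate.incl)
  ultimately have "generate G (insert b M) = carrier G" using max[of "generate G (insert b M)"] M by blast
  then have "order G = p * card M"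
    using card_generate_insert[of M b] M b pow by (simp add: order_def)
  then show ?thesis using that M by blast
qed

end

section \<open>Homomorphisms and quotients\<close>

lemma (in group_hom) card_fibre:
  assumes "finite (carrier G)" "y \<in> h ` carrier G"
  shows "card {x \<in> carrier G. h x = y} = card (kernel G H h)"
proof -
  obtain a where a: "a \<in> carrier G" "y = h a" using assms by blast
  have "bij_betw (\<lambda>x. a \<otimes> x) (kernel G H h) {x \<in> carrier G. h x = y}"
  proof (rule bij_betwI[where g = "\<lambda>x. inv a \<otimes> x"])
    show "(\<otimes>) a \<in> kernel G H h \<rightarrow> {x \<in> carrier G. h x = y}"
      using a by (auto simp: kernel_def)
    show "(\<otimes>) (inv a) \<in> {x \<in> carrier G. h x = y} \<rightarrow> kernel G H h"
      using a by (auto simp: kernel_def)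
  qed (use a in \<open>auto simp: kernel_def simp flip: G.m_assoc\<close>)
  then show ?thesis by (rule bij_betw_same_card[symmetric])
qed

lemma (in group_hom) card_carrier_eq:
  assumes "finite (carrier G)"
  shows "order G = card (kernel G H h) * card (h ` carrier G)"
proof -
  have "order G = (\<Sum>y\<in>h ` carrier G. card {x \<in> carrier G. h x = y})"
    using sum.image_gen[OF assms, of "\<lambda>_. 1::nat" h] by (simp add: order_def)
  then show ?thesis using card_fibre[OF assms] by simp
qed

lemma (in group_hom) subgroup_vimage_hom:
  "subgroup K H \<Longrightarrow> subgroup {x \<in> carrier G. h x \<in> K} G"
  by (rule subgroup.intro) (auto intro: subgroup.m_closed subgroup.one_closed subgroup.m_inv_closed)

lemma (in group_hom) Mod_vimage_iso:
  assumes "h ` carrier G = carrier H" "K \<lhd> H"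
  shows "G Mod {x \<in> carrier G. h x \<in> K} \<cong> H Mod K"
proof -
  interpret K: normal K H by fact
  let ?f = "(\<lambda>y. K #>\<^bsub>H\<^esub> y) \<circ> h"
  have "?f \<in> hom G (H Mod K)"
    using homh K.r_coset_hom_Mod by (rule Group.hom_compose)
  then interpret f: group_hom G "H Mod K" ?f
    by (intro group_hom.intro group_hom_axioms.intro K.factorgroup_is_group G.is_group)
  have "kernel G (H Mod K) ?f = {x \<in> carrier G. h x \<in> K}"
    unfolding kernel_def
    using H.coset_join1[OF _ _ K.subgroup_axioms] H.coset_join2[OF _ K.subgroup_axioms] by auto
  moreover have "?f ` carrier G = carrier (H Mod K)"
    unfolding image_comp[symmetric] assms(1) carrier_FactGroup ..
  ultimately show ?thesis using f.FactGroup_iso by simp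
qed

lemma (in normal) power_mem_of_Mod_iso:
  assumes iso: "G Mod H \<cong> K" and K: "group K"
    and exp: "\<And>x. x \<in> carrier K \<Longrightarrow> x [^]\<^bsub>K\<^esub> (e::nat) = \<one>\<^bsub>K\<^esub>" and v: "v \<in> carrier G"
  shows "v [^] e \<in> H"
proof -
  obtain h where h: "h \<in> iso (G Mod H) K" using iso by (auto simp: is_iso_def)
  interpret Q: group "G Mod H" by (rule factorgroup_is_group)
  interpret h: group_hom "G Mod H" K h
    using h K by (intro group_hom.intro group_hom_axioms.intro Q.is_group) (auto simp: iso_def)
  have c: "H #> v \<in> carrier (G Mod H)" using v by (auto simp: carrier_FactGroup)
  have "h ((H #> v) [^]\<^bsub>G Mod H\<^esub> e) = h \<one>\<^bsub>G Mod H\<^esub>"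
    using c exp by (simp only: h.hom_nat_pow h.hom_closed h.hom_one)
  moreover have "inj_on h (carrier (G Mod H))" using h by (auto simp: iso_def bij_betw_def)
  ultimately have "(H #> v) [^]\<^bsub>G Mod H\<^esub> e = \<one>\<^bsub>G Mod H\<^esub>"
    using inj_onD[OF _ _ Q.nat_pow_closed[OF c] Q.one_closed] by blast
  then have "H #> (v [^] e) = H" using FactGroup_pow[OF v] by simp
  then show ?thesis using coset_join1[OF _ _ subgroup_axioms] v by simp
qed

lemma (in group_hom) eq_on_generate:
  assumes "group_hom G H h'" "A \<subseteq> carrier G" "\<And>a. a \<in> A \<Longrightarrow> h a = h' a" "x \<in> generate G A"
  shows "h x = h' x"
proof -
  interpret h': group_hom G H h' by fact
  from assms(4) show ?thesis
  proof induction
    case (eng x y)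
    then show ?case using G.generate_in_carrier[OF assms(2)] by simp
  qed (use assms(2,3) in \<open>auto simp: subset_iff\<close>)
qed

lemma (in comm_group) finprod_in_subgroup:
  assumes "subgroup H G" "finite I" "\<And>i. i \<in> I \<Longrightarrow> f i \<in> H"
  shows "finprod G f I \<in> H"
  using assms(2,3)
proof (induction I rule: finite_induct)
  case (insert i I)
  then have "f \<in> I \<rightarrow> carrier G" "f i \<in> carrier G"
    using subgroup.subset[OF assms(1)] by (auto simp: subset_iff)
  then show ?case using insert assms(1) by (simp add: subgroup.m_closed)
qed (use assms(1) subgroup.one_closed in auto)

lemma (in group) int_pow_mod_exponent:
  assumes "x \<in> carrier G" "x [^] (q::nat) = \<one>"
  shows "x [^] (a mod int q) = x [^] a"
proof -
  have "x [^] a = x [^] (int q * (a div int q) + a mod int q)" by simp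
  also have "\<dots> = (x [^] int q) [^] (a div int q) \<otimes> x [^] (a mod int q)"
    using assms(1) by (simp only: int_pow_mult int_pow_pow)
  finally show ?thesis using assms by (simp add: int_pow_int)
qed

section \<open>Free modules over the integers modulo q\<close>

text \<open>
A product over a set of indices and not over a type: the rank is then a term, and the projection
to a smaller set of coordinates is the restriction of functions.
\<close>

definition zmod_vec :: "nat \<Rightarrow> 'i set \<Rightarrow> ('i \<Rightarrow> int) monoid" where
  "zmod_vec q I = product_group I (\<lambda>_. integer_mod_group q)"

lemma carrier_zmod_vec: "0 < q \<Longrightarrow> carrier (zmod_vec q I) = (\<Pi>\<^sub>E i\<in>I. {0..<int q})"
  by (simp add: zmod_vec_def carrier_integer_mod_group)

lemma mult_zmod_vec: "x \<otimes>\<^bsub>zmod_vec q I\<^esub> y = (\<lambda>i\<in>I. (x i + y i) mod int q)"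
  by (simp add: zmod_vec_def)

lemma one_zmod_vec: "\<one>\<^bsub>zmod_vec q I\<^esub> = (\<lambda>i\<in>I. 0)"
  by (simp add: zmod_vec_def)

lemma restrict_mod_in_zmod_vec: "0 < q \<Longrightarrow> (\<lambda>i\<in>I. f i mod int q) \<in> carrier (zmod_vec q I)"
  by (auto simp: carrier_zmod_vec)

lemma comm_group_zmod_vec: "comm_group (zmod_vec q I)"
proof -
  interpret group "zmod_vec q I" unfolding zmod_vec_def by (intro product_group) simp
  show ?thesis
    by (intro group_comm_groupI) (auto simp: mult_zmod_vec add.commute)
qed

lemma order_zmod_vec: "0 < q \<Longrightarrow> finite I \<Longrightarrow> order (zmod_vec q I) = q ^ card I"
  by (simp add: order_def carrier_zmod_vec card_PiE)

lemma pow_zmod_vec: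
  assumes "0 < q" "x \<in> carrier (zmod_vec q I)"
  shows "x [^]\<^bsub>zmod_vec q I\<^esub> (n::nat) = (\<lambda>i\<in>I. (int n * x i) mod int q)"
proof (induction n)
  case 0
  show ?case by (simp add: one_zmod_vec)
next
  case (Suc n)
  have "x [^]\<^bsub>zmod_vec q I\<^esub> Suc n = (\<lambda>i\<in>I. (int n * x i) mod int q) \<otimes>\<^bsub>zmod_vec q I\<^esub> x"
    unfolding nat_pow_Suc Suc ..
  also have "\<dots> = (\<lambda>i\<in>I. (int (Suc n) * x i) mod int q)"
    unfolding mult_zmod_vec by (intro restrict_ext) (simp add: mod_add_left_eq mod_add_right_eq distrib_right add.commute)
  finally show ?case .
qed

lemma int_pow_zmod_vec:
  assumes "0 < q" "x \<in> carrier (zmod_vec q I)"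
  shows "x [^]\<^bsub>zmod_vec q I\<^esub> (a::int) = (\<lambda>i\<in>I. (a * x i) mod int q)"
proof -
  interpret comm_group "zmod_vec q I" by (rule comm_group_zmod_vec)
  have "x [^]\<^bsub>zmod_vec q I\<^esub> q = \<one>\<^bsub>zmod_vec q I\<^esub>"
    using assms by (simp add: pow_zmod_vec one_zmod_vec)
  then have "x [^]\<^bsub>zmod_vec q I\<^esub> a = x [^]\<^bsub>zmod_vec q I\<^esub> (a mod int q)"
    using int_pow_mod_exponent[OF assms(2)] by simp
  also have "\<dots> = x [^]\<^bsub>zmod_vec q I\<^esub> nat (a mod int q)"
    using int_pow_int[of "zmod_vec q I" x "nat (a mod int q)"] assms by simp
  also have "\<dots> = (\<lambda>i\<in>I. (a * x i) mod int q)"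
    unfolding pow_zmod_vec[OF assms] using assms(1) by (intro restrict_ext) (simp add: mod_simps)
  finally show ?thesis .
qed

lemma finprod_zmod_vec:
  assumes "0 < q" "finite J" "\<And>j. j \<in> J \<Longrightarrow> f j \<in> carrier (zmod_vec q I)"
  shows "finprod (zmod_vec q I) f J = (\<lambda>i\<in>I. (\<Sum>j\<in>J. f j i) mod int q)"
proof -
  interpret comm_group "zmod_vec q I" by (rule comm_group_zmod_vec)
  show ?thesis using assms(2,3)
  proof (induction J rule: finite_induct)
    case (insert j J)
    then have "f \<in> J \<rightarrow> carrier (zmod_vec q I)" "f j \<in> carrier (zmod_vec q I)" by auto
    then have "finprod (zmod_vec q I) f (insert j J) = f j \<otimes>\<^bsub>zmod_vec q I\<^esub> finprod (zmod_vec q I) f J"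
      by (intro finprod_insert insert.hyps)
    also have "finprod (zmod_vec q I) f J = (\<lambda>i\<in>I. (\<Sum>j\<in>J. f j i) mod int q)"
      by (rule insert.IH) (use insert.prems in auto)
    also have "f j \<otimes>\<^bsub>zmod_vec q I\<^esub> \<dots> = (\<lambda>i\<in>I. (\<Sum>j\<in>insert j J. f j i) mod int q)"
      unfolding mult_zmod_vec using insert.hyps by (intro restrict_ext) (simp add: mod_add_right_eq)
    finally show ?case .
  qed (simp add: one_zmod_vec)
qed

lemma zmod_vec_pow_card:
  "0 < q \<Longrightarrow> x \<in> carrier (zmod_vec q I) \<Longrightarrow> x [^]\<^bsub>zmod_vec q I\<^esub> q = \<one>\<^bsub>zmod_vec q I\<^esub>"
  by (simp add: pow_zmod_vec one_zmod_vec)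

lemma zmod_vec_pgroup:
  assumes "Factorial_Ring.prime (p::nat)" "finite I"
  shows "finite_abelian_pgroup (zmod_vec (p ^ m) I) p"
proof -
  have "0 < p ^ m" using assms(1) by (simp add: prime_gt_0_nat)
  moreover have "order (zmod_vec (p ^ m) I) = p ^ (m * card I)"
    using calculation assms(2) by (simp add: order_zmod_vec power_mult)
  ultimately show ?thesis
    using assms by (intro finite_abelian_pgroup.intro finite_abelian_pgroup_axioms.intro comm_group_zmod_vec)
      (auto simp: carrier_zmod_vec intro!: finite_PiE)
qed

text \<open>
If all \<open>g i\<close> are killed by \<open>q\<close>, this is the homomorphism from \<open>(\<int>/q)\<^sup>I\<close> that sends the unit vectors to the
\<open>g i\<close>.
\<close>

definition lincomb :: "('a, 'b) monoid_scheme \<Rightarrow> 'i set \<Rightarrow> ('i \<Rightarrow> 'a) \<Rightarrow> ('i \<Rightarrow> int) \<Rightarrow> 'a" where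
  "lincomb G I g x = finprod G (\<lambda>i. g i [^]\<^bsub>G\<^esub> x i) I"

definition unit_zmod_vec :: "nat \<Rightarrow> 'i set \<Rightarrow> 'i \<Rightarrow> 'i \<Rightarrow> int" where
  "unit_zmod_vec q I i = (\<lambda>j\<in>I. if j = i then 1 mod int q else 0)"

lemma unit_zmod_vec_carrier: "0 < q \<Longrightarrow> unit_zmod_vec q I i \<in> carrier (zmod_vec q I)"
  by (auto simp: unit_zmod_vec_def carrier_zmod_vec)

context comm_group
begin

lemma lincomb_hom:
  assumes "finite I" "0 < q" "\<And>i. i \<in> I \<Longrightarrow> g i \<in> carrier G" "\<And>i. i \<in> I \<Longrightarrow> g i [^] (q::nat) = \<one>"
  shows "group_hom (zmod_vec q I) G (lincomb G I g)"
proof -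
  interpret Z: comm_group "zmod_vec q I" by (rule comm_group_zmod_vec)
  have "lincomb G I g \<in> hom (zmod_vec q I) G"
  proof (rule homI)
    show "lincomb G I g x \<in> carrier G" for x
      unfolding lincomb_def by (intro finprod_closed Pi_I int_pow_closed assms(3))
    fix x y
    have "lincomb G I g (x \<otimes>\<^bsub>zmod_vec q I\<^esub> y) = finprod G (\<lambda>i. g i [^] x i \<otimes> g i [^] y i) I"
      unfolding lincomb_def
    proof (rule finprod_cong'[OF refl])
      show "g i [^] (x \<otimes>\<^bsub>zmod_vec q I\<^esub> y) i = g i [^] x i \<otimes> g i [^] y i" if "i \<in> I" for i
        using that assms(3)[OF that] int_pow_mod_exponent[OF assms(3,4)[OF that]]
        by (simp add: mult_zmod_vec int_pow_mult)
    qed (use assms(3) in auto)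
    also have "\<dots> = lincomb G I g x \<otimes> lincomb G I g y"
      unfolding lincomb_def by (intro finprod_multf Pi_I int_pow_closed assms(3))
    finally show "lincomb G I g (x \<otimes>\<^bsub>zmod_vec q I\<^esub> y) = lincomb G I g x \<otimes> lincomb G I g y" .
  qed
  then show ?thesis by (intro group_hom.intro group_hom_axioms.intro Z.is_group is_group)
qed

lemma lincomb_unit:
  assumes "finite I" "\<And>i. i \<in> I \<Longrightarrow> g i \<in> carrier G" "\<And>i. i \<in> I \<Longrightarrow> g i [^] (q::nat) = \<one>" "i \<in> I"
  shows "lincomb G I g (unit_zmod_vec q I i) = g i"
proof -
  have "lincomb G I g (unit_zmod_vec q I i) = finprod G (\<lambda>j. if i = j then g j else \<one>) I"
    unfolding lincomb_def
  proof (rule finprod_cong'[OF refl])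
    show "g j [^] unit_zmod_vec q I i j = (if i = j then g j else \<one>)" if "j \<in> I" for j
      using that assms(2,3) int_pow_mod_exponent[of "g j" q 1] by (simp add: unit_zmod_vec_def)
  qed (use assms in auto)
  also have "\<dots> = g i" using assms by (intro finprod_singleton) auto
  finally show ?thesis .
qed

lemma lincomb_image:
  assumes "finite I" "0 < q" "\<And>i. i \<in> I \<Longrightarrow> g i \<in> carrier G" "\<And>i. i \<in> I \<Longrightarrow> g i [^] (q::nat) = \<one>"
  shows "lincomb G I g ` carrier (zmod_vec q I) = generate G (g ` I)"
proof
  have sub: "subgroup (generate G (g ` I)) G" using assms(3) by (intro generate_is_subgroup) auto
  show "lincomb G I g ` carrier (zmod_vec q I) \<subseteq> generate G (g ` I)"
    unfolding lincomb_def
    by (intro image_subsetI finprod_in_subgroup[OF sub assms(1)] subgroup_int_pow_closed[OF sub]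
        generate.incl imageI)
  interpret h: group_hom "zmod_vec q I" G "lincomb G I g" by (rule lincomb_hom[OF assms])
  show "generate G (g ` I) \<subseteq> lincomb G I g ` carrier (zmod_vec q I)"
  proof (rule generate_subgroup_incl[OF _ h.img_is_subgroup])
    show "g ` I \<subseteq> lincomb G I g ` carrier (zmod_vec q I)"
    proof (rule image_subsetI)
      fix i assume "i \<in> I"
      from lincomb_unit[of I g q i, OF assms(1,3,4) this] show "g i \<in> lincomb G I g ` carrier (zmod_vec q I)"
        using unit_zmod_vec_carrier[OF assms(2)] by (intro image_eqI[where x = "unit_zmod_vec q I i"]) simp_all
    qed
  qed
qed

end

lemma lincomb_unit_zmod_vec:
  assumes "finite I" "0 < q" "x \<in> carrier (zmod_vec q I)"
  shows "lincomb (zmod_vec q I) I (unit_zmod_vec q I) x = x"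
proof -
  have x: "x \<in> (\<Pi>\<^sub>E i\<in>I. {0..<int q})" using assms by (simp add: carrier_zmod_vec)
  have "lincomb (zmod_vec q I) I (unit_zmod_vec q I) x =
    (\<lambda>i\<in>I. (\<Sum>j\<in>I. (x j * unit_zmod_vec q I j i) mod int q) mod int q)"
    unfolding lincomb_def int_pow_zmod_vec[OF assms(2) unit_zmod_vec_carrier[OF assms(2)]]
      finprod_zmod_vec[OF assms(2,1) restrict_mod_in_zmod_vec[OF assms(2)]]
    by (intro restrict_ext) simp
  also have "\<dots> = (\<lambda>i\<in>I. x i)"
  proof (rule restrict_ext)
    fix i assume i: "i \<in> I"
    have "(\<Sum>j\<in>I. (x j * unit_zmod_vec q I j i) mod int q) = (\<Sum>j\<in>I. if i = j then x j else 0)"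
      using i x by (intro sum.cong) (auto simp: unit_zmod_vec_def mod_simps PiE_iff)
    also have "\<dots> = x i" using i assms(1) by simp
    finally show "(\<Sum>j\<in>I. (x j * unit_zmod_vec q I j i) mod int q) mod int q = x i"
      using i x by (auto simp: PiE_iff)
  qed
  also have "\<dots> = x" using x by (auto simp: PiE_iff extensional_restrict)
  finally show ?thesis .
qed

lemma generate_unit_zmod_vec:
  assumes "finite I" "0 < q"
  shows "generate (zmod_vec q I) (unit_zmod_vec q I ` I) = carrier (zmod_vec q I)"
proof -
  interpret comm_group "zmod_vec q I" by (rule comm_group_zmod_vec)
  have "lincomb (zmod_vec q I) I (unit_zmod_vec q I) ` carrier (zmod_vec q I) = carrier (zmod_vec q I)"
    using lincomb_unit_zmod_vec[OF assms] by (auto simp: image_iff)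
  then show ?thesis
    using lincomb_image[OF assms, of "unit_zmod_vec q I"] assms
    by (simp add: unit_zmod_vec_carrier zmod_vec_pow_card)
qed

lemma group_hom_restrict_zmod_vec:
  assumes "J \<subseteq> I"
  shows "group_hom (zmod_vec q I) (zmod_vec q J) (\<lambda>x. restrict x J)"
proof -
  have "(\<lambda>x. restrict x J) \<in> hom (zmod_vec q I) (zmod_vec q J)"
  proof (rule homI)
    fix x y
    show "restrict (x \<otimes>\<^bsub>zmod_vec q I\<^esub> y) J = restrict x J \<otimes>\<^bsub>zmod_vec q J\<^esub> restrict y J"
      unfolding mult_zmod_vec using assms by (simp add: restrict_def fun_eq_iff subset_iff)
  qed (use assms in \<open>auto simp: zmod_vec_def\<close>)
  then show ?thesis
    by (intro group_hom.intro group_hom_axioms.intro comm_group.axioms(2)[OF comm_group_zmod_vec])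
qed

lemma restrict_zmod_vec_surj:
  assumes "J \<subseteq> I" "0 < q"
  shows "(\<lambda>x. restrict x J) ` carrier (zmod_vec q I) = carrier (zmod_vec q J)"
proof
  show "(\<lambda>x. restrict x J) ` carrier (zmod_vec q I) \<subseteq> carrier (zmod_vec q J)"
    using group_hom.hom_closed[OF group_hom_restrict_zmod_vec[OF assms(1)]] by auto
  show "carrier (zmod_vec q J) \<subseteq> (\<lambda>x. restrict x J) ` carrier (zmod_vec q I)"
  proof
    fix y assume y: "y \<in> carrier (zmod_vec q J)"
    then have "(\<lambda>i\<in>I. if i \<in> J then y i else 0) \<in> carrier (zmod_vec q I)"
      using assms by (auto simp: carrier_zmod_vec PiE_iff)
    moreover have "restrict (\<lambda>i\<in>I. if i \<in> J then y i else 0) J = y"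
    proof
      fix j
      show "restrict (\<lambda>i\<in>I. if i \<in> J then y i else 0) J j = y j"
        using y assms PiE_arb[of y J "\<lambda>_. {0..<int q}" j] by (cases "j \<in> J") (auto simp: carrier_zmod_vec)
    qed
    ultimately show "y \<in> (\<lambda>x. restrict x J) ` carrier (zmod_vec q I)"
      by (intro image_eqI[where f = "\<lambda>x. restrict x J"]) (rule sym)
  qed
qed

lemma card_torsion_zmod_vec:
  assumes "0 < p" "0 < r" "finite I"
  shows "card {x \<in> carrier (zmod_vec (p * r) I). x [^]\<^bsub>zmod_vec (p * r) I\<^esub> p = \<one>\<^bsub>zmod_vec (p * r) I\<^esub>} = p ^ card I"
    and "x \<in> carrier (zmod_vec (p * r) I) \<Longrightarrow> x [^]\<^bsub>zmod_vec (p * r) I\<^esub> p = \<one>\<^bsub>zmod_vec (p * r) I\<^esub> \<Longrightarrow>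
      \<exists>y \<in> carrier (zmod_vec (p * r) I). x = y [^]\<^bsub>zmod_vec (p * r) I\<^esub> r"
proof -
  let ?A = "zmod_vec (p * r) I"
  let ?T = "(\<lambda>c. int r * c) ` {0..<int p}"
  have T: "a \<in> {0..<int (p * r)} \<and> (int p * a) mod int (p * r) = 0 \<longleftrightarrow> a \<in> ?T" for a
  proof
    assume a: "a \<in> {0..<int (p * r)} \<and> (int p * a) mod int (p * r) = 0"
    then have "int p * int r dvd int p * a" by (auto simp: mod_eq_0_iff_dvd)
    then obtain c where c: "a = int r * c" using assms by (auto simp: dvd_def)
    then have "0 \<le> c" "c < int p"
      using a assms by (auto simp: zero_le_mult_iff mult.commute[of "int p"])
    then show "a \<in> ?T" using c by auto
  qed (use assms in \<open>auto simp: mult.commute[of "int p"] mult.left_commute\<close>)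
  have eq: "{x \<in> carrier ?A. x [^]\<^bsub>?A\<^esub> p = \<one>\<^bsub>?A\<^esub>} = (\<Pi>\<^sub>E i\<in>I. ?T)" (is "?L = ?R")
  proof (rule Set.set_eqI)
    fix x
    have "x \<in> ?L \<longleftrightarrow> x \<in> extensional I \<and> (\<forall>i\<in>I. x i \<in> {0..<int (p * r)} \<and> (int p * x i) mod int (p * r) = 0)"
      using assms by (auto simp: carrier_zmod_vec pow_zmod_vec one_zmod_vec PiE_iff fun_eq_iff restrict_def)
    also have "\<dots> \<longleftrightarrow> x \<in> ?R" unfolding T by (auto simp: PiE_iff)
    finally show "x \<in> ?L \<longleftrightarrow> x \<in> ?R" .
  qed
  have "card ?T = p" using assms by (subst card_image) (auto simp: inj_on_def)
  then show "card {x \<in> carrier ?A. x [^]\<^bsub>?A\<^esub> p = \<one>\<^bsub>?A\<^esub>} = p ^ card I"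
    unfolding eq using assms by (simp add: card_PiE)
  assume x: "x \<in> carrier ?A" "x [^]\<^bsub>?A\<^esub> p = \<one>\<^bsub>?A\<^esub>"
  then have "x \<in> ?R" using eq by blast
  then have "\<forall>i\<in>I. \<exists>c. c \<in> {0..<int p} \<and> x i = int r * c" by (fastforce simp: PiE_iff)
  then obtain y where y: "\<And>i. i \<in> I \<Longrightarrow> y i \<in> {0..<int p} \<and> x i = int r * y i" by metis
  have "int p \<le> int p * int r" using assms by simp
  then have lt: "y i < int p * int r" if "i \<in> I" for i using y[OF that] by (auto intro: less_le_trans)
  have yc: "restrict y I \<in> carrier ?A" using y lt assms by (auto simp: carrier_zmod_vec)
  have "(restrict y I) [^]\<^bsub>?A\<^esub> r = (\<lambda>i\<in>I. x i)"
  proof -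
    have "(int r * y i) mod int (p * r) = x i" if "i \<in> I" for i
      using x(1) y[OF that] that assms by (auto simp: carrier_zmod_vec PiE_iff)
    then show ?thesis
      using assms by (subst pow_zmod_vec[OF _ yc]) (auto intro!: restrict_ext)
  qed
  also have "\<dots> = x" using x(1) assms by (auto simp: carrier_zmod_vec PiE_iff extensional_restrict)
  finally show "\<exists>y \<in> carrier ?A. x = y [^]\<^bsub>?A\<^esub> r" using yc by metis
qed

text \<open>
The map \<open>x \<mapsto> x\<^sup>p\<close> on \<open>L\<close> has the full \<open>p\<close>-torsion of \<open>(\<int>/q)\<^sup>I\<close> as its kernel, of order \<open>p\<close> to the
number of coordinates. So \<open>L\<close> needs as many generators as the whole group, like a sublattice of
finite index.
\<close>

lemma index_powers_of_subgroup:
  assumes p: "Factorial_Ring.prime (p::nat)" and q: "q = p * r" "0 < r" and I: "finite I"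
    and L: "subgroup L (zmod_vec q I)"
    and tors: "\<And>x. x \<in> carrier (zmod_vec q I) \<Longrightarrow> x [^]\<^bsub>zmod_vec q I\<^esub> p = \<one>\<^bsub>zmod_vec q I\<^esub> \<Longrightarrow> x \<in> L"
  shows "card L = p ^ card I * card ((\<lambda>x. x [^]\<^bsub>zmod_vec q I\<^esub> p) ` L)"
    and "subgroup ((\<lambda>x. x [^]\<^bsub>zmod_vec q I\<^esub> p) ` L) (zmod_vec q I)"
proof -
  let ?A = "zmod_vec q I"
  interpret A: comm_group ?A by (rule comm_group_zmod_vec)
  have p0: "0 < p" using p by (rule prime_gt_0_nat)
  have Lc: "L \<subseteq> carrier ?A" using L by (rule subgroup.subset)
  interpret L: group "?A\<lparr>carrier := L\<rparr>" using L by (rule A.subgroup_imp_group)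
  interpret h: group_hom "?A\<lparr>carrier := L\<rparr>" ?A "\<lambda>x. x [^]\<^bsub>?A\<^esub> p"
    using Lc by unfold_locales (auto simp: hom_def A.nat_pow_distrib subset_iff)
  have "finite (carrier ?A)" using I p0 q by (simp add: carrier_zmod_vec finite_PiE)
  then have "finite L" using Lc by (rule finite_subset[rotated])
  then have "card L = card (kernel (?A\<lparr>carrier := L\<rparr>) ?A (\<lambda>x. x [^]\<^bsub>?A\<^esub> p)) * card ((\<lambda>x. x [^]\<^bsub>?A\<^esub> p) ` L)"
    using h.card_carrier_eq by (simp add: order_def)
  also have "kernel (?A\<lparr>carrier := L\<rparr>) ?A (\<lambda>x. x [^]\<^bsub>?A\<^esub> p) = {x \<in> carrier ?A. x [^]\<^bsub>?A\<^esub> p = \<one>\<^bsub>?A\<^esub>}"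
    using Lc tors by (auto simp: kernel_def)
  finally show "card L = p ^ card I * card ((\<lambda>x. x [^]\<^bsub>?A\<^esub> p) ` L)"
    using card_torsion_zmod_vec(1)[OF p0 q(2) I] q(1) by simp
  show "subgroup ((\<lambda>x. x [^]\<^bsub>?A\<^esub> p) ` L) ?A" using h.img_is_subgroup by simp
qed

text \<open>
The assumption \<open>good\<close> says that the vectors \<open>Y j\<close> are independent modulo \<open>p\<close>. They can be
completed to a generating family indexed by \<open>J1 \<union> J2\<close>. This family is a basis, because a surjective
endomorphism of a finite group is bijective, and \<open>\<pi>\<close> reads the coordinates at the added vectors.
\<close>

lemma exists_projection_killing:
  assumes p: "Factorial_Ring.prime (p::nat)" and q: "q = p ^ Suc m" and J: "finite J1" "finite J2" "J1 \<inter> J2 = {}"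
    and Y: "Y \<in> J2 \<rightarrow> carrier (zmod_vec q (J1 \<union> J2))"
    and good: "p ^ card J1 * card (generate (zmod_vec q (J1 \<union> J2))
        ((\<lambda>x. x [^]\<^bsub>zmod_vec q (J1 \<union> J2)\<^esub> p) ` carrier (zmod_vec q (J1 \<union> J2)) \<union> Y ` J2)) =
      order (zmod_vec q (J1 \<union> J2))"
  obtains \<pi> where "group_hom (zmod_vec q (J1 \<union> J2)) (zmod_vec q J1) \<pi>"
    "\<pi> ` carrier (zmod_vec q (J1 \<union> J2)) = carrier (zmod_vec q J1)"
    "kernel (zmod_vec q (J1 \<union> J2)) (zmod_vec q J1) \<pi> = generate (zmod_vec q (J1 \<union> J2)) (Y ` J2)"
proof -
  let ?I = "J1 \<union> J2"
  let ?A = "zmod_vec q ?I"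
  let ?pA = "(\<lambda>x. x [^]\<^bsub>?A\<^esub> p) ` carrier ?A"
  interpret A: finite_abelian_pgroup ?A p unfolding q using p J by (intro zmod_vec_pgroup) auto
  interpret B: comm_group "zmod_vec q J1" by (rule comm_group_zmod_vec)
  have q0: "0 < q" unfolding q using p by (simp add: prime_gt_0_nat)
  have Yc: "Y ` J2 \<subseteq> carrier ?A" using Y by auto
  let ?S = "generate ?A (?pA \<union> Y ` J2)"
  have S: "subgroup ?S ?A" using Yc by (intro A.generate_is_subgroup) auto
  have powS: "x [^]\<^bsub>?A\<^esub> p \<in> ?S" if "x \<in> carrier ?A" for x using that by (auto intro: generate.incl)
  have "0 < inverse_power_prod p (card J1) * real (order ?A) ^ card J1"
    using A.p_gt_1 A.finite_carrier A.order_gt_0_iff_finite by (simp add: inverse_power_prod_pos)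
  then have "0 < real (card {w \<in> PiE J1 (\<lambda>_. carrier ?A). generate ?A (?S \<union> w ` J1) = carrier ?A})"
    using A.card_generating_tuples_full[OF J(1) S powS] good by simp
  then have "{w \<in> PiE J1 (\<lambda>_. carrier ?A). generate ?A (?S \<union> w ` J1) = carrier ?A} \<noteq> {}"
    by (metis card.empty of_nat_0 less_irrefl)
  then obtain w where w: "w \<in> PiE J1 (\<lambda>_. carrier ?A)" "generate ?A (?S \<union> w ` J1) = carrier ?A" by auto
  let ?g = "\<lambda>i. if i \<in> J1 then w i else Y i"
  have wc: "w ` J1 \<subseteq> carrier ?A" using w by auto
  have gimg: "?g ` ?I = Y ` J2 \<union> w ` J1" using J(3) by (auto simp: image_iff)
  have gc: "?g i \<in> carrier ?A" if "i \<in> ?I" for i using that w Y by auto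
  have "generate ?A (?g ` ?I) = carrier ?A"
  proof (rule A.generate_with_powers_imp)
    show "subgroup (generate ?A (?g ` ?I)) ?A" by (intro A.generate_is_subgroup image_subsetI gc)
    have "generate ?A (generate ?A (?g ` ?I) \<union> ?pA) = generate ?A (?g ` ?I \<union> ?pA)"
      by (intro A.generate_generate_Un image_subsetI gc) auto
    also have "?g ` ?I \<union> ?pA = (?pA \<union> Y ` J2) \<union> w ` J1" unfolding gimg by auto
    also have "generate ?A \<dots> = carrier ?A"
      using w(2) A.generate_generate_Un[of "?pA \<union> Y ` J2" "w ` J1"] Yc wc by auto
    finally show "generate ?A (generate ?A (?g ` ?I) \<union> ?pA) = carrier ?A" .
  qed
  define \<psi> where "\<psi> = lincomb ?A ?I ?g"
  have gq: "?g i [^]\<^bsub>?A\<^esub> q = \<one>\<^bsub>?A\<^esub>" if "i \<in> ?I" for i using zmod_vec_pow_card[OF q0 gc[OF that]] .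
  interpret \<psi>: group_hom ?A ?A \<psi>
    unfolding \<psi>_def by (rule A.lincomb_hom[OF _ q0 gc gq]) (use J in auto)
  have surj: "\<psi> ` carrier ?A = carrier ?A"
    unfolding \<psi>_def using A.lincomb_image[of ?I q ?g, OF _ q0 gc gq] J \<open>generate ?A (?g ` ?I) = carrier ?A\<close> by simp
  then have "bij_betw \<psi> (carrier ?A) (carrier ?A)"
    by (simp add: bij_betw_def eq_card_imp_inj_on)
  then have iso: "\<psi> \<in> iso ?A ?A" using \<psi>.homh by (simp add: iso_def)
  define \<theta> where "\<theta> = inv_into (carrier ?A) \<psi>"
  have \<theta>: "\<theta> \<in> iso ?A ?A" unfolding \<theta>_def using iso by (rule A.iso_set_sym)
  have \<theta>\<psi>: "\<theta> (\<psi> x) = x" if "x \<in> carrier ?A" for x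
    unfolding \<theta>_def using iso that by (auto simp: iso_def bij_betw_def)
  have \<psi>\<theta>: "\<psi> (\<theta> x) = x" if "x \<in> carrier ?A" for x
    unfolding \<theta>_def using surj that by (simp add: f_inv_into_f)
  interpret r: group_hom ?A "zmod_vec q J1" "\<lambda>x. restrict x J1"
    by (rule group_hom_restrict_zmod_vec) auto
  define \<pi> where "\<pi> = (\<lambda>x. restrict x J1) \<circ> \<theta>"
  have "\<pi> \<in> hom ?A (zmod_vec q J1)"
    unfolding \<pi>_def using \<theta> r.homh by (intro Group.hom_compose) (auto simp: iso_def)
  then have hom: "group_hom ?A (zmod_vec q J1) \<pi>"
    by (intro group_hom.intro group_hom_axioms.intro) auto
  then interpret \<pi>: group_hom ?A "zmod_vec q J1" \<pi> .
  have "\<theta> ` carrier ?A = carrier ?A" using \<theta> by (auto simp: iso_def bij_betw_def)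
  then have "\<pi> ` carrier ?A = carrier (zmod_vec q J1)"
    unfolding \<pi>_def image_comp[symmetric] using restrict_zmod_vec_surj[of J1 ?I q] q0 by simp
  moreover have "kernel ?A (zmod_vec q J1) \<pi> = generate ?A (Y ` J2)"
  proof
    have subY: "subgroup (generate ?A (Y ` J2)) ?A" using Yc by (rule A.generate_is_subgroup)
    show "kernel ?A (zmod_vec q J1) \<pi> \<subseteq> generate ?A (Y ` J2)"
    proof
      fix x assume x: "x \<in> kernel ?A (zmod_vec q J1) \<pi>"
      then have xc: "x \<in> carrier ?A" and "restrict (\<theta> x) J1 = (\<lambda>i\<in>J1. 0)"
        by (auto simp: kernel_def \<pi>_def one_zmod_vec)
      then have z: "\<theta> x i = 0" if "i \<in> J1" for i using that by (metis restrict_apply')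
      have "\<psi> (\<theta> x) \<in> generate ?A (Y ` J2)"
        unfolding \<psi>_def lincomb_def
      proof (rule A.finprod_in_subgroup[OF subY])
        fix i assume i: "i \<in> ?I"
        show "?g i [^]\<^bsub>?A\<^esub> \<theta> x i \<in> generate ?A (Y ` J2)"
        proof (cases "i \<in> J1")
          case True
          then show ?thesis using z gc[OF i] subgroup.one_closed[OF subY] by simp
        next
          case False
          then show ?thesis using i by (auto intro!: A.subgroup_int_pow_closed[OF subY] intro: generate.incl)
        qed
      qed (use J in auto)
      then show "x \<in> generate ?A (Y ` J2)" using \<psi>\<theta>[OF xc] by simp
    qed
    show "generate ?A (Y ` J2) \<subseteq> kernel ?A (zmod_vec q J1) \<pi>"
    proof (rule A.generate_subgroup_incl[OF _ \<pi>.subgroup_kernel], safe)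
      fix j assume j: "j \<in> J2"
      have uc: "unit_zmod_vec q ?I j \<in> carrier ?A" using q0 by (rule unit_zmod_vec_carrier)
      have "\<psi> (unit_zmod_vec q ?I j) = ?g j"
        unfolding \<psi>_def by (rule A.lincomb_unit[OF _ gc gq]) (use J j in auto)
      then have "\<psi> (unit_zmod_vec q ?I j) = Y j" using j J(3) by auto
      then have "\<theta> (Y j) = unit_zmod_vec q ?I j" using \<theta>\<psi>[OF uc] by simp
      then have "\<pi> (Y j) = \<one>\<^bsub>zmod_vec q J1\<^esub>"
        using j J(3) by (auto simp: \<pi>_def one_zmod_vec unit_zmod_vec_def intro!: restrict_ext)
      then show "Y j \<in> kernel ?A (zmod_vec q J1) \<pi>" using j Yc by (auto simp: kernel_def)
    qed
  qed
  ultimately show ?thesis using that hom by blast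
qed

section \<open>The cokernel of a uniform square matrix\<close>

text \<open>
The elements \<open>g j\<close> are the images of the unit vectors under the projection to the quotient, followed
by the isomorphism.
\<close>

lemma quotient_iso_generators:
  fixes K :: "('k, 'l) monoid_scheme"
  assumes K: "comm_group K" and J: "finite J" and q: "0 < (q::nat)"
    and L: "subgroup L (zmod_vec q J)" and iso: "zmod_vec q J Mod L \<cong> K"
  obtains g where "g \<in> PiE J (\<lambda>_. carrier K)" "\<And>j. j \<in> J \<Longrightarrow> g j [^]\<^bsub>K\<^esub> q = \<one>\<^bsub>K\<^esub>"
    "generate K (g ` J) = carrier K" "kernel (zmod_vec q J) K (lincomb K J g) = L"
proof -
  let ?A = "zmod_vec q J"
  interpret A: comm_group ?A by (rule comm_group_zmod_vec)
  interpret K: comm_group K by (rule K)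
  interpret L: normal L ?A using L by (rule A.subgroup_imp_normal)
  obtain h where h: "h \<in> iso (?A Mod L) K" using iso by (auto simp: is_iso_def)
  define F where "F = h \<circ> (\<lambda>x. L #>\<^bsub>?A\<^esub> x)"
  have "F \<in> hom ?A K"
    unfolding F_def using L.r_coset_hom_Mod h by (intro Group.hom_compose) (auto simp: iso_def)
  then interpret F: group_hom ?A K F by (intro group_hom.intro group_hom_axioms.intro A.is_group K.is_group)
  have surj: "F ` carrier ?A = carrier K"
    unfolding F_def image_comp[symmetric] carrier_FactGroup[symmetric] using h by (auto simp: iso_def bij_betw_def)
  interpret Q: group "?A Mod L" by (rule L.factorgroup_is_group)
  interpret h: group_hom "?A Mod L" K h
    using h by (intro group_hom.intro group_hom_axioms.intro Q.is_group K.is_group) (auto simp: iso_def)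
  have ker: "kernel ?A K F = L"
  proof -
    have "F x = \<one>\<^bsub>K\<^esub> \<longleftrightarrow> x \<in> L" if x: "x \<in> carrier ?A" for x
    proof -
      have inj: "inj_on h (carrier (?A Mod L))" using h by (auto simp: iso_def bij_betw_def)
      have c: "L #>\<^bsub>?A\<^esub> x \<in> carrier (?A Mod L)" "L \<in> carrier (?A Mod L)"
        using x Q.one_closed by (auto simp: carrier_FactGroup)
      have "F x = \<one>\<^bsub>K\<^esub> \<longleftrightarrow> h (L #>\<^bsub>?A\<^esub> x) = h L"
        using h.hom_one by (simp add: F_def)
      also have "\<dots> \<longleftrightarrow> L #>\<^bsub>?A\<^esub> x = L" using inj c by (auto dest: inj_onD)
      also have "\<dots> \<longleftrightarrow> x \<in> L"
        using A.coset_join1[OF _ x L.subgroup_axioms] A.coset_join2[OF x L.subgroup_axioms] by blast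
      finally show ?thesis .
    qed
    then show ?thesis using L.subset by (auto simp: kernel_def)
  qed
  define g where "g = (\<lambda>j\<in>J. F (unit_zmod_vec q J j))"
  have gc: "g j \<in> carrier K" if "j \<in> J" for j
    using that unit_zmod_vec_carrier[OF q, of J j] by (simp add: g_def)
  have gq: "g j [^]\<^bsub>K\<^esub> q = \<one>\<^bsub>K\<^esub>" if "j \<in> J" for j
    using that unit_zmod_vec_carrier[OF q, of J j] zmod_vec_pow_card[OF q unit_zmod_vec_carrier[OF q], of J j]
    by (simp add: g_def flip: F.hom_nat_pow)
  interpret l: group_hom ?A K "lincomb K J g" by (rule K.lincomb_hom[OF J q gc gq])
  have eq: "lincomb K J g x = F x" if "x \<in> carrier ?A" for x
  proof (rule l.eq_on_generate[OF F.group_hom_axioms])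
    show "x \<in> generate ?A (unit_zmod_vec q J ` J)" using generate_unit_zmod_vec[OF J q] that by simp
    show "lincomb K J g a = F a" if "a \<in> unit_zmod_vec q J ` J" for a
      using that K.lincomb_unit[of J g q, OF J gc gq] by (auto simp: g_def)
  qed (auto intro: unit_zmod_vec_carrier[OF q])
  show ?thesis
  proof (rule that[of g])
    show "g \<in> PiE J (\<lambda>_. carrier K)" using gc by (auto simp: g_def)
    show "generate K (g ` J) = carrier K"
    proof -
      have "lincomb K J g ` carrier ?A = F ` carrier ?A" by (rule image_cong[OF refl eq])
      then show ?thesis using K.lincomb_image[of J q g, OF J q gc gq] surj by simp
    qed
    show "kernel ?A K (lincomb K J g) = L"
      unfolding ker[symmetric] kernel_def by (intro Collect_cong conj_cong refl) (simp add: eq)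
  qed (rule gq)
qed

text \<open>
A generating tuple of \<open>K\<close> is a surjection from \<open>(\<int>/q)\<^sup>J\<close> to \<open>K\<close>. The subgroups with quotient \<open>K\<close>
are the kernels of these surjections, and the surjections with a given kernel form an orbit of
the automorphism group, which acts freely.
\<close>

lemma card_quotient_kernels:
  fixes K :: "('k, 'l) monoid_scheme"
  assumes K: "comm_group K" "finite (carrier K)" and J: "finite J" and q: "0 < (q::nat)"
    and exp: "\<And>x. x \<in> carrier K \<Longrightarrow> x [^]\<^bsub>K\<^esub> q = \<one>\<^bsub>K\<^esub>"
  shows "card {g \<in> PiE J (\<lambda>_. carrier K). generate K (g ` J) = carrier K} =
    card {L. subgroup L (zmod_vec q J) \<and> zmod_vec q J Mod L \<cong> K} * card (auto K)"
proof -
  let ?A = "zmod_vec q J"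
  let ?E = "{g \<in> PiE J (\<lambda>_. carrier K). generate K (g ` J) = carrier K}"
  let ?LL = "{L. subgroup L ?A \<and> ?A Mod L \<cong> K}"
  let ?k = "\<lambda>g. kernel ?A K (lincomb K J g)"
  interpret A: comm_group ?A by (rule comm_group_zmod_vec)
  interpret K: comm_group K by (rule K)
  have hom: "group_hom ?A K (lincomb K J g)" and surj: "lincomb K J g ` carrier ?A = generate K (g ` J)"
    and unit: "\<And>j. j \<in> J \<Longrightarrow> lincomb K J g (unit_zmod_vec q J j) = g j"
    if "g \<in> PiE J (\<lambda>_. carrier K)" for g
    using that exp by (auto intro!: K.lincomb_hom[OF J q] K.lincomb_image[OF J q] K.lincomb_unit[OF J, of g q])
  have finE: "finite ?E" using J K(2) by (intro finite_subset[OF _ finite_PiE[of J "\<lambda>_. carrier K"]]) auto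
  have img: "?k ` ?E = ?LL"
  proof
    show "?k ` ?E \<subseteq> ?LL"
    proof (rule image_subsetI)
      fix g assume g: "g \<in> ?E"
      then interpret l: group_hom ?A K "lincomb K J g" using hom by auto
      show "?k g \<in> ?LL" using l.subgroup_kernel l.FactGroup_iso surj g by auto
    qed
    show "?LL \<subseteq> ?k ` ?E"
    proof
      fix L assume "L \<in> ?LL"
      then obtain g where "g \<in> ?E" "?k g = L"
        using quotient_iso_generators[OF K(1) J q, of L] by auto
      then show "L \<in> ?k ` ?E" by blast
    qed
  qed
  have "card {g' \<in> ?E. ?k g' = ?k g} = card (auto K)" if g: "g \<in> ?E" for g
  proof -
    let ?T = "\<lambda>\<alpha>. \<lambda>j\<in>J. \<alpha> (g j)"
    have gE: "g \<in> PiE J (\<lambda>_. carrier K)" and gen: "generate K (g ` J) = carrier K" using g by auto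
    interpret l: group_hom ?A K "lincomb K J g" by (rule hom[OF gE])
    have hom\<alpha>: "group_hom K K \<alpha>" if "\<alpha> \<in> auto K" for \<alpha>
      using that by (intro group_hom.intro group_hom_axioms.intro) (auto simp: auto_def)
    have T: "?T \<alpha> \<in> PiE J (\<lambda>_. carrier K)" if "\<alpha> \<in> auto K" for \<alpha>
      using that gE by (auto simp: auto_def hom_def)
    have comp: "lincomb K J (?T \<alpha>) x = \<alpha> (lincomb K J g x)" if "\<alpha> \<in> auto K" "x \<in> carrier ?A" for \<alpha> x
    proof -
      interpret \<alpha>: group_hom K K \<alpha> using that(1) by (rule hom\<alpha>)
      interpret l': group_hom ?A K "lincomb K J (?T \<alpha>)" by (rule hom[OF T[OF that(1)]])
      have "group_hom ?A K (\<alpha> \<circ> lincomb K J g)"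
        by (intro group_hom.intro group_hom_axioms.intro A.is_group K.is_group Group.hom_compose[OF l.homh \<alpha>.homh])
      then have "lincomb K J (?T \<alpha>) x = (\<alpha> \<circ> lincomb K J g) x"
      proof (rule l'.eq_on_generate)
        show "x \<in> generate ?A (unit_zmod_vec q J ` J)" using generate_unit_zmod_vec[OF J q] that by simp
        show "lincomb K J (?T \<alpha>) a = (\<alpha> \<circ> lincomb K J g) a" if "a \<in> unit_zmod_vec q J ` J" for a
          using that unit[OF T[OF \<open>\<alpha> \<in> auto K\<close>]] unit[OF gE] by auto
      qed (auto intro: unit_zmod_vec_carrier[OF q])
      then show ?thesis by simp
    qed
    have "bij_betw ?T (auto K) {g' \<in> ?E. ?k g' = ?k g}"
      unfolding bij_betw_def
    proof
      show "inj_on ?T (auto K)"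
      proof (rule inj_onI)
        fix \<alpha> \<beta> assume ab: "\<alpha> \<in> auto K" "\<beta> \<in> auto K" "?T \<alpha> = ?T \<beta>"
        interpret \<alpha>: group_hom K K \<alpha> using ab(1) by (rule hom\<alpha>)
        have eq: "\<alpha> (g j) = \<beta> (g j)" if "j \<in> J" for j using fun_cong[OF ab(3), of j] that by simp
        have "\<alpha> x = \<beta> x" if "x \<in> carrier K" for x
          by (rule \<alpha>.eq_on_generate[OF hom\<alpha>[OF ab(2)], of "g ` J"]) (use gE eq gen that in auto)
        moreover have "\<alpha> \<in> extensional (carrier K)" "\<beta> \<in> extensional (carrier K)"
          using ab by (auto simp: auto_def Bij_def)
        ultimately show "\<alpha> = \<beta>" by (rule extensionalityI[rotated 2])
      qed
      show "?T ` auto K = {g' \<in> ?E. ?k g' = ?k g}"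
      proof
        show "?T ` auto K \<subseteq> {g' \<in> ?E. ?k g' = ?k g}"
        proof (rule image_subsetI)
          fix \<alpha> assume \<alpha>: "\<alpha> \<in> auto K"
          interpret \<alpha>: group_hom K K \<alpha> using \<alpha> by (rule hom\<alpha>)
          have bij: "bij_betw \<alpha> (carrier K) (carrier K)" using \<alpha> by (auto simp: auto_def Bij_def)
          have "lincomb K J (?T \<alpha>) ` carrier ?A = \<alpha> ` (lincomb K J g ` carrier ?A)"
            using comp[OF \<alpha>] by (simp add: image_image)
          then have "generate K (?T \<alpha> ` J) = carrier K"
            using surj[OF T[OF \<alpha>]] surj[OF gE] gen bij by (simp add: bij_betw_def)
          moreover have "?k (?T \<alpha>) = ?k g"
          proof -
            have "\<alpha> y = \<one>\<^bsub>K\<^esub> \<longleftrightarrow> y = \<one>\<^bsub>K\<^esub>" if "y \<in> carrier K" for y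
              using bij that \<alpha>.hom_one K.one_closed unfolding bij_betw_def by (metis inj_onD)
            then show ?thesis using comp[OF \<alpha>] unfolding kernel_def by auto
          qed
          ultimately show "?T \<alpha> \<in> {g' \<in> ?E. ?k g' = ?k g}" using T[OF \<alpha>] by simp
        qed
        show "{g' \<in> ?E. ?k g' = ?k g} \<subseteq> ?T ` auto K"
        proof
          fix g' assume g': "g' \<in> {g' \<in> ?E. ?k g' = ?k g}"
          then have gE': "g' \<in> PiE J (\<lambda>_. carrier K)" and gen': "generate K (g' ` J) = carrier K"
            and ker: "?k g' = ?k g" by auto
          interpret l': group_hom ?A K "lincomb K J g'" by (rule hom[OF gE'])
          let ?f = "lincomb K J g" and ?f' = "lincomb K J g'"
          have eq1: "?f x = ?f y \<longleftrightarrow> ?f' x = ?f' y" if xy: "x \<in> carrier ?A" "y \<in> carrier ?A" for x y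
          proof -
            let ?d = "x \<otimes>\<^bsub>?A\<^esub> inv\<^bsub>?A\<^esub> y"
            have "?f x = ?f y \<longleftrightarrow> ?d \<in> ?k g"
              using xy by (simp add: kernel_def K.inv_solve_right')
            moreover have "?f' x = ?f' y \<longleftrightarrow> ?d \<in> ?k g'"
              using xy by (simp add: kernel_def K.inv_solve_right')
            ultimately show ?thesis using ker by simp
          qed
          define \<alpha> where "\<alpha> = (\<lambda>y\<in>carrier K. ?f' (inv_into (carrier ?A) ?f y))"
          have s: "?f ` carrier ?A = carrier K" and s': "?f' ` carrier ?A = carrier K"
            using surj[OF gE] surj[OF gE'] gen gen' by auto
          have \<alpha>f: "\<alpha> (?f x) = ?f' x" if x: "x \<in> carrier ?A" for x
          proof -
            have m: "?f x \<in> ?f ` carrier ?A" using x by blast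
            have "?f' (inv_into (carrier ?A) ?f (?f x)) = ?f' x"
              using eq1[OF inv_into_into[OF m] x] f_inv_into_f[OF m] by blast
            then show ?thesis unfolding \<alpha>_def restrict_apply'[OF l.hom_closed[OF x]] .
          qed
          have "\<alpha> \<in> hom K K"
          proof (rule homI)
            fix y z assume y: "y \<in> carrier K" and z: "z \<in> carrier K"
            have "y \<in> ?f ` carrier ?A" "z \<in> ?f ` carrier ?A" unfolding s using y z .
            then obtain a b where ab: "a \<in> carrier ?A" "y = ?f a" "b \<in> carrier ?A" "z = ?f b"
              by (elim imageE)
            show "\<alpha> y \<in> carrier K" using ab \<alpha>f by simp
            have "\<alpha> (y \<otimes>\<^bsub>K\<^esub> z) = \<alpha> (?f (a \<otimes>\<^bsub>?A\<^esub> b))" using ab by simp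
            also have "\<dots> = \<alpha> y \<otimes>\<^bsub>K\<^esub> \<alpha> z" using ab \<alpha>f[of "a \<otimes>\<^bsub>?A\<^esub> b"] \<alpha>f[of a] \<alpha>f[of b] by simp
            finally show "\<alpha> (y \<otimes>\<^bsub>K\<^esub> z) = \<alpha> y \<otimes>\<^bsub>K\<^esub> \<alpha> z" .
          qed
          moreover have "\<alpha> ` carrier K = carrier K"
          proof -
            have "\<alpha> ` ?f ` carrier ?A = ?f' ` carrier ?A"
              unfolding image_image by (rule image_cong[OF refl \<alpha>f])
            then show ?thesis unfolding s s' .
          qed
          then have "bij_betw \<alpha> (carrier K) (carrier K)" using K(2) by (simp add: bij_betw_def eq_card_imp_inj_on)
          ultimately have "\<alpha> \<in> auto K" by (auto simp: auto_def Bij_def \<alpha>_def)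
          moreover have "?T \<alpha> = g'"
          proof
            fix j
            show "?T \<alpha> j = g' j"
            proof (cases "j \<in> J")
              case True
              then show ?thesis
                using \<alpha>f[OF unit_zmod_vec_carrier[OF q, of J j]] unit[OF gE True] unit[OF gE' True] by simp
            qed (use PiE_arb[OF gE'] in simp)
          qed
          ultimately show "g' \<in> ?T ` auto K" by blast
        qed
      qed
    qed
    then show ?thesis by (rule bij_betw_same_card[symmetric])
  qed
  then have "(\<Sum>L\<in>?k ` ?E. card {g' \<in> ?E. ?k g' = L}) = (\<Sum>L\<in>?k ` ?E. card (auto K))"
    by (intro sum.cong) auto
  moreover have "card ?E = (\<Sum>L\<in>?k ` ?E. card {g' \<in> ?E. ?k g' = L})"
    using sum.image_gen[OF finE, of "\<lambda>_. 1::nat" ?k] unfolding card_eq_sum .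
  ultimately show ?thesis unfolding img by simp
qed

text \<open>
The index of \<open>L\<close> is the order of \<open>K\<close>, and all of the \<open>p\<close>-torsion lies in \<open>L\<close>: it consists of
\<open>p\<^sup>m\<close>-th powers, which vanish in \<open>K\<close>. So the \<open>p\<close>-th powers have index \<open>p\<close> to the number of
coordinates in \<open>L\<close>, and by Nakayama's lemma it suffices to generate \<open>L\<close> together with them.
\<close>

lemma card_tuples_generating_kernel:
  fixes K :: "('k, 'l) monoid_scheme"
  assumes p: "Factorial_Ring.prime (p::nat)" and q: "q = p ^ Suc m" and J: "finite J"
    and K: "comm_group K" "finite (carrier K)"
    and exp: "\<And>x. x \<in> carrier K \<Longrightarrow> x [^]\<^bsub>K\<^esub> (p ^ m) = \<one>\<^bsub>K\<^esub>"
    and L: "subgroup L (zmod_vec q J)" "zmod_vec q J Mod L \<cong> K"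
  shows "real (card {w \<in> PiE J (\<lambda>_. carrier (zmod_vec q J)). generate (zmod_vec q J) (w ` J) = L}) =
    inverse_power_prod p (card J) * (real (order (zmod_vec q J)) / real (order K)) ^ card J"
proof -
  let ?A = "zmod_vec q J"
  interpret A: finite_abelian_pgroup ?A p unfolding q using p J by (rule zmod_vec_pgroup)
  interpret K: comm_group K by (rule K)
  have p0: "0 < p" using p by (rule prime_gt_0_nat)
  then have q0: "0 < q" by (simp add: q)
  have Lc: "L \<subseteq> carrier ?A" using L(1) by (rule subgroup.subset)
  interpret L: finite_abelian_pgroup "?A\<lparr>carrier := L\<rparr>" p using L(1) by (rule A.subgroup_pgroup)
  obtain g where g: "g \<in> PiE J (\<lambda>_. carrier K)" "\<And>j. j \<in> J \<Longrightarrow> g j [^]\<^bsub>K\<^esub> q = \<one>\<^bsub>K\<^esub>"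
    "generate K (g ` J) = carrier K" "kernel ?A K (lincomb K J g) = L"
    by (rule quotient_iso_generators[OF K(1) J q0 L]) blast
  have gc: "g j \<in> carrier K" if "j \<in> J" for j using g(1) that by auto
  interpret l: group_hom ?A K "lincomb K J g" by (rule K.lincomb_hom[OF J q0 gc g(2)])
  have "order ?A = card L * order K"
    using l.card_carrier_eq[OF A.finite_carrier] K.lincomb_image[of J q g, OF J q0 gc g(2)] g(3,4)
    by (simp add: order_def)
  moreover have "0 < order K" using K K.one_closed by (auto simp: order_def card_gt_0_iff)
  ultimately have ratio: "real (order ?A) / real (order K) = real (card L)" by simp
  \<comment> \<open>This is where \<open>q\<close> has to exceed the exponent of \<open>K\<close> by a factor of \<open>p\<close>.\<close>
  have tors: "x \<in> L" if x: "x \<in> carrier ?A" "x [^]\<^bsub>?A\<^esub> p = \<one>\<^bsub>?A\<^esub>" for x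
  proof -
    obtain y where y: "y \<in> carrier ?A" "x = y [^]\<^bsub>?A\<^esub> (p ^ m)"
      using card_torsion_zmod_vec(2)[OF p0 _ J, of "p ^ m" x] x p0 by (auto simp: q)
    then have "lincomb K J g x = \<one>\<^bsub>K\<^esub>" using exp by (simp add: l.hom_nat_pow)
    then show ?thesis using x(1) unfolding g(4)[symmetric] by (simp add: kernel_def)
  qed
  let ?S = "(\<lambda>x. x [^]\<^bsub>?A\<^esub> p) ` L"
  have idx: "card L = p ^ card J * card ?S" and subS: "subgroup ?S ?A"
    using index_powers_of_subgroup[OF p _ _ J L(1) tors, of "p ^ m"] p0 q by auto
  have SL: "?S \<subseteq> L" using L.nat_pow_closed A.nat_pow_consistent by (auto simp flip: A.nat_pow_consistent)
  have pow: "x [^]\<^bsub>?A\<lparr>carrier := L\<rparr>\<^esub> (n::nat) = x [^]\<^bsub>?A\<^esub> n" for x n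
    by (rule A.nat_pow_consistent[symmetric])
  have subSL: "subgroup ?S (?A\<lparr>carrier := L\<rparr>)"
    using subS L(1) SL by (rule A.subgroup_incl)
  have "real (card {w \<in> PiE J (\<lambda>_. L). generate (?A\<lparr>carrier := L\<rparr>) (?S \<union> w ` J) = L}) =
      inverse_power_prod p (card J) * real (card L) ^ card J"
    using L.card_generating_tuples_full[OF J subSL] idx by (simp add: order_def pow)
  moreover have "{w \<in> PiE J (\<lambda>_. carrier ?A). generate ?A (w ` J) = L} =
      {w \<in> PiE J (\<lambda>_. L). generate (?A\<lparr>carrier := L\<rparr>) (?S \<union> w ` J) = L}" (is "?X = ?Y")
  proof
    show "?X \<subseteq> ?Y"
    proof
      fix w assume w: "w \<in> ?X"
      then have wL: "w ` J \<subseteq> L" by (auto intro: generate.incl)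
      then have "w \<in> PiE J (\<lambda>_. L)" using w by (auto simp: PiE_iff)
      moreover have "generate ?A (?S \<union> w ` J) = L"
      proof
        show "generate ?A (?S \<union> w ` J) \<subseteq> L" using SL wL L(1) by (intro A.generate_subgroup_incl) auto
        show "L \<subseteq> generate ?A (?S \<union> w ` J)" using w A.mono_generate[of "w ` J" "?S \<union> w ` J"] by auto
      qed
      ultimately show "w \<in> ?Y" using A.generate_consistent[OF _ L(1)] SL wL by auto
    qed
    show "?Y \<subseteq> ?X"
    proof
      fix w assume w: "w \<in> ?Y"
      then have wL: "w ` J \<subseteq> L" and wP: "w \<in> PiE J (\<lambda>_. L)" by auto
      let ?H = "generate (?A\<lparr>carrier := L\<rparr>) (w ` J)"
      have sub: "subgroup ?H (?A\<lparr>carrier := L\<rparr>)" using wL by (intro L.generate_is_subgroup) simp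
      have "generate (?A\<lparr>carrier := L\<rparr>) (?H \<union> ?S) = generate (?A\<lparr>carrier := L\<rparr>) (w ` J \<union> ?S)"
        using wL SL by (intro L.generate_generate_Un) auto
      also have "\<dots> = L" using w by (simp add: Un_commute)
      finally have "?H = L" using L.generate_with_powers_imp[OF sub] by (simp add: pow)
      then have "generate ?A (w ` J) = L" using A.generate_consistent[OF wL L(1)] by simp
      then show "w \<in> ?X" using wP Lc by (auto simp: PiE_iff)
    qed
  qed
  ultimately show ?thesis by (simp add: ratio)
qed

lemma card_square_quotient_iso:
  fixes K :: "('k, 'l) monoid_scheme"
  assumes p: "Factorial_Ring.prime (p::nat)" and q: "q = p ^ Suc m" and J: "finite J"
    and K: "comm_group K" "finite (carrier K)"
    and exp: "\<And>x. x \<in> carrier K \<Longrightarrow> x [^]\<^bsub>K\<^esub> (p ^ m) = \<one>\<^bsub>K\<^esub>"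
  shows "real (card {w \<in> PiE J (\<lambda>_. carrier (zmod_vec q J)). zmod_vec q J Mod generate (zmod_vec q J) (w ` J) \<cong> K})
      / real (order (zmod_vec q J)) ^ card J =
    inverse_power_prod p (card J) / real (card (auto K)) *
      (real (card {g \<in> PiE J (\<lambda>_. carrier K). generate K (g ` J) = carrier K}) / real (order K) ^ card J)"
proof -
  let ?A = "zmod_vec q J"
  let ?LL = "{L. subgroup L ?A \<and> ?A Mod L \<cong> K}"
  let ?W = "\<lambda>L. {w \<in> PiE J (\<lambda>_. carrier ?A). generate ?A (w ` J) = L}"
  interpret A: finite_abelian_pgroup ?A p unfolding q using p J by (rule zmod_vec_pgroup)
  interpret K: comm_group K by (rule K)
  have p0: "0 < p" using p by (rule prime_gt_0_nat)
  then have q0: "0 < q" by (simp add: q)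
  have exp': "x [^]\<^bsub>K\<^esub> q = \<one>\<^bsub>K\<^esub>" if "x \<in> carrier K" for x
  proof -
    have "x [^]\<^bsub>K\<^esub> q = (x [^]\<^bsub>K\<^esub> (p ^ m)) [^]\<^bsub>K\<^esub> p" using that by (simp add: K.nat_pow_pow q mult.commute)
    then show ?thesis using exp[OF that] by simp
  qed
  have finL: "finite ?LL" by (rule finite_subset[of _ "Pow (carrier ?A)"]) (auto dest: subgroup.subset)
  have finW: "finite (PiE J (\<lambda>_. carrier ?A))" using J by (intro finite_PiE) auto
  have "{w \<in> PiE J (\<lambda>_. carrier ?A). ?A Mod generate ?A (w ` J) \<cong> K} = (\<Union>L\<in>?LL. ?W L)"
    by (auto intro!: A.generate_is_subgroup)
  then have "real (card {w \<in> PiE J (\<lambda>_. carrier ?A). ?A Mod generate ?A (w ` J) \<cong> K}) =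
      (\<Sum>L\<in>?LL. real (card (?W L)))"
    using finL finW by (simp only:) (subst card_UN_disjoint, auto)
  also have "\<dots> = (\<Sum>L\<in>?LL. inverse_power_prod p (card J) * (real (order ?A) / real (order K)) ^ card J)"
    using card_tuples_generating_kernel[OF p q J K exp] by (intro sum.cong) auto
  also have "\<dots> = real (card ?LL) * (inverse_power_prod p (card J) * (real (order ?A) / real (order K)) ^ card J)"
    by simp
  finally have eq: "real (card {w \<in> PiE J (\<lambda>_. carrier ?A). ?A Mod generate ?A (w ` J) \<cong> K}) = \<dots>" .
  have cq: "real (card {g \<in> PiE J (\<lambda>_. carrier K). generate K (g ` J) = carrier K}) =
      real (card ?LL) * real (card (auto K))"
    unfolding of_nat_mult[symmetric] by (rule arg_cong[OF card_quotient_kernels[OF K J q0 exp']])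
  have "0 < order ?A" "0 < order K" using K K.one_closed q0 J
    by (auto simp: order_zmod_vec order_def card_gt_0_iff)
  moreover have "auto K \<noteq> {}" using K.id_in_auto by auto
  moreover have "finite (auto K)"
    using K(2) by (intro finite_subset[OF _ finite_PiE[of "carrier K" "\<lambda>_. carrier K"]])
      (auto simp: auto_def Bij_def PiE_def hom_def)
  ultimately show ?thesis
    unfolding eq cq by (simp add: card_gt_0_iff power_divide field_simps)
qed

text \<open>
A tuple that does not generate lies in one of the finitely many proper subgroups, and each of them contains
at most half of the elements.
\<close>

lemma (in comm_group) generating_tuples_ratio:
  assumes fin: "finite (carrier G)"
  shows "(\<lambda>k. real (card {g \<in> PiE {..<k} (\<lambda>_. carrier G). generate G (g ` {..<k}) = carrier G})
      / real (order G) ^ k) \<longlonglongrightarrow> 1"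
proof (rule tendsto_sandwich)
  let ?P = "\<lambda>k. PiE {..<k::nat} (\<lambda>_. carrier G)"
  let ?E = "\<lambda>k. {g \<in> ?P k. generate G (g ` {..<k}) = carrier G}"
  let ?HH = "{H. subgroup H G \<and> H \<noteq> carrier G}"
  have pos: "0 < order G" using fin one_closed by (auto simp: order_def card_gt_0_iff)
  have finH: "finite ?HH" by (rule finite_subset[of _ "Pow (carrier G)"]) (use fin in \<open>auto dest: subgroup.subset\<close>)
  have finP: "finite (?P k)" for k using fin by (intro finite_PiE) auto
  have cardP: "real (card (?P k)) = real (order G) ^ k" for k by (simp add: card_PiE order_def)
  have half: "real (card H) \<le> real (order G) / 2" if "H \<in> ?HH" for H
  proof -
    have H: "subgroup H G" "H \<noteq> carrier G" using that by auto
    have eq: "card (rcosets H) * card H = order G" using lagrange_finite[OF fin H(1)] .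
    have "card H \<noteq> order G"
      using card_subset_eq[OF fin subgroup.subset[OF H(1)]] H(2) by (auto simp: order_def)
    then have "card (rcosets H) \<noteq> 1" using eq by auto
    moreover have "card (rcosets H) \<noteq> 0" using eq pos by (metis mult_0 less_irrefl)
    ultimately have "2 \<le> card (rcosets H)" by linarith
    then have "2 * card H \<le> card (rcosets H) * card H" by (intro mult_right_mono) auto
    then show ?thesis using eq by linarith
  qed
  show "\<forall>\<^sub>F k in sequentially. 1 - real (card ?HH) * (1 / 2) ^ k \<le> real (card (?E k)) / real (order G) ^ k"
  proof (rule always_eventually, rule allI)
    fix k
    have "?P k - ?E k \<subseteq> (\<Union>H\<in>?HH. PiE {..<k} (\<lambda>_. H))"
    proof
      fix g assume g: "g \<in> ?P k - ?E k"
      then have "g ` {..<k} \<subseteq> carrier G" by auto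
      then have "generate G (g ` {..<k}) \<in> ?HH" using g generate_is_subgroup by auto
      moreover have "g \<in> PiE {..<k} (\<lambda>_. generate G (g ` {..<k}))"
        using g by (auto simp: PiE_iff intro: generate.incl)
      ultimately show "g \<in> (\<Union>H\<in>?HH. PiE {..<k} (\<lambda>_. H))" by blast
    qed
    then have "card (?P k - ?E k) \<le> card (\<Union>H\<in>?HH. PiE {..<k} (\<lambda>_. H))"
      using finH fin by (intro card_mono) (auto intro!: finite_PiE intro: finite_subset[OF subgroup.subset fin])
    also have "\<dots> \<le> (\<Sum>H\<in>?HH. card (PiE {..<k} (\<lambda>_. H)))" by (rule card_UN_le[OF finH])
    finally have "real (card (?P k - ?E k)) \<le> (\<Sum>H\<in>?HH. real (card H) ^ k)"
      by (simp add: card_PiE flip: of_nat_sum of_nat_power)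
    also have "\<dots> \<le> (\<Sum>H\<in>?HH. (real (order G) / 2) ^ k)" using half by (intro sum_mono power_mono) auto
    also have "\<dots> = real (order G) ^ k * (real (card ?HH) * (1 / 2) ^ k)" by (simp add: power_divide)
    finally have 1: "real (card (?P k - ?E k)) \<le> real (order G) ^ k * (real (card ?HH) * (1 / 2) ^ k)" .
    have "card (?P k) = card (?E k) + card (?P k - ?E k)"
      using finP[of k] by (subst card_Un_disjoint[symmetric]) (auto intro: finite_subset arg_cong[where f = card])
    then have "real (order G) ^ k = real (card (?E k)) + real (card (?P k - ?E k))" using cardP[of k] by simp
    then have "real (order G) ^ k * (1 - real (card ?HH) * (1 / 2) ^ k) \<le> real (card (?E k))"
      using 1 by (simp add: right_diff_distrib)
    then show "1 - real (card ?HH) * (1 / 2) ^ k \<le> real (card (?E k)) / real (order G) ^ k"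
      using pos by (simp add: pos_le_divide_eq mult.commute)
  qed
  show "\<forall>\<^sub>F k in sequentially. real (card (?E k)) / real (order G) ^ k \<le> 1"
  proof (rule always_eventually, rule allI)
    fix k
    have "real (card (?E k)) \<le> real (card (?P k))" using finP[of k] by (intro of_nat_mono card_mono) auto
    then show "real (card (?E k)) / real (order G) ^ k \<le> 1" using pos cardP[of k] by simp
  qed
  show "(\<lambda>k. 1 - real (card ?HH) * (1 / 2) ^ k) \<longlonglongrightarrow> 1"
    by (rule tendsto_eq_intros | simp)+
qed simp

section \<open>Completing a partial matrix\<close>

lemma card_PiE_fibres:
  assumes J: "finite J" and fin: "\<And>j. j \<in> J \<Longrightarrow> finite (B j)" "finite V"
    and into: "\<And>j x. j \<in> J \<Longrightarrow> x \<in> B j \<Longrightarrow> h x \<in> V"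
    and fib: "\<And>j y. j \<in> J \<Longrightarrow> y \<in> V \<Longrightarrow> card {x \<in> B j. h x = y} = c j"
  shows "card {w \<in> PiE J B. Q (\<lambda>j\<in>J. h (w j))} = prod c J * card {v \<in> PiE J (\<lambda>_. V). Q v}"
proof -
  let ?T = "\<lambda>w. \<lambda>j\<in>J. h (w j)"
  let ?X = "{w \<in> PiE J B. Q (?T w)}" and ?Y = "{v \<in> PiE J (\<lambda>_. V). Q v}"
  have finX: "finite ?X" using J fin(1) by (intro finite_subset[OF _ finite_PiE[of J B]]) auto
  have finY: "finite ?Y" using J fin(2) by (intro finite_subset[OF _ finite_PiE[of J "\<lambda>_. V"]]) auto
  have "?T ` ?X \<subseteq> ?Y" using into by (auto simp: PiE_iff)
  have "card ?X = (\<Sum>v\<in>?Y. card {w \<in> ?X. ?T w = v})"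
    using sum.group[OF finX finY \<open>?T ` ?X \<subseteq> ?Y\<close>, of "\<lambda>_. 1::nat"] unfolding card_eq_sum by simp
  also have "\<dots> = (\<Sum>v\<in>?Y. prod c J)"
  proof (rule sum.cong[OF refl])
    fix v assume v: "v \<in> ?Y"
    have "{w \<in> ?X. ?T w = v} = PiE J (\<lambda>j. {x \<in> B j. h x = v j})"
    proof (rule Set.set_eqI)
      fix w
      have "?T w = v \<longleftrightarrow> (\<forall>j\<in>J. h (w j) = v j)"
        using v by (auto simp: fun_eq_iff PiE_iff restrict_def extensional_def)
      then show "w \<in> {w \<in> ?X. ?T w = v} \<longleftrightarrow> w \<in> PiE J (\<lambda>j. {x \<in> B j. h x = v j})"
        using v by (auto simp: PiE_iff)
    qed
    then show "card {w \<in> ?X. ?T w = v} = prod c J"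
      using v J fib by (simp add: card_PiE PiE_iff)
  qed
  finally show ?thesis by simp
qed

text \<open>
All fibres of \<open>\<pi>\<close> on \<open>B j\<close> have the same size, so \<open>\<pi>\<close> maps a uniform element of \<open>B j\<close> to a uniform
element of \<open>V\<close>. The quotient by \<open>Y\<close> and \<open>w\<close> is the quotient of \<open>V\<close> by the image of \<open>w\<close>.
\<close>

lemma card_completions_quotient_iso:
  fixes K :: "('k, 'l) monoid_scheme"
  assumes A: "finite_abelian_pgroup A p" and V: "comm_group V"
    and \<pi>: "group_hom A V \<pi>" and ker: "kernel A V \<pi> = generate A Y" and Y: "Y \<subseteq> carrier A"
    and J: "finite J" and B: "\<And>j. j \<in> J \<Longrightarrow> subgroup (B j) A"
    and surj: "\<And>j. j \<in> J \<Longrightarrow> \<pi> ` B j = carrier V" and surjA: "\<pi> ` carrier A = carrier V"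
  shows "real (card {w \<in> PiE J B. A Mod generate A (Y \<union> w ` J) \<cong> K}) / (\<Prod>j\<in>J. real (card (B j))) =
    real (card {v \<in> PiE J (\<lambda>_. carrier V). V Mod generate V (v ` J) \<cong> K}) / real (order V) ^ card J"
proof -
  interpret A: finite_abelian_pgroup A p by fact
  interpret V: comm_group V by fact
  interpret \<pi>: group_hom A V \<pi> by fact
  have finV: "finite (carrier V)" using surjA A.finite_carrier by (metis finite_imageI)
  have iso: "A Mod generate A (Y \<union> w ` J) \<cong> K \<longleftrightarrow> V Mod generate V ((\<lambda>j\<in>J. \<pi> (w j)) ` J) \<cong> K"
    if w: "w \<in> PiE J B" for w
  proof -
    have wc: "w ` J \<subseteq> carrier A" using w B by (auto dest: subgroup.subset)
    have im: "(\<lambda>j\<in>J. \<pi> (w j)) ` J = \<pi> ` w ` J" by (auto simp: image_image)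
    let ?V = "generate V (\<pi> ` w ` J)"
    have sV: "subgroup ?V V" using wc by (intro V.generate_is_subgroup) auto
    interpret NV: normal ?V V using sV by (rule V.subgroup_imp_normal)
    have sub: "subgroup (generate A (Y \<union> w ` J)) A" using wc Y by (intro A.generate_is_subgroup) auto
    interpret N: normal "generate A (Y \<union> w ` J)" A using sub by (rule A.subgroup_imp_normal)
    have "generate A (Y \<union> w ` J) = {x \<in> carrier A. \<pi> x \<in> ?V}"
    proof
      show "generate A (Y \<union> w ` J) \<subseteq> {x \<in> carrier A. \<pi> x \<in> ?V}"
      proof
        fix x assume x: "x \<in> generate A (Y \<union> w ` J)"
        have "\<pi> x \<in> \<pi> ` generate A (Y \<union> w ` J)" using x by blast
        also have "\<dots> = generate V (\<pi> ` (Y \<union> w ` J))" using wc Y by (intro \<pi>.generate_img[symmetric]) auto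
        also have "\<dots> \<subseteq> ?V"
        proof (rule V.generate_subgroup_incl[OF _ sV])
          have "\<pi> y \<in> ?V" if "y \<in> Y" for y
          proof -
            have "y \<in> kernel A V \<pi>" unfolding ker using that by (rule generate.incl)
            then show ?thesis by (simp add: kernel_def generate.one)
          qed
          then show "\<pi> ` (Y \<union> w ` J) \<subseteq> ?V" by (auto intro: generate.incl)
        qed
        finally show "x \<in> {x \<in> carrier A. \<pi> x \<in> ?V}" using subgroup.mem_carrier[OF sub x] by simp
      qed
      show "{x \<in> carrier A. \<pi> x \<in> ?V} \<subseteq> generate A (Y \<union> w ` J)"
      proof
        fix x assume x: "x \<in> {x \<in> carrier A. \<pi> x \<in> ?V}"
        then obtain z where z: "z \<in> generate A (w ` J)" "\<pi> x = \<pi> z"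
          using \<pi>.generate_img[OF wc] by auto
        have zc: "z \<in> carrier A" using z(1) A.generate_in_carrier[OF wc] by blast
        have "x \<otimes>\<^bsub>A\<^esub> inv\<^bsub>A\<^esub> z \<in> kernel A V \<pi>" using x z zc by (simp add: kernel_def)
        then have 1: "x \<otimes>\<^bsub>A\<^esub> inv\<^bsub>A\<^esub> z \<in> generate A (Y \<union> w ` J)"
          unfolding ker using A.mono_generate[of Y "Y \<union> w ` J"] by blast
        have 2: "z \<in> generate A (Y \<union> w ` J)" using z(1) A.mono_generate[of "w ` J" "Y \<union> w ` J"] by blast
        have "x = (x \<otimes>\<^bsub>A\<^esub> inv\<^bsub>A\<^esub> z) \<otimes>\<^bsub>A\<^esub> z" using x zc by (simp add: A.m_assoc)
        then show "x \<in> generate A (Y \<union> w ` J)" using subgroup.m_closed[OF sub 1 2] by simp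
      qed
    qed
    then have AV: "A Mod generate A (Y \<union> w ` J) \<cong> V Mod ?V"
      using \<pi>.Mod_vimage_iso[OF surjA NV.normal_axioms] by (simp only:)
    then have VA: "V Mod ?V \<cong> A Mod generate A (Y \<union> w ` J)"
      by (rule group.iso_sym[OF N.factorgroup_is_group])
    show ?thesis unfolding im using iso_trans[OF AV] iso_trans[OF VA] by blast
  qed
  define c where "c j = card {x \<in> B j. \<pi> x = \<one>\<^bsub>V\<^esub>}" for j
  have fibre: "card {x \<in> B j. \<pi> x = y} = c j" and size: "card (B j) = c j * order V"
    if j: "j \<in> J" and y: "y \<in> carrier V" for j y
  proof -
    have Bc: "B j \<subseteq> carrier A" using B[OF j] by (rule subgroup.subset)
    interpret Bj: group "A\<lparr>carrier := B j\<rparr>" using B[OF j] by (rule A.subgroup_imp_group)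
    interpret h: group_hom "A\<lparr>carrier := B j\<rparr>" V \<pi>
      using Bc by unfold_locales (auto simp: hom_def subset_iff)
    have fin: "finite (carrier (A\<lparr>carrier := B j\<rparr>))" using A.finite_subgroup[OF B[OF j]] by simp
    have k: "c j = card (kernel (A\<lparr>carrier := B j\<rparr>) V \<pi>)" by (simp add: c_def kernel_def)
    show "card {x \<in> B j. \<pi> x = y} = c j"
      using h.card_fibre[OF fin, of y] surj[OF j] y by (simp add: k)
    show "card (B j) = c j * order V"
      using h.card_carrier_eq[OF fin] surj[OF j] by (simp add: order_def k)
  qed
  have into: "\<pi> x \<in> carrier V" if "j \<in> J" "x \<in> B j" for j x using surj[OF that(1)] that(2) by blast
  have "{w \<in> PiE J B. A Mod generate A (Y \<union> w ` J) \<cong> K} =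
      {w \<in> PiE J B. V Mod generate V ((\<lambda>j\<in>J. \<pi> (w j)) ` J) \<cong> K}"
    using iso by (intro Collect_cong conj_cong refl) simp
  also have "card \<dots> = prod c J * card {v \<in> PiE J (\<lambda>_. carrier V). V Mod generate V (v ` J) \<cong> K}"
    by (rule card_PiE_fibres[OF J _ finV into fibre]) (use A.finite_subgroup[OF B] in auto)
  finally have eq: "card {w \<in> PiE J B. A Mod generate A (Y \<union> w ` J) \<cong> K} = \<dots>" .
  have posV: "0 < order V" using finV V.one_closed by (auto simp: order_def card_gt_0_iff)
  have "0 < card (B j)" if "j \<in> J" for j using B[OF that] A.finite_carrier by (meson subgroup.finite_imp_card_positive)
  then have "0 < c j" if "j \<in> J" for j using size[OF that V.one_closed] that by (metis gr0I mult_0 less_irrefl)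
  then have posc: "0 < (\<Prod>j\<in>J. real (c j))" by (intro prod_pos) auto
  have "(\<Prod>j\<in>J. real (card (B j))) = (\<Prod>j\<in>J. real (c j) * real (order V))"
    using size[OF _ V.one_closed] by (intro prod.cong) (auto simp flip: of_nat_mult)
  also have "\<dots> = real (prod c J) * real (order V) ^ card J" by (simp add: prod.distrib)
  finally show ?thesis unfolding eq using posc posV by simp
qed

section \<open>Uniform entries with prescribed support\<close>

lemma prob_mono_pmf:
  assumes "\<And>x. x \<in> set_pmf p \<Longrightarrow> Q x \<Longrightarrow> Q' x"
  shows "measure_pmf.prob p {x. Q x} \<le> measure_pmf.prob p {x. Q' x}"
  using assms by (intro measure_pmf.finite_measure_mono_AE) (auto simp: AE_measure_pmf_iff)

lemma prob_cong_pmf: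
  assumes "\<And>x. x \<in> set_pmf p \<Longrightarrow> Q x \<longleftrightarrow> Q' x"
  shows "measure_pmf.prob p {x. Q x} = measure_pmf.prob p {x. Q' x}"
  using prob_mono_pmf[of p Q Q'] prob_mono_pmf[of p Q' Q] assms by force

lemma prob_not_pmf: "measure_pmf.prob p {x. \<not> Q x} = 1 - measure_pmf.prob p {x. Q x}"
  using measure_pmf.prob_compl[of "{x. Q x}" p] by (simp add: Compl_eq_Diff_UNIV[symmetric] Collect_neg_eq)

lemma prob_bind_pmf:
  "measure_pmf.prob (bind_pmf p F) X = measure_pmf.expectation p (\<lambda>x. measure_pmf.prob (F x) X)"
proof -
  have "ennreal (measure_pmf.prob (bind_pmf p F) X) = (\<integral>\<^sup>+x. ennreal (measure_pmf.prob (F x) X) \<partial>measure_pmf p)"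
    using emeasure_bind_pmf[of p F X] by (simp add: measure_pmf.emeasure_eq_measure)
  also have "\<dots> = ennreal (measure_pmf.expectation p (\<lambda>x. measure_pmf.prob (F x) X))"
    by (intro nn_integral_eq_integral measure_pmf.integrable_const_bound[where B = 1]) auto
  finally show ?thesis by (subst (asm) ennreal_inj) (auto intro!: Bochner_Integration.integral_nonneg)
qed

lemma prob_eq_expectation_indicator:
  "measure_pmf.prob p {f. R f} = measure_pmf.expectation p (\<lambda>f. if R f then 1 else 0)"
proof -
  have "(\<lambda>f. if R f then 1 else 0 :: real) = indicator {f. R f}" by (auto simp: fun_eq_iff)
  then show ?thesis by simp
qed

lemma expectation_mono_pmf:
  fixes u v :: "'x \<Rightarrow> real"
  assumes "\<And>x. x \<in> set_pmf p \<Longrightarrow> u x \<le> v x" "\<And>x. \<bar>u x\<bar> \<le> B" "\<And>x. \<bar>v x\<bar> \<le> B"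
  shows "measure_pmf.expectation p u \<le> measure_pmf.expectation p v"
  by (intro integral_mono_AE measure_pmf.integrable_const_bound[where B = B])
    (use assms in \<open>auto simp: AE_measure_pmf_iff\<close>)

text \<open>
A random matrix with support \<open>I\<close> is a random function of the position, which is zero outside of \<open>I\<close>.
\<close>

definition entry_pmf :: "nat \<Rightarrow> 'e set \<Rightarrow> ('e \<Rightarrow> int) pmf" where
  "entry_pmf q I = Pi_pmf I 0 (\<lambda>_. pmf_of_set {0..<int q})"

lemma set_entry_pmf:
  assumes "finite I" "0 < q"
  shows "set_pmf (entry_pmf q I) = PiE_dflt I 0 (\<lambda>_. {0..<int q})"
  using assms unfolding entry_pmf_def by (simp add: set_Pi_pmf)

lemma entry_pmf_outside: "finite I \<Longrightarrow> f \<in> set_pmf (entry_pmf q I) \<Longrightarrow> e \<notin> I \<Longrightarrow> f e = 0"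
  unfolding entry_pmf_def using set_Pi_pmf_subset[of I 0 "\<lambda>_. pmf_of_set {0..<int q}"] by auto

definition glue :: "'e set \<Rightarrow> ('e \<Rightarrow> 'b) \<Rightarrow> ('e \<Rightarrow> 'b) \<Rightarrow> 'e \<Rightarrow> 'b" where
  "glue I f g e = (if e \<in> I then f e else g e)"

lemma prob_entry_pmf_Un:
  assumes "finite I" "finite I'" "I \<inter> I' = {}"
  shows "measure_pmf.prob (entry_pmf q (I \<union> I')) {f. Q f} =
    measure_pmf.expectation (entry_pmf q I) (\<lambda>f. measure_pmf.prob (entry_pmf q I') {g. Q (glue I f g)})"
proof -
  have "entry_pmf q (I \<union> I') = bind_pmf (entry_pmf q I) (\<lambda>f. map_pmf (glue I f) (entry_pmf q I'))"
    unfolding entry_pmf_def Pi_pmf_union[OF assms] pair_pmf_def glue_def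
    by (simp add: map_bind_pmf map_pmf_def bind_assoc_pmf bind_return_pmf)
  then show ?thesis by (simp add: prob_bind_pmf vimage_def)
qed

lemma prob_entry_pmf_Un_le:
  assumes "finite I" "finite I'" "I \<inter> I' = {}" "0 \<le> c"
    and "\<And>f. f \<in> set_pmf (entry_pmf q I) \<Longrightarrow>
      measure_pmf.prob (entry_pmf q I') {g. Q (glue I f g)} \<le> (if R f then c else 0)"
  shows "measure_pmf.prob (entry_pmf q (I \<union> I')) {f. Q f} \<le> c * measure_pmf.prob (entry_pmf q I) {f. R f}"
proof -
  have "measure_pmf.prob (entry_pmf q (I \<union> I')) {f. Q f} \<le>
      measure_pmf.expectation (entry_pmf q I) (\<lambda>f. c * (if R f then 1 else 0))"
    unfolding prob_entry_pmf_Un[OF assms(1-3)]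
    by (rule expectation_mono_pmf[where B = "max 1 c"])
      (use assms(4) order_trans[OF assms(5)] in \<open>auto simp: le_max_iff_disj split: if_splits\<close>)
  then show ?thesis by (simp add: prob_eq_expectation_indicator[of _ R])
qed

lemma prob_entry_pmf_Un_ge:
  assumes "finite I" "finite I'" "I \<inter> I' = {}" "0 \<le> c"
    and "\<And>f. f \<in> set_pmf (entry_pmf q I) \<Longrightarrow> R f \<Longrightarrow>
      c \<le> measure_pmf.prob (entry_pmf q I') {g. Q (glue I f g)}"
  shows "c * measure_pmf.prob (entry_pmf q I) {f. R f} \<le> measure_pmf.prob (entry_pmf q (I \<union> I')) {f. Q f}"
proof -
  have "measure_pmf.expectation (entry_pmf q I) (\<lambda>f. c * (if R f then 1 else 0)) \<le>
      measure_pmf.prob (entry_pmf q (I \<union> I')) {f. Q f}"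
    unfolding prob_entry_pmf_Un[OF assms(1-3)]
    by (rule expectation_mono_pmf[where B = "max 1 c"])
      (use assms(4,5) in \<open>auto simp: le_max_iff_disj\<close>)
  then show ?thesis by (simp add: prob_eq_expectation_indicator[of _ R])
qed

text \<open>
Conditionally on the entries in \<open>I\<close> the event \<open>Q\<close> has probability \<open>c\<close> as soon as they satisfy \<open>R\<close>. The
lower bound for the complement of \<open>Q\<close> gives the upper bound for \<open>Q\<close>.
\<close>

lemma prob_entry_pmf_Un_approx:
  assumes "finite I" "finite I'" "I \<inter> I' = {}" "0 \<le> c" "c \<le> 1"
    and eq: "\<And>f. f \<in> set_pmf (entry_pmf q I) \<Longrightarrow> R f \<Longrightarrow>
      measure_pmf.prob (entry_pmf q I') {g. Q (glue I f g)} = c"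
  shows "\<bar>measure_pmf.prob (entry_pmf q (I \<union> I')) {f. Q f} - c\<bar> \<le>
    1 - measure_pmf.prob (entry_pmf q I) {f. R f}"
proof -
  let ?P = "measure_pmf.prob (entry_pmf q I) {f. R f}"
  have lower: "c * ?P \<le> measure_pmf.prob (entry_pmf q (I \<union> I')) {f. Q f}"
    using prob_entry_pmf_Un_ge[OF assms(1-4)] eq by simp
  have "(1 - c) * ?P \<le> measure_pmf.prob (entry_pmf q (I \<union> I')) {f. \<not> Q f}"
  proof (rule prob_entry_pmf_Un_ge[OF assms(1-3)])
    fix f assume f: "f \<in> set_pmf (entry_pmf q I)" "R f"
    have "{g. \<not> Q (glue I f g)} = space (measure_pmf (entry_pmf q I')) - {g. Q (glue I f g)}" by auto
    then show "1 - c \<le> measure_pmf.prob (entry_pmf q I') {g. \<not> Q (glue I f g)}"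
      using eq[OF f] by (simp only:) (subst measure_pmf.prob_compl, auto)
  qed (use assms in simp)
  also have "{f. \<not> Q f} = space (measure_pmf (entry_pmf q (I \<union> I'))) - {f. Q f}" by auto
  also have "measure_pmf.prob (entry_pmf q (I \<union> I')) \<dots> = 1 - measure_pmf.prob (entry_pmf q (I \<union> I')) {f. Q f}"
    by (rule measure_pmf.prob_compl) simp
  finally have upper: "measure_pmf.prob (entry_pmf q (I \<union> I')) {f. Q f} \<le> 1 - (1 - c) * ?P" by simp
  have "0 \<le> c * (1 - ?P)" "0 \<le> (1 - c) * (1 - ?P)"
    using assms(4,5) by (auto intro!: mult_nonneg_nonneg)
  then show ?thesis using lower upper by (simp add: abs_le_iff algebra_simps)
qed

lemma prob_entry_pmf_subset:
  assumes "finite I" "I' \<subseteq> I"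
  shows "measure_pmf.prob (entry_pmf q I') {f. Q f} =
    measure_pmf.prob (entry_pmf q I) {f. Q (\<lambda>x. if x \<in> I' then f x else 0)}"
  unfolding entry_pmf_def Pi_pmf_subset[OF assms] by (simp add: vimage_def)

text \<open>
The position of coordinate \<open>i\<close> of the vector with index \<open>j\<close> is \<open>e i j\<close>. Pairing reads the columns of a
matrix and the flipped pairing its rows, so one argument serves both.
\<close>

definition block_vec :: "('i \<Rightarrow> 'j \<Rightarrow> 'e) \<Rightarrow> 'i set \<Rightarrow> ('e \<Rightarrow> int) \<Rightarrow> 'j \<Rightarrow> 'i \<Rightarrow> int" where
  "block_vec e R f j = (\<lambda>i\<in>R. f (e i j))"

definition block_index :: "('i \<Rightarrow> 'j \<Rightarrow> 'e) \<Rightarrow> 'i set \<Rightarrow> 'j set \<Rightarrow> 'e set" where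
  "block_index e R J = (\<lambda>(i, j). e i j) ` (R \<times> J)"

definition supported_vecs :: "nat \<Rightarrow> ('i \<Rightarrow> 'j \<Rightarrow> 'e) \<Rightarrow> 'e set \<Rightarrow> 'i set \<Rightarrow> 'j \<Rightarrow> ('i \<Rightarrow> int) set" where
  "supported_vecs q e S R j = {x \<in> carrier (zmod_vec q R). \<forall>i\<in>R. e i j \<notin> S \<longrightarrow> x i = 0}"

lemma subgroup_supported_vecs:
  assumes "0 < q" shows "subgroup (supported_vecs q e S R j) (zmod_vec q R)"
proof -
  interpret comm_group "zmod_vec q R" by (rule comm_group_zmod_vec)
  have inv: "inv\<^bsub>zmod_vec q R\<^esub> x = (\<lambda>i\<in>R. (- x i) mod int q)" if "x \<in> carrier (zmod_vec q R)" for x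
  proof (rule inv_equality[OF _ that])
    show "(\<lambda>i\<in>R. (- x i) mod int q) \<otimes>\<^bsub>zmod_vec q R\<^esub> x = \<one>\<^bsub>zmod_vec q R\<^esub>"
      unfolding mult_zmod_vec one_zmod_vec by (intro restrict_ext) (simp add: mod_add_left_eq)
  qed (rule restrict_mod_in_zmod_vec[OF assms])
  show ?thesis
  proof (rule subgroup.intro)
    fix x assume x: "x \<in> supported_vecs q e S R j"
    then have "x \<in> carrier (zmod_vec q R)" by (simp add: supported_vecs_def)
    then show "inv\<^bsub>zmod_vec q R\<^esub> x \<in> supported_vecs q e S R j"
      using x restrict_mod_in_zmod_vec[OF assms] by (simp add: inv supported_vecs_def)
  qed (use m_closed one_closed in \<open>auto simp: supported_vecs_def one_zmod_vec mult_zmod_vec\<close>)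
qed

lemma card_supported_vecs_pos:
  assumes "0 < q" "finite R"
  shows "0 < card (supported_vecs q e S R j)"
proof -
  have "finite (carrier (zmod_vec q R))" using assms by (simp add: carrier_zmod_vec finite_PiE)
  then show ?thesis by (rule subgroup.finite_imp_card_positive[OF subgroup_supported_vecs[OF assms(1)]])
qed

text \<open>
Reading a block of entries as a tuple of vectors is a bijection from the possible values of the entries to
the tuples of supported vectors.
\<close>

lemma prob_block_vecs:
  assumes "finite R" "finite J" "0 < q" and inj: "inj_on (\<lambda>(i, j). e i j) (R \<times> J)"
  shows "measure_pmf.prob (entry_pmf q (S \<inter> block_index e R J)) {f. Q (\<lambda>j\<in>J. block_vec e R f j)} =
    real (card {w \<in> PiE J (supported_vecs q e S R). Q w}) / (\<Prod>j\<in>J. real (card (supported_vecs q e S R j)))"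
proof -
  let ?I = "S \<inter> block_index e R J"
  let ?D = "PiE_dflt ?I 0 (\<lambda>_. {0..<int q})"
  let ?W = "PiE J (supported_vecs q e S R)"
  let ?T = "\<lambda>f. \<lambda>j\<in>J. block_vec e R f j"
  let ?U = "\<lambda>w x. if x \<in> ?I then (case the_inv_into (R \<times> J) (\<lambda>(i, j). e i j) x of (i, j) \<Rightarrow> w j i) else 0"
  have fin: "finite ?I" using assms by (simp add: block_index_def)
  have D: "entry_pmf q ?I = pmf_of_set ?D"
    unfolding entry_pmf_def using fin assms(3) by (intro Pi_pmf_of_set) auto
  have finD: "finite ?D" "?D \<noteq> {}" using fin assms(3) by (auto intro!: finite_PiE_dflt)
  have inv: "the_inv_into (R \<times> J) (\<lambda>(i, j). e i j) (e i j) = (i, j)" if "i \<in> R" "j \<in> J" for i j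
    using the_inv_into_f_f[OF inj, of "(i, j)"] that by simp
  have bij: "bij_betw ?T ?D ?W"
  proof (rule bij_betwI[where g = ?U])
    show "?T \<in> ?D \<rightarrow> ?W"
    proof
      fix f assume f: "f \<in> ?D"
      then have "f x \<in> {0..<int q}" for x using assms(3) by (cases "x \<in> ?I") (auto simp: PiE_dflt_def)
      then show "?T f \<in> ?W"
        using f assms(3) by (auto simp: supported_vecs_def block_vec_def carrier_zmod_vec PiE_dflt_def)
    qed
    show "?U \<in> ?W \<rightarrow> ?D"
    proof
      fix w assume w: "w \<in> ?W"
      have "w j i \<in> {0..<int q}" if "i \<in> R" "j \<in> J" for i j
        using w that assms(3) by (auto simp: supported_vecs_def carrier_zmod_vec PiE_iff)
      then have "?U w x \<in> {0..<int q}" if "x \<in> ?I" for x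
        using that inv by (auto simp: block_index_def)
      then show "?U w \<in> ?D" by (auto simp: PiE_dflt_def)
    qed
    show "?U (?T f) = f" if f: "f \<in> ?D" for f
    proof
      fix x
      show "?U (?T f) x = f x"
        using f inv by (cases "x \<in> ?I") (auto simp: PiE_dflt_def block_vec_def block_index_def)
    qed
    show "?T (?U w) = w" if w: "w \<in> ?W" for w
    proof
      fix j
      show "?T (?U w) j = w j"
      proof (cases "j \<in> J")
        case True
        then have wj: "w j \<in> supported_vecs q e S R j" using w by auto
        have "block_vec e R (?U w) j i = w j i" for i
        proof (cases "i \<in> R")
          case i: True
          then have "e i j \<in> block_index e R J" using True by (auto simp: block_index_def)
          then show ?thesis using wj i True inv by (auto simp: block_vec_def supported_vecs_def)
        next
          case False
          then show ?thesis using wj assms(3)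
            by (auto simp: block_vec_def supported_vecs_def carrier_zmod_vec PiE_iff extensional_def)
        qed
        then show ?thesis using True by (simp add: fun_eq_iff)
      next
        case False
        then show ?thesis using w by (auto simp: PiE_iff extensional_def)
      qed
    qed
  qed
  have "bij_betw ?T (?D \<inter> {f. Q (?T f)}) {w \<in> ?W. Q w}"
    unfolding bij_betw_def
  proof
    show "inj_on ?T (?D \<inter> {f. Q (?T f)})" using bij by (auto simp: bij_betw_def intro: inj_on_subset)
    show "?T ` (?D \<inter> {f. Q (?T f)}) = {w \<in> ?W. Q w}"
      unfolding bij_betw_imp_surj_on[OF bij, symmetric] by auto
  qed
  then have "card (?D \<inter> {f. Q (?T f)}) = card {w \<in> ?W. Q w}" by (rule bij_betw_same_card)
  moreover have "card ?D = card ?W" using bij by (rule bij_betw_same_card)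
  moreover have "card ?W = (\<Prod>j\<in>J. card (supported_vecs q e S R j))" using assms(2) by (simp add: card_PiE)
  ultimately show ?thesis unfolding D measure_pmf_of_set[OF finD(2,1)] by simp
qed

lemma block_vec_carrier:
  assumes "finite I" "0 < q" "f \<in> set_pmf (entry_pmf q I)"
  shows "block_vec e R f j \<in> carrier (zmod_vec q R)"
proof -
  have "f x \<in> {0..<int q}" for x
    using assms by (cases "x \<in> I") (auto simp: set_entry_pmf PiE_dflt_def)
  then show ?thesis using assms(2) by (auto simp: block_vec_def carrier_zmod_vec)
qed

lemma glue_set_entry_pmf:
  assumes "finite I" "finite I'" "0 < q" "f \<in> set_pmf (entry_pmf q I)" "g \<in> set_pmf (entry_pmf q I')"
  shows "glue I f g \<in> set_pmf (entry_pmf q (I \<union> I'))"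
  using assms by (auto simp: set_entry_pmf PiE_dflt_def glue_def)

lemma block_vec_glue_left:
  assumes "finite I" "finite I'" "f \<in> set_pmf (entry_pmf q I)" "g \<in> set_pmf (entry_pmf q I')"
    and "\<And>i. i \<in> R \<Longrightarrow> e i j \<notin> I'"
  shows "block_vec e R (glue I f g) j = block_vec e R f j"
  unfolding block_vec_def
proof (rule restrict_ext)
  fix i assume i: "i \<in> R"
  show "glue I f g (e i j) = f (e i j)"
    using entry_pmf_outside[OF assms(1,3), of "e i j"] entry_pmf_outside[OF assms(2,4), of "e i j"] assms(5)[OF i]
    by (simp add: glue_def)
qed

lemma block_vec_glue_right:
  assumes "\<And>i. i \<in> R \<Longrightarrow> e i j \<notin> I"
  shows "block_vec e R (glue I f g) j = block_vec e R g j"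
  unfolding block_vec_def using assms by (intro restrict_ext) (simp add: glue_def)

lemma block_index_Un: "block_index e R (J1 \<union> J2) = block_index e R J1 \<union> block_index e R J2"
  by (auto simp: block_index_def)

lemma block_index_notin:
  assumes "inj_on (\<lambda>(i, j). e i j) (R \<times> (J1 \<union> J2))" "J1 \<inter> J2 = {}" "j \<in> J1" "i \<in> R"
  shows "e i j \<notin> block_index e R J2"
proof
  assume "e i j \<in> block_index e R J2"
  then obtain i' j' where "e i j = e i' j'" "i' \<in> R" "j' \<in> J2" by (auto simp: block_index_def)
  then have "(i, j) = (i', j')" using inj_onD[OF assms(1), of "(i, j)" "(i', j')"] assms by auto
  then show False using assms \<open>j' \<in> J2\<close> by auto
qed

lemma block_index_disjoint:
  assumes "inj_on (\<lambda>(i, j). e i j) (R \<times> (J1 \<union> J2))" "J1 \<inter> J2 = {}"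
  shows "block_index e R J1 \<inter> block_index e R J2 = {}"
proof -
  have "x \<notin> block_index e R J2" if "x \<in> block_index e R J1" for x
  proof -
    obtain i j where "x = e i j" "i \<in> R" "j \<in> J1" using \<open>x \<in> block_index e R J1\<close>
      by (auto simp: block_index_def)
    then show ?thesis using block_index_notin[OF assms] by simp
  qed
  then show ?thesis by blast
qed

section \<open>Ranks of partial matrices\<close>

lemma powers_subgroup_zmod_vec:
  assumes p: "Factorial_Ring.prime (p::nat)" and q: "q = p ^ Suc m" and N: "finite N"
  shows "subgroup ((\<lambda>x. x [^]\<^bsub>zmod_vec q N\<^esub> p) ` carrier (zmod_vec q N)) (zmod_vec q N)"
    and "order (zmod_vec q N) = p ^ card N * card ((\<lambda>x. x [^]\<^bsub>zmod_vec q N\<^esub> p) ` carrier (zmod_vec q N))"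
proof -
  interpret A: comm_group "zmod_vec q N" by (rule comm_group_zmod_vec)
  show "subgroup ((\<lambda>x. x [^]\<^bsub>zmod_vec q N\<^esub> p) ` carrier (zmod_vec q N)) (zmod_vec q N)"
    and "order (zmod_vec q N) = p ^ card N * card ((\<lambda>x. x [^]\<^bsub>zmod_vec q N\<^esub> p) ` carrier (zmod_vec q N))"
    using index_powers_of_subgroup[OF p _ _ N A.subgroup_self, of "p ^ m"] p q
    by (auto simp: order_def prime_gt_0_nat)
qed

lemma card_generate_with_powers_le:
  assumes p: "Factorial_Ring.prime (p::nat)" and q: "q = p ^ Suc m"
    and fin: "finite N" "finite J2" and card: "card N = k + card J2"
    and Y: "Y ` J2 \<subseteq> carrier (zmod_vec q N)"
  shows "p ^ k * card (generate (zmod_vec q N)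
      ((\<lambda>x. x [^]\<^bsub>zmod_vec q N\<^esub> p) ` carrier (zmod_vec q N) \<union> Y ` J2)) \<le> order (zmod_vec q N)"
proof -
  let ?A = "zmod_vec q N"
  let ?pA = "(\<lambda>x. x [^]\<^bsub>?A\<^esub> p) ` carrier ?A"
  interpret A: finite_abelian_pgroup ?A p unfolding q using p fin by (intro zmod_vec_pgroup)
  have "card (generate ?A (?pA \<union> Y ` J2)) \<le> p ^ card J2 * card ?pA"
    using Y fin powers_subgroup_zmod_vec(1)[OF p q fin(1)] by (intro A.card_generate_Un_le) auto
  then have "p ^ k * card (generate ?A (?pA \<union> Y ` J2)) \<le> p ^ k * (p ^ card J2 * card ?pA)"
    by (rule mult_left_mono) simp
  also have "\<dots> = order ?A"
    unfolding powers_subgroup_zmod_vec(2)[OF p q fin(1)] by (simp add: card power_add)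
  finally show ?thesis .
qed

text \<open>
Expose the vectors with index in \<open>J2\<close> first. Even if they are as independent as possible, the
\<open>p\<close>-th powers and these vectors generate a subgroup of index at least \<open>p\<close> to the size of \<open>J1\<close>, and the
remaining vectors complete it with at most the probability from \<open>card_generating_tuples_le\<close>.
\<close>

lemma prob_generating_le:
  assumes p: "Factorial_Ring.prime (p::nat)" and q: "q = p ^ Suc m"
    and fin: "finite N" "finite J1" "finite J2" and J: "J1 \<inter> J2 = {}" "card N = card J1 + card J2"
    and inj: "inj_on (\<lambda>(i, j). e i j) (N \<times> (J1 \<union> J2))"
    and gen: "\<And>f. f \<in> set_pmf (entry_pmf q (S \<inter> block_index e N (J1 \<union> J2))) \<Longrightarrow> Q f \<Longrightarrow>
      generate (zmod_vec q N) (block_vec e N f ` (J1 \<union> J2)) = carrier (zmod_vec q N)"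
    and R: "\<And>f g. f \<in> set_pmf (entry_pmf q (S \<inter> block_index e N J2)) \<Longrightarrow>
      g \<in> set_pmf (entry_pmf q (S \<inter> block_index e N J1)) \<Longrightarrow>
      Q (glue (S \<inter> block_index e N J2) f g) \<Longrightarrow> R f"
  shows "measure_pmf.prob (entry_pmf q (S \<inter> block_index e N (J1 \<union> J2))) {f. Q f} \<le>
    inverse_power_prod p (card J1) * measure_pmf.prob (entry_pmf q (S \<inter> block_index e N J2)) {f. R f}"
proof -
  let ?A = "zmod_vec q N"
  let ?I1 = "S \<inter> block_index e N J1" and ?I2 = "S \<inter> block_index e N J2"
  let ?pA = "(\<lambda>x. x [^]\<^bsub>?A\<^esub> p) ` carrier ?A"
  interpret A: finite_abelian_pgroup ?A p unfolding q using p fin by (intro zmod_vec_pgroup)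
  have q0: "0 < q" unfolding q using p by (simp add: prime_gt_0_nat)
  have finI: "finite ?I1" "finite ?I2" using fin by (auto simp: block_index_def)
  have inj1: "inj_on (\<lambda>(i, j). e i j) (N \<times> J1)" using inj by (rule inj_on_subset) auto
  have disj: "e i j \<notin> block_index e N J2" if "j \<in> J1" "i \<in> N" for i j
    using block_index_notin[OF inj J(1) that] .
  have disj': "e i j \<notin> block_index e N J1" if "j \<in> J2" "i \<in> N" for i j
    using block_index_notin[of e N J2 J1, OF _ _ that] inj J(1) by (simp add: Un_commute Int_commute)
  have I: "?I2 \<inter> ?I1 = {}" using block_index_disjoint[OF inj J(1)] by blast
  have eq: "S \<inter> block_index e N (J1 \<union> J2) = ?I2 \<union> ?I1" by (auto simp: block_index_Un)
  have cpos: "0 \<le> inverse_power_prod p (card J1)" using inverse_power_prod_pos[OF A.p_gt_1] by (rule less_imp_le)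
  show ?thesis unfolding eq
  proof (rule prob_entry_pmf_Un_le[OF finI(2,1) I cpos])
    fix f assume f: "f \<in> set_pmf (entry_pmf q ?I2)"
    let ?P = "measure_pmf.prob (entry_pmf q ?I1)"
    show "?P {g. Q (glue ?I2 f g)} \<le> (if R f then inverse_power_prod p (card J1) else 0)"
    proof (cases "R f")
      case False
      then have "?P {g. Q (glue ?I2 f g)} \<le> ?P {g. False}" by (intro prob_mono_pmf) (use R f in auto)
      then show ?thesis using False by simp
    next
      case True
      have Yc: "block_vec e N f ` J2 \<subseteq> carrier ?A" using block_vec_carrier[OF finI(2) q0 f] by auto
      let ?S = "generate ?A (?pA \<union> block_vec e N f ` J2)"
      have subS: "subgroup ?S ?A" using Yc by (intro A.generate_is_subgroup) auto
      have powS: "x [^]\<^bsub>?A\<^esub> p \<in> ?S" if "x \<in> carrier ?A" for x using that by (auto intro: generate.incl)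
      have le: "p ^ card J1 * card ?S \<le> order ?A"
        by (rule card_generate_with_powers_le[OF p q fin(1,3) J(2) Yc])
      let ?B = "supported_vecs q e S N"
      let ?G = "\<lambda>w. generate ?A (?S \<union> w ` J1) = carrier ?A"
      have "?P {g. Q (glue ?I2 f g)} \<le> ?P {g. ?G (\<lambda>j\<in>J1. block_vec e N g j)}"
      proof (rule prob_mono_pmf)
        fix g assume g: "g \<in> set_pmf (entry_pmf q ?I1)" and Q: "Q (glue ?I2 f g)"
        have gc: "block_vec e N g ` J1 \<subseteq> carrier ?A" using block_vec_carrier[OF finI(1) q0 g] by auto
        have "block_vec e N (glue ?I2 f g) ` J1 = block_vec e N g ` J1"
          by (intro image_cong refl block_vec_glue_right) (use disj in auto)
        moreover have "block_vec e N (glue ?I2 f g) ` J2 = block_vec e N f ` J2"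
          by (intro image_cong refl block_vec_glue_left[OF finI(2,1) f g]) (use disj' in auto)
        moreover have "generate ?A (block_vec e N (glue ?I2 f g) ` (J1 \<union> J2)) = carrier ?A"
          using gen[OF _ Q] glue_set_entry_pmf[OF finI(2,1) q0 f g] unfolding eq by simp
        ultimately have "generate ?A (block_vec e N g ` J1 \<union> block_vec e N f ` J2) = carrier ?A"
          by (simp add: image_Un)
        moreover have "block_vec e N g ` J1 \<union> block_vec e N f ` J2 \<subseteq> ?S \<union> block_vec e N g ` J1"
          by (auto intro: generate.incl)
        ultimately have "carrier ?A \<subseteq> generate ?A (?S \<union> block_vec e N g ` J1)"
          using A.mono_generate by metis
        moreover have "generate ?A (?S \<union> block_vec e N g ` J1) \<subseteq> carrier ?A"
          using gc subgroup.subset[OF subS] by (intro A.generate_incl) auto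
        moreover have "(\<lambda>j\<in>J1. block_vec e N g j) ` J1 = block_vec e N g ` J1" by auto
        ultimately show "?G (\<lambda>j\<in>J1. block_vec e N g j)" by auto
      qed
      also have "\<dots> = real (card {w \<in> PiE J1 ?B. ?G w}) / (\<Prod>j\<in>J1. real (card (?B j)))"
        by (rule prob_block_vecs[OF fin(1,2) q0 inj1])
      also have "\<dots> \<le> inverse_power_prod p (card J1)"
      proof -
        have pos: "0 < (\<Prod>j\<in>J1. real (card (?B j)))"
          by (intro prod_pos) (simp add: card_supported_vecs_pos[OF q0 fin(1)])
        have "real (card {w \<in> PiE J1 ?B. ?G w}) \<le>
          (if order ?A = p ^ card J1 * card ?S then inverse_power_prod p (card J1) else 0) * (\<Prod>j\<in>J1. real (card (?B j)))"
          by (rule A.card_generating_tuples_le[OF fin(2) subgroup_supported_vecs[OF q0] subS powS le])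
        also have "\<dots> \<le> inverse_power_prod p (card J1) * (\<Prod>j\<in>J1. real (card (?B j)))"
          using cpos pos by (intro mult_right_mono) auto
        finally show ?thesis using pos by (simp add: pos_divide_le_eq)
      qed
      finally show ?thesis using True by simp
    qed
  qed
qed

text \<open>
Over the \<open>p\<close>-th powers, each vector multiplies the order of the generated subgroup by at most \<open>p\<close>. The
number of vectors is the number of coordinates, so no vector can be wasted.
\<close>

lemma card_generate_first_columns:
  assumes p: "Factorial_Ring.prime (p::nat)" and q: "q = p ^ Suc m"
    and fin: "finite N" "finite J1" "finite J2" and card: "card N = card J1 + card J2"
    and Y: "Y ` J2 \<subseteq> carrier (zmod_vec q N)" and W: "W ` J1 \<subseteq> carrier (zmod_vec q N)"
    and gen: "generate (zmod_vec q N) (Y ` J2 \<union> W ` J1) = carrier (zmod_vec q N)"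
  shows "p ^ card J1 * card (generate (zmod_vec q N)
      ((\<lambda>x. x [^]\<^bsub>zmod_vec q N\<^esub> p) ` carrier (zmod_vec q N) \<union> Y ` J2)) = order (zmod_vec q N)"
proof -
  let ?A = "zmod_vec q N"
  let ?pA = "(\<lambda>x. x [^]\<^bsub>?A\<^esub> p) ` carrier ?A"
  interpret A: finite_abelian_pgroup ?A p unfolding q using p fin by (intro zmod_vec_pgroup)
  let ?S = "generate ?A (?pA \<union> Y ` J2)"
  have subS: "subgroup ?S ?A" using Y by (intro A.generate_is_subgroup) auto
  have powS: "x [^]\<^bsub>?A\<^esub> p \<in> ?S" if "x \<in> carrier ?A" for x using that by (auto intro: generate.incl)
  have le: "p ^ card J1 * card ?S \<le> order ?A"
    by (rule card_generate_with_powers_le[OF p q fin(1,3) card Y])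
  have "carrier ?A \<subseteq> generate ?A (?S \<union> W ` J1)"
    unfolding gen[symmetric] by (rule A.mono_generate) (auto intro: generate.incl)
  moreover have "generate ?A (?S \<union> W ` J1) \<subseteq> carrier ?A"
    using W subgroup.subset[OF subS] by (intro A.generate_incl) auto
  ultimately have "order ?A = card (generate ?A (?S \<union> W ` J1))" by (simp add: order_def)
  also have "\<dots> \<le> p ^ card J1 * card ?S"
    using W fin powS by (intro A.card_generate_Un_le subS) auto
  finally show ?thesis using le by simp
qed

text \<open>
If the vectors with index in \<open>J1\<close> do not generate, they lie in a subgroup of index \<open>p\<close>. Each further
vector falls into it with probability at least \<open>1 / p\<close>, whatever its support.
\<close>

lemma prob_not_generating_ge:
  assumes p: "Factorial_Ring.prime (p::nat)" and q: "q = p ^ Suc m"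
    and fin: "finite R" "finite J1" "finite J2" and J: "J1 \<inter> J2 = {}"
    and inj: "inj_on (\<lambda>(i, j). e i j) (R \<times> (J1 \<union> J2))"
  shows "(1 / p) ^ card J2 * measure_pmf.prob (entry_pmf q (S \<inter> block_index e R J1))
      {f. generate (zmod_vec q R) (block_vec e R f ` J1) \<noteq> carrier (zmod_vec q R)} \<le>
    1 - measure_pmf.prob (entry_pmf q (S \<inter> block_index e R (J1 \<union> J2)))
      {f. generate (zmod_vec q R) (block_vec e R f ` (J1 \<union> J2)) = carrier (zmod_vec q R)}"
proof -
  let ?A = "zmod_vec q R"
  let ?I1 = "S \<inter> block_index e R J1" and ?I2 = "S \<inter> block_index e R J2"
  interpret A: finite_abelian_pgroup ?A p unfolding q using p fin by (intro zmod_vec_pgroup)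
  have q0: "0 < q" unfolding q using p by (simp add: prime_gt_0_nat)
  have p0: "0 < p" using A.p_gt_1 by simp
  have finI: "finite ?I1" "finite ?I2" using fin by (auto simp: block_index_def)
  have inj2: "inj_on (\<lambda>(i, j). e i j) (R \<times> J2)" using inj by (rule inj_on_subset) auto
  have disj: "e i j \<notin> block_index e R J2" if "j \<in> J1" "i \<in> R" for i j
    using block_index_notin[OF inj J that] .
  have disj': "e i j \<notin> block_index e R J1" if "j \<in> J2" "i \<in> R" for i j
    using block_index_notin[of e R J2 J1, OF _ _ that] inj J by (simp add: Un_commute Int_commute)
  have I: "?I1 \<inter> ?I2 = {}" using block_index_disjoint[OF inj J] by blast
  have eq: "S \<inter> block_index e R (J1 \<union> J2) = ?I1 \<union> ?I2" by (auto simp: block_index_Un)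
  let ?Q = "\<lambda>f. generate ?A (block_vec e R f ` (J1 \<union> J2)) = carrier ?A"
  have "(1 / p) ^ card J2 * measure_pmf.prob (entry_pmf q ?I1) {f. generate ?A (block_vec e R f ` J1) \<noteq> carrier ?A}
      \<le> measure_pmf.prob (entry_pmf q (?I1 \<union> ?I2)) {f. \<not> ?Q f}"
  proof (rule prob_entry_pmf_Un_ge[OF finI I])
    fix f assume f: "f \<in> set_pmf (entry_pmf q ?I1)" and ne: "generate ?A (block_vec e R f ` J1) \<noteq> carrier ?A"
    let ?P = "measure_pmf.prob (entry_pmf q ?I2)"
    let ?B = "supported_vecs q e S R"
    have Yc: "block_vec e R f ` J1 \<subseteq> carrier ?A" using block_vec_carrier[OF finI(1) q0 f] by auto
    obtain M where M: "subgroup M ?A" "generate ?A (block_vec e R f ` J1) \<subseteq> M" "order ?A = p * card M"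
      using A.obtain_index_p_subgroup[OF A.generate_is_subgroup[OF Yc] ne] by blast
    have B: "subgroup (?B j) ?A" for j by (rule subgroup_supported_vecs[OF q0])
    have Bpos: "0 < card (?B j)" for j by (rule card_supported_vecs_pos[OF q0 fin(1)])
    have Mpos: "0 < card M" using M(1) A.finite_carrier by (meson subgroup.finite_imp_card_positive)
    have half: "1 / real p \<le> real (card (?B j \<inter> M)) / real (card (?B j))" for j
    proof -
      have "card (?B j) * card M \<le> p * card M * card (?B j \<inter> M)"
        using A.subgroup_inter_card_le[OF B M(1)] unfolding M(3) .
      then have "card (?B j) \<le> p * card (?B j \<inter> M)" using Mpos by (simp add: mult.commute mult.left_commute)
      then show ?thesis using Bpos[of j] p0 by (simp add: field_simps flip: of_nat_mult)
    qed
    have "(1 / real p) ^ card J2 = (\<Prod>j\<in>J2. 1 / real p)" by simp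
    also have "\<dots> \<le> (\<Prod>j\<in>J2. real (card (?B j \<inter> M)) / real (card (?B j)))"
      using half by (intro prod_mono) auto
    also have "\<dots> = real (card (PiE J2 (\<lambda>j. ?B j \<inter> M))) / (\<Prod>j\<in>J2. real (card (?B j)))"
      using fin(3) by (simp add: card_PiE prod_dividef)
    also have "PiE J2 (\<lambda>j. ?B j \<inter> M) = {w \<in> PiE J2 ?B. w ` J2 \<subseteq> M}"
      unfolding PiE_def Pi_def by auto
    also have "real (card {w \<in> PiE J2 ?B. w ` J2 \<subseteq> M}) / (\<Prod>j\<in>J2. real (card (?B j))) =
        ?P {g. (\<lambda>j\<in>J2. block_vec e R g j) ` J2 \<subseteq> M}"
      by (rule prob_block_vecs[OF fin(1,3) q0 inj2, symmetric])
    also have "\<dots> \<le> ?P {g. \<not> ?Q (glue ?I1 f g)}"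
    proof (rule prob_mono_pmf)
      fix g assume g: "g \<in> set_pmf (entry_pmf q ?I2)" and sub: "(\<lambda>j\<in>J2. block_vec e R g j) ` J2 \<subseteq> M"
      have "block_vec e R (glue ?I1 f g) ` J2 = block_vec e R g ` J2"
        by (intro image_cong refl block_vec_glue_right) (use disj' in auto)
      moreover have "block_vec e R (glue ?I1 f g) ` J1 = block_vec e R f ` J1"
        by (intro image_cong refl block_vec_glue_left[OF finI f g]) (use disj in auto)
      moreover have "block_vec e R f ` J1 \<subseteq> M"
        using M(2) generate.incl[of _ "block_vec e R f ` J1" ?A] by blast
      ultimately have "block_vec e R (glue ?I1 f g) ` (J1 \<union> J2) \<subseteq> M"
        using sub by (auto simp: image_Un)
      then have "generate ?A (block_vec e R (glue ?I1 f g) ` (J1 \<union> J2)) \<subseteq> M"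
        using M(1) by (intro A.generate_subgroup_incl)
      then have "?Q (glue ?I1 f g) \<Longrightarrow> order ?A \<le> card M"
        using A.finite_subgroup[OF M(1)] by (simp add: order_def card_mono)
      then show "\<not> ?Q (glue ?I1 f g)" using M(3) Mpos A.p_gt_1 by auto
    qed
    finally show "(1 / real p) ^ card J2 \<le> ?P {g. \<not> ?Q (glue ?I1 f g)}" .
  qed simp
  then show ?thesis unfolding eq prob_not_pmf .
qed

section \<open>Invertibility and the distribution of the cokernel\<close>

lemma block_index_Pair: "block_index Pair R J = R \<times> J"
  by (auto simp: block_index_def)

lemma block_index_flip: "block_index (\<lambda>i j. (j, i)) R J = J \<times> R"
  by (auto simp: block_index_def)

lemma restrict_block_vec: "R \<subseteq> N \<Longrightarrow> restrict (block_vec e N f j) R = block_vec e R f j"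
  unfolding block_vec_def by (auto simp: restrict_def fun_eq_iff)

lemma generate_restrict_carrier:
  assumes "R \<subseteq> N" "0 < q" "Y \<subseteq> carrier (zmod_vec q N)" "generate (zmod_vec q N) Y = carrier (zmod_vec q N)"
  shows "generate (zmod_vec q R) ((\<lambda>x. restrict x R) ` Y) = carrier (zmod_vec q R)"
proof -
  interpret r: group_hom "zmod_vec q N" "zmod_vec q R" "\<lambda>x. restrict x R"
    using assms(1) by (rule group_hom_restrict_zmod_vec)
  show ?thesis
    unfolding r.generate_img[OF assms(3)] assms(4) by (rule restrict_zmod_vec_surj[OF assms(1,2)])
qed

definition cols_generate :: "nat \<Rightarrow> nat set \<Rightarrow> nat set \<Rightarrow> (nat \<times> nat \<Rightarrow> int) \<Rightarrow> bool" where
  "cols_generate q R J f \<longleftrightarrow> generate (zmod_vec q R) (block_vec Pair R f ` J) = carrier (zmod_vec q R)"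

definition rows_generate :: "nat \<Rightarrow> nat set \<Rightarrow> nat set \<Rightarrow> (nat \<times> nat \<Rightarrow> int) \<Rightarrow> bool" where
  "rows_generate q N J f \<longleftrightarrow>
    generate (zmod_vec q N) (block_vec (\<lambda>i j. (j, i)) N f ` J) = carrier (zmod_vec q N)"

text \<open>
Expose the rows from \<open>s\<close> on first. If the columns of the matrix generate, then so do their
restrictions to these rows; this fails with the probability bounded in \<open>prob_not_generating_ge\<close>. The
other \<open>s\<close> rows contribute the factor in front. The event contains both the rows and
the columns because the two parts of the argument use different ones.
\<close>

lemma prob_full_rank_le_row_block:
  assumes p: "Factorial_Ring.prime (p::nat)" and q: "q = p ^ Suc m"
    and S: "S \<subseteq> {..<n} \<times> {..<n}" and s: "s \<le> n"
    and J: "J1 \<union> J2 = {..<n}" "J1 \<inter> J2 = {}"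
  shows "measure_pmf.prob (entry_pmf q S) {f. cols_generate q {..<n} {..<n} f \<and> rows_generate q {..<n} {..<n} f} \<le>
    inverse_power_prod p s * (1 - (1 / p) ^ card J2 *
      measure_pmf.prob (entry_pmf q (S \<inter> {s..<n} \<times> J1)) {f. \<not> cols_generate q {s..<n} J1 f})"
proof -
  let ?N = "{..<n}" and ?R = "{s..<n}"
  let ?e = "\<lambda>(i::nat) (j::nat). (j, i)"
  have q0: "0 < q" unfolding q using p by (simp add: prime_gt_0_nat)
  have N: "{..<s} \<union> ?R = ?N" using s by auto
  have S1: "S \<inter> block_index ?e ?N ({..<s} \<union> ?R) = S" unfolding N block_index_flip using S by auto
  have S2: "S \<inter> block_index ?e ?N ?R = S \<inter> ?R \<times> ?N" by (simp add: block_index_flip)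
  have finS: "finite S" using S by (rule finite_subset) simp
  have "measure_pmf.prob (entry_pmf q (S \<inter> block_index ?e ?N ({..<s} \<union> ?R)))
      {f. cols_generate q ?N ?N f \<and> rows_generate q ?N ?N f} \<le>
    inverse_power_prod p (card {..<s}) *
      measure_pmf.prob (entry_pmf q (S \<inter> block_index ?e ?N ?R)) {f. cols_generate q ?R ?N f}"
  proof (rule prob_generating_le[OF p q])
    show "inj_on (\<lambda>(i, j). (j, i)) (?N \<times> ({..<s} \<union> ?R))" by (auto simp: inj_on_def)
    show "generate (zmod_vec q ?N) (block_vec ?e ?N f ` ({..<s} \<union> ?R)) = carrier (zmod_vec q ?N)"
      if "cols_generate q ?N ?N f \<and> rows_generate q ?N ?N f" for f
      using that unfolding N rows_generate_def by simp
    show "cols_generate q ?R ?N f"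
      if f: "f \<in> set_pmf (entry_pmf q (S \<inter> block_index ?e ?N ?R))"
        and g: "g \<in> set_pmf (entry_pmf q (S \<inter> block_index ?e ?N {..<s}))"
        and Q: "cols_generate q ?N ?N (glue (S \<inter> block_index ?e ?N ?R) f g) \<and>
          rows_generate q ?N ?N (glue (S \<inter> block_index ?e ?N ?R) f g)" for f g
    proof -
      let ?h = "glue (S \<inter> block_index ?e ?N ?R) f g"
      have fin: "finite (S \<inter> block_index ?e ?N ?R)" "finite (S \<inter> block_index ?e ?N {..<s})"
        using finS by auto
      have h: "block_vec Pair ?N ?h ` ?N \<subseteq> carrier (zmod_vec q ?N)"
        using block_vec_carrier[OF finite_UnI[OF fin] q0 glue_set_entry_pmf[OF fin q0 f g]] by auto
      have "generate (zmod_vec q ?R) ((\<lambda>x. restrict x ?R) ` block_vec Pair ?N ?h ` ?N) = carrier (zmod_vec q ?R)"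
        by (rule generate_restrict_carrier[OF _ q0 h]) (use Q in \<open>auto simp: cols_generate_def\<close>)
      moreover have "(\<lambda>x. restrict x ?R) ` block_vec Pair ?N ?h ` ?N = block_vec Pair ?R f ` ?N"
        unfolding image_image
      proof (rule image_cong[OF refl])
        fix j
        have "restrict (block_vec Pair ?N ?h j) ?R = block_vec Pair ?R ?h j" by (rule restrict_block_vec) auto
        also have "\<dots> = block_vec Pair ?R f j"
          by (rule block_vec_glue_left[OF fin f g]) (auto simp: block_index_flip)
        finally show "restrict (block_vec Pair ?N ?h j) ?R = block_vec Pair ?R f j" .
      qed
      ultimately show ?thesis by (simp add: cols_generate_def)
    qed
  qed (use s in auto)
  then have 1: "measure_pmf.prob (entry_pmf q S) {f. cols_generate q ?N ?N f \<and> rows_generate q ?N ?N f} \<le>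
      inverse_power_prod p s * measure_pmf.prob (entry_pmf q (S \<inter> ?R \<times> ?N)) {f. cols_generate q ?R ?N f}"
    unfolding S1 S2 by simp
  have finJ: "finite J1" "finite J2" using J(1) by (metis finite_Un finite_lessThan)+
  have "(1 / p) ^ card J2 * measure_pmf.prob (entry_pmf q (S \<inter> block_index Pair ?R J1))
      {f. generate (zmod_vec q ?R) (block_vec Pair ?R f ` J1) \<noteq> carrier (zmod_vec q ?R)} \<le>
    1 - measure_pmf.prob (entry_pmf q (S \<inter> block_index Pair ?R (J1 \<union> J2)))
      {f. generate (zmod_vec q ?R) (block_vec Pair ?R f ` (J1 \<union> J2)) = carrier (zmod_vec q ?R)}"
    by (rule prob_not_generating_ge[OF p q _ finJ J(2)]) (auto simp: inj_on_def)
  then have "measure_pmf.prob (entry_pmf q (S \<inter> ?R \<times> ?N)) {f. cols_generate q ?R ?N f} \<le>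
      1 - (1 / p) ^ card J2 * measure_pmf.prob (entry_pmf q (S \<inter> ?R \<times> J1)) {f. \<not> cols_generate q ?R J1 f}"
    unfolding block_index_Pair J(1) cols_generate_def by simp
  then have "inverse_power_prod p s * measure_pmf.prob (entry_pmf q (S \<inter> ?R \<times> ?N)) {f. cols_generate q ?R ?N f} \<le>
    inverse_power_prod p s * (1 - (1 / p) ^ card J2 * measure_pmf.prob (entry_pmf q (S \<inter> ?R \<times> J1)) {f. \<not> cols_generate q ?R J1 f})"
    using inverse_power_prod_pos[OF prime_gt_1_nat[OF p], of s] by (intro mult_left_mono) auto
  with 1 show ?thesis by (rule order_trans)
qed

text \<open>
The last row is a block of one row that vanishes outside of the columns with \<open>n \<le> j + t\<close>. Without these
at most \<open>t + 1\<close> columns, nothing is generated.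
\<close>

lemma prob_full_rank_narrow_le:
  assumes p: "Factorial_Ring.prime (p::nat)" and q: "q = p ^ Suc m"
    and S: "S \<subseteq> {..<Suc n} \<times> {..<Suc n}" and narrow: "\<And>j. (n, j) \<in> S \<Longrightarrow> n \<le> j + t"
  shows "measure_pmf.prob (entry_pmf q S)
      {f. cols_generate q {..<Suc n} {..<Suc n} f \<and> rows_generate q {..<Suc n} {..<Suc n} f} \<le>
    inverse_power_prod p n * (1 - (1 / p) ^ Suc t)"
proof -
  let ?J1 = "{j. j < Suc n \<and> j + t < n}" and ?J2 = "{j. j < Suc n \<and> n \<le> j + t}" and ?R = "{n..<Suc n}"
  have p1: "1 < p" using p by (rule prime_gt_1_nat)
  then have q1: "1 < q" unfolding q by (rule one_less_power) simp
  have empty: "S \<inter> ?R \<times> ?J1 = {}" using narrow by fastforce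
  have "\<not> cols_generate q ?R ?J1 (\<lambda>_. 0)"
  proof
    interpret A: comm_group "zmod_vec q ?R" by (rule comm_group_zmod_vec)
    assume "cols_generate q ?R ?J1 (\<lambda>_. 0)"
    moreover have "block_vec Pair ?R (\<lambda>_. 0) ` ?J1 \<subseteq> {\<one>\<^bsub>zmod_vec q ?R\<^esub>}"
      by (auto simp: block_vec_def one_zmod_vec)
    then have "generate (zmod_vec q ?R) (block_vec Pair ?R (\<lambda>_. 0) ` ?J1) \<subseteq> {\<one>\<^bsub>zmod_vec q ?R\<^esub>}"
      by (intro A.generate_subgroup_incl A.triv_subgroup)
    ultimately have "carrier (zmod_vec q ?R) \<subseteq> {\<one>\<^bsub>zmod_vec q ?R\<^esub>}" by (simp add: cols_generate_def)
    moreover have "(\<lambda>i\<in>?R. 1) \<in> carrier (zmod_vec q ?R)" using q1 by (simp add: carrier_zmod_vec)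
    ultimately have "(\<lambda>i\<in>?R. 1::int) = (\<lambda>i\<in>?R. 0)" unfolding one_zmod_vec by blast
    from fun_cong[OF this, of n] show False by simp
  qed
  then have prob1: "measure_pmf.prob (entry_pmf q (S \<inter> ?R \<times> ?J1)) {f. \<not> cols_generate q ?R ?J1 f} = 1"
    unfolding empty entry_pmf_def by simp
  have "?J2 \<subseteq> {n - t..n}" by auto
  then have "card ?J2 \<le> card {n - t..n}" by (intro card_mono) auto
  also have "\<dots> \<le> Suc t" by simp
  finally have "(1 / real p) ^ Suc t \<le> (1 / real p) ^ card ?J2"
    using p1 by (intro power_decreasing) auto
  then have "inverse_power_prod p n * (1 - (1 / p) ^ card ?J2) \<le> inverse_power_prod p n * (1 - (1 / p) ^ Suc t)"
    using inverse_power_prod_pos[OF p1, of n] by (intro mult_left_mono) auto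
  moreover have "?J1 \<union> ?J2 = {..<Suc n}" "?J1 \<inter> ?J2 = {}" by auto
  from prob_full_rank_le_row_block[OF p q S _ this, of n]
  have "measure_pmf.prob (entry_pmf q S)
      {f. cols_generate q {..<Suc n} {..<Suc n} f \<and> rows_generate q {..<Suc n} {..<Suc n} f} \<le>
    inverse_power_prod p n * (1 - (1 / p) ^ card ?J2)"
    unfolding prob1 by simp
  ultimately show ?thesis by (rule order_trans[rotated])
qed

text \<open>
The probability that the cokernel of a uniform \<open>k \<times> k\<close> matrix over \<open>\<int>/q\<close> is isomorphic to \<open>K\<close>.
\<close>

definition square_cok_prob :: "nat \<Rightarrow> nat \<Rightarrow> ('k, 'l) monoid_scheme \<Rightarrow> real" where
  "square_cok_prob q k K =
    real (card {w \<in> PiE {..<k} (\<lambda>_. carrier (zmod_vec q {..<k})).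
      zmod_vec q {..<k} Mod generate (zmod_vec q {..<k}) (w ` {..<k}) \<cong> K}) /
    real (order (zmod_vec q {..<k})) ^ k"

text \<open>
Expose the columns from \<open>k\<close> on first. They are good if they are independent modulo \<open>p\<close>
and if their restrictions to the rows from \<open>s\<close> on generate. Then every vector agrees, up to a combination of
these columns, with one that is supported on the first \<open>s\<close> rows. So by the assumption \<open>corner\<close> each of
the first \<open>k\<close> columns is uniform in the quotient by the others, which is free of rank \<open>k\<close>.
\<close>

lemma prob_cok_approx:
  fixes K :: "('k, 'l) monoid_scheme"
  assumes p: "Factorial_Ring.prime (p::nat)" and q: "q = p ^ Suc m"
    and S: "S \<subseteq> {..<n} \<times> {..<n}" and s: "s \<le> n" and k: "k \<le> n"
    and corner: "{..<s} \<times> {..<k} \<subseteq> S"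
    and \<delta>: "\<delta> = measure_pmf.prob (entry_pmf q S) {f. cols_generate q {..<n} {..<n} f \<and> rows_generate q {..<n} {..<n} f}"
  shows "\<bar>measure_pmf.prob (entry_pmf q S)
      {f. zmod_vec q {..<n} Mod generate (zmod_vec q {..<n}) (block_vec Pair {..<n} f ` {..<n}) \<cong> K} -
      square_cok_prob q k K\<bar> \<le>
    (1 - \<delta> / inverse_power_prod p k) + real p ^ k * (1 - \<delta> / inverse_power_prod p s)"
proof -
  let ?N = "{..<n}" and ?R = "{s..<n}" and ?J1 = "{..<k}" and ?J2 = "{k..<n}"
  let ?A = "zmod_vec q ?N" and ?V = "zmod_vec q ?J1"
  let ?pA = "(\<lambda>x. x [^]\<^bsub>?A\<^esub> p) ` carrier ?A"
  have p1: "1 < p" using p by (rule prime_gt_1_nat)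
  have q0: "0 < q" unfolding q using p1 by simp
  interpret A: finite_abelian_pgroup ?A p unfolding q using p by (intro zmod_vec_pgroup) auto
  interpret V: comm_group ?V by (rule comm_group_zmod_vec)
  have finS: "finite S" using S by (rule finite_subset) simp
  have N: "?J1 \<union> ?J2 = ?N" "?J1 \<inter> ?J2 = {}" using k by auto
  let ?I1 = "S \<inter> ?N \<times> ?J1" and ?I2 = "S \<inter> ?N \<times> ?J2"
  have SU: "?I2 \<union> ?I1 = S" using S k by auto
  have fin: "finite ?I1" "finite ?I2" using finS by auto
  have disj: "?I2 \<inter> ?I1 = {}" by auto
  let ?rank = "\<lambda>f. p ^ card ?J1 * card (generate ?A (?pA \<union> block_vec Pair ?N f ` ?J2)) = order ?A"
  let ?good = "\<lambda>f. ?rank f \<and> cols_generate q ?R ?J2 f"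
  let ?P2 = "measure_pmf.prob (entry_pmf q ?I2)"
  have cpos: "0 < inverse_power_prod p i" for i using p1 by (rule inverse_power_prod_pos)

  have "\<delta> \<le> inverse_power_prod p (card ?J1) * ?P2 {f. ?rank f}"
  proof -
    have "measure_pmf.prob (entry_pmf q (S \<inter> block_index Pair ?N (?J1 \<union> ?J2)))
        {f. cols_generate q ?N ?N f \<and> rows_generate q ?N ?N f} \<le>
      inverse_power_prod p (card ?J1) * measure_pmf.prob (entry_pmf q (S \<inter> block_index Pair ?N ?J2)) {f. ?rank f}"
    proof (rule prob_generating_le[OF p q])
      show "generate ?A (block_vec Pair ?N f ` (?J1 \<union> ?J2)) = carrier ?A"
        if "cols_generate q ?N ?N f \<and> rows_generate q ?N ?N f" for f
        using that unfolding N cols_generate_def by simp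
      show "?rank f" if f: "f \<in> set_pmf (entry_pmf q (S \<inter> block_index Pair ?N ?J2))"
        and g: "g \<in> set_pmf (entry_pmf q (S \<inter> block_index Pair ?N ?J1))"
        and Q: "cols_generate q ?N ?N (glue (S \<inter> block_index Pair ?N ?J2) f g) \<and>
          rows_generate q ?N ?N (glue (S \<inter> block_index Pair ?N ?J2) f g)" for f g
      proof -
        let ?I1' = "S \<inter> block_index Pair ?N ?J1" and ?I2' = "S \<inter> block_index Pair ?N ?J2"
        have fin': "finite ?I2'" "finite ?I1'" using finS by auto
        show ?thesis
        proof (rule card_generate_first_columns[OF p q, where W = "block_vec Pair ?N g"])
          show "block_vec Pair ?N f ` ?J2 \<subseteq> carrier ?A" using block_vec_carrier[OF fin'(1) q0 f] by auto
          show "block_vec Pair ?N g ` ?J1 \<subseteq> carrier ?A" using block_vec_carrier[OF fin'(2) q0 g] by auto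
          have "block_vec Pair ?N (glue ?I2' f g) ` ?J1 = block_vec Pair ?N g ` ?J1"
            by (intro image_cong refl block_vec_glue_right) (auto simp: block_index_Pair)
          moreover have "block_vec Pair ?N (glue ?I2' f g) ` ?J2 = block_vec Pair ?N f ` ?J2"
            by (intro image_cong refl block_vec_glue_left[OF fin' f g]) (auto simp: block_index_Pair)
          ultimately have "block_vec Pair ?N (glue ?I2' f g) ` ?N = block_vec Pair ?N f ` ?J2 \<union> block_vec Pair ?N g ` ?J1"
            unfolding N(1)[symmetric] image_Un by blast
          then show "generate ?A (block_vec Pair ?N f ` ?J2 \<union> block_vec Pair ?N g ` ?J1) = carrier ?A"
            using Q by (simp add: cols_generate_def)
        qed (use k in auto)
      qed
    qed (use k in \<open>auto simp: inj_on_def\<close>)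
    moreover have "S \<inter> block_index Pair ?N (?J1 \<union> ?J2) = S" unfolding N(1) block_index_Pair using S by auto
    ultimately show ?thesis unfolding \<delta> block_index_Pair by simp
  qed
  then have rank: "1 - ?P2 {f. ?rank f} \<le> 1 - \<delta> / inverse_power_prod p k"
    using cpos[of k] by (simp add: pos_divide_le_eq mult.commute)

  have "\<delta> \<le> inverse_power_prod p s * (1 - (1 / p) ^ card ?J1 *
      measure_pmf.prob (entry_pmf q (S \<inter> ?R \<times> ?J2)) {f. \<not> cols_generate q ?R ?J2 f})"
    unfolding \<delta> using N by (intro prob_full_rank_le_row_block[OF p q S s]) auto
  also have "measure_pmf.prob (entry_pmf q (S \<inter> ?R \<times> ?J2)) {f. \<not> cols_generate q ?R ?J2 f} =
      ?P2 {f. \<not> cols_generate q ?R ?J2 f}"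
  proof -
    have sub: "S \<inter> ?R \<times> ?J2 \<subseteq> ?I2" by auto
    have "block_vec Pair ?R (\<lambda>x. if x \<in> S \<inter> ?R \<times> ?J2 then f x else 0) j = block_vec Pair ?R f j"
      if f: "f \<in> set_pmf (entry_pmf q ?I2)" and j: "j \<in> ?J2" for f j
      unfolding block_vec_def using j entry_pmf_outside[OF fin(2) f] by (intro restrict_ext) auto
    then have "block_vec Pair ?R (\<lambda>x. if x \<in> S \<inter> ?R \<times> ?J2 then f x else 0) ` ?J2 = block_vec Pair ?R f ` ?J2"
      if "f \<in> set_pmf (entry_pmf q ?I2)" for f using that by (intro image_cong refl) blast
    then show ?thesis
      unfolding prob_entry_pmf_subset[OF fin(2) sub] cols_generate_def by (intro prob_cong_pmf) simp
  qed
  finally have "\<delta> / inverse_power_prod p s \<le> 1 - (1 / real p) ^ k * ?P2 {f. \<not> cols_generate q ?R ?J2 f}"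
    using cpos[of s] by (simp add: pos_divide_le_eq mult.commute)
  then have "real p ^ k * ((1 / real p) ^ k * ?P2 {f. \<not> cols_generate q ?R ?J2 f}) \<le>
      real p ^ k * (1 - \<delta> / inverse_power_prod p s)"
    by (intro mult_left_mono) auto
  then have row: "?P2 {f. \<not> cols_generate q ?R ?J2 f} \<le> real p ^ k * (1 - \<delta> / inverse_power_prod p s)"
    using p1 by (simp add: power_divide)

  have "1 - ?P2 {f. ?good f} = ?P2 {f. \<not> ?good f}" by (simp only: prob_not_pmf)
  also have "\<dots> \<le> ?P2 ({f. \<not> ?rank f} \<union> {f. \<not> cols_generate q ?R ?J2 f})"
    by (intro measure_pmf.finite_measure_mono) auto
  also have "\<dots> \<le> ?P2 {f. \<not> ?rank f} + ?P2 {f. \<not> cols_generate q ?R ?J2 f}"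
    by (intro measure_Un_le) auto
  also have "?P2 {f. \<not> ?rank f} = 1 - ?P2 {f. ?rank f}" by (rule prob_not_pmf)
  finally have good: "1 - ?P2 {f. ?good f} \<le>
      (1 - \<delta> / inverse_power_prod p k) + real p ^ k * (1 - \<delta> / inverse_power_prod p s)"
    using rank row by linarith

  let ?Q = "\<lambda>f. ?A Mod generate ?A (block_vec Pair ?N f ` ?N) \<cong> K"
  have "\<bar>measure_pmf.prob (entry_pmf q (?I2 \<union> ?I1)) {f. ?Q f} - square_cok_prob q k K\<bar> \<le> 1 - ?P2 {f. ?good f}"
  proof (rule prob_entry_pmf_Un_approx[OF fin(2,1) disj])
    show "0 \<le> square_cok_prob q k K" by (simp add: square_cok_prob_def)
    show "square_cok_prob q k K \<le> 1"
    proof -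
      let ?W = "PiE ?J1 (\<lambda>_. carrier ?V)"
      have finV: "finite (carrier ?V)" using q0 by (simp add: carrier_zmod_vec finite_PiE)
      have "card {w \<in> ?W. ?V Mod generate ?V (w ` ?J1) \<cong> K} \<le> card ?W"
        using finV by (intro card_mono finite_PiE) auto
      also have "\<dots> = order ?V ^ k" by (simp add: card_PiE order_def)
      finally show ?thesis unfolding square_cok_prob_def
        by (auto simp add: divide_le_eq_1 simp flip: of_nat_power)
    qed
    fix f assume f: "f \<in> set_pmf (entry_pmf q ?I2)" and gd: "?good f"
    let ?Y = "block_vec Pair ?N f"
    have Yc: "?Y j \<in> carrier ?A" for j by (rule block_vec_carrier[OF fin(2) q0 f])
    obtain \<pi> where \<pi>: "group_hom ?A ?V \<pi>" "\<pi> ` carrier ?A = carrier ?V" "kernel ?A ?V \<pi> = generate ?A (?Y ` ?J2)"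
    proof -
      have Y1: "?Y \<in> ?J2 \<rightarrow> carrier ?A" using Yc by auto
      show ?thesis
        by (rule exists_projection_killing[OF p q finite_lessThan finite_atLeastLessThan N(2), of ?Y, unfolded N(1),
            OF Y1 conjunct1[OF gd]]) (rule that)
    qed
    interpret \<pi>: group_hom ?A ?V \<pi> by (rule \<pi>(1))
    let ?B = "supported_vecs q Pair S ?N"
    have B: "subgroup (?B j) ?A" for j by (rule subgroup_supported_vecs[OF q0])
    have surj: "\<pi> ` ?B j = carrier ?V" if j: "j \<in> ?J1" for j
    proof
      show "\<pi> ` ?B j \<subseteq> carrier ?V" using subgroup.subset[OF B[of j]] by auto
      show "carrier ?V \<subseteq> \<pi> ` ?B j"
      proof
        fix v assume "v \<in> carrier ?V"
        then obtain x where x: "x \<in> carrier ?A" "v = \<pi> x" using \<pi>(2) by auto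
        interpret r: group_hom ?A "zmod_vec q ?R" "\<lambda>x. restrict x ?R"
          by (rule group_hom_restrict_zmod_vec) auto
        have "restrict x ?R \<in> generate (zmod_vec q ?R) (block_vec Pair ?R f ` ?J2)"
          using gd x(1) unfolding cols_generate_def by simp
        also have "block_vec Pair ?R f ` ?J2 = (\<lambda>x. restrict x ?R) ` ?Y ` ?J2"
          unfolding image_image by (intro image_cong refl restrict_block_vec[symmetric]) auto
        also have "generate (zmod_vec q ?R) \<dots> = (\<lambda>x. restrict x ?R) ` generate ?A (?Y ` ?J2)"
          using Yc by (intro r.generate_img) auto
        finally obtain y where y: "y \<in> generate ?A (?Y ` ?J2)" "restrict x ?R = restrict y ?R"
          by (rule imageE) (rule that)
        have yk: "y \<in> kernel ?A ?V \<pi>" using y(1) \<pi>(3) by simp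
        then have yc: "y \<in> carrier ?A" and y1: "\<pi> y = \<one>\<^bsub>?V\<^esub>" by (auto simp: kernel_def)
        \<comment> \<open>The correction by \<open>y\<close> is invisible to \<open>\<pi>\<close> and clears the coordinates from \<open>s\<close> on.\<close>
        let ?z = "x \<otimes>\<^bsub>?A\<^esub> inv\<^bsub>?A\<^esub> y"
        have zc: "?z \<in> carrier ?A" using x yc by simp
        have "restrict ?z ?R = restrict x ?R \<otimes>\<^bsub>zmod_vec q ?R\<^esub> inv\<^bsub>zmod_vec q ?R\<^esub> restrict y ?R"
          using r.hom_mult[OF x(1) A.inv_closed[OF yc]] r.hom_inv[OF yc] by simp
        also have "\<dots> = \<one>\<^bsub>zmod_vec q ?R\<^esub>"
          unfolding y(2) using r.hom_closed[OF yc] by (rule r.H.r_inv)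
        finally have z0: "restrict ?z ?R = (\<lambda>i\<in>?R. 0)" by (simp add: one_zmod_vec)
        have "?z i = 0" if "i \<in> ?N" "(i, j) \<notin> S" for i
        proof -
          have "\<not> i < s" using corner that(2) j by auto
          then have "i \<in> ?R" using that(1) by auto
          then show ?thesis using fun_cong[OF z0, of i] by simp
        qed
        then have "?z \<in> ?B j" using zc by (simp add: supported_vecs_def)
        moreover have "\<pi> ?z = v" using x yc y1 by simp
        ultimately show "v \<in> \<pi> ` ?B j" by blast
      qed
    qed
    let ?P1 = "measure_pmf.prob (entry_pmf q ?I1)"
    let ?G = "\<lambda>w. ?A Mod generate ?A (?Y ` ?J2 \<union> w ` ?J1) \<cong> K"
    have "?P1 {g. ?Q (glue ?I2 f g)} = ?P1 {g. ?G (\<lambda>j\<in>?J1. block_vec Pair ?N g j)}"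
    proof (rule prob_cong_pmf)
      fix g assume g: "g \<in> set_pmf (entry_pmf q ?I1)"
      have "block_vec Pair ?N (glue ?I2 f g) ` ?J1 = block_vec Pair ?N g ` ?J1"
        by (intro image_cong refl block_vec_glue_right) auto
      moreover have "block_vec Pair ?N (glue ?I2 f g) ` ?J2 = ?Y ` ?J2"
        by (intro image_cong refl block_vec_glue_left[OF fin(2,1) f g]) auto
      ultimately have "block_vec Pair ?N (glue ?I2 f g) ` ?N = ?Y ` ?J2 \<union> block_vec Pair ?N g ` ?J1"
        unfolding N(1)[symmetric] image_Un by blast
      moreover have "(\<lambda>j\<in>?J1. block_vec Pair ?N g j) ` ?J1 = block_vec Pair ?N g ` ?J1" by auto
      ultimately show "?Q (glue ?I2 f g) \<longleftrightarrow> ?G (\<lambda>j\<in>?J1. block_vec Pair ?N g j)" by simp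
    qed
    also have "\<dots> = real (card {w \<in> PiE ?J1 ?B. ?G w}) / (\<Prod>j\<in>?J1. real (card (?B j)))"
      using prob_block_vecs[of ?N ?J1 q Pair S ?G] q0 unfolding block_index_Pair by (simp add: inj_on_def)
    also have "\<dots> = real (card {v \<in> PiE ?J1 (\<lambda>_. carrier ?V). ?V Mod generate ?V (v ` ?J1) \<cong> K}) /
        real (order ?V) ^ card ?J1"
      by (rule card_completions_quotient_iso[OF A.finite_abelian_pgroup_axioms V.comm_group_axioms \<pi>(1,3) _ _ B surj \<pi>(2)])
        (use Yc in auto)
    finally show "?P1 {g. ?Q (glue ?I2 f g)} = square_cok_prob q k K" by (simp add: square_cok_prob_def)
  qed
  then show ?thesis unfolding SU using good by linarith
qed

section \<open>Arithmetic of the p-adic integers\<close>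

lemma residue_range: "0 \<le> residue (x :: 'p::prime_card padic_int) k" "residue x k < int CARD('p) ^ k"
  using residue[of x] by auto

lemma residue_mod_self [simp]: "residue (x :: 'p::prime_card padic_int) k mod int CARD('p) ^ k = residue x k"
  using residue_range[of x k] by simp

lemma residue_mod_le:
  assumes "j \<le> k"
  shows "residue (x :: 'p::prime_card padic_int) k mod int CARD('p) ^ j = residue x j"
  using assms
proof (induction k rule: dec_induct)
  case (step k)
  have "residue x (Suc k) mod int CARD('p) ^ k mod int CARD('p) ^ j = residue x (Suc k) mod int CARD('p) ^ j"
    using step.hyps by (intro mod_mod_cancel le_imp_power_dvd)
  then show ?case using step.IH by (simp add: residue_Suc_mod)
qed simp

lemma residue_eqI: "(\<And>k. residue x k = residue y k) \<Longrightarrow> x = y"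
  by (rule residue_inject[THEN iffD1]) (rule ext)

lemma residue_sum:
  "residue (sum f J :: 'p::prime_card padic_int) k = (\<Sum>j\<in>J. residue (f j) k) mod int CARD('p) ^ k"
  by (induction J rule: infinite_finite_induct) (auto simp: residue_arith mod_simps)

lemma residue_of_nat: "residue (of_nat a :: 'p::prime_card padic_int) k = int a mod int CARD('p) ^ k"
  by (induction a) (auto simp: residue_arith mod_simps add.commute)

lemma residue_of_int: "residue (of_int a :: 'p::prime_card padic_int) k = a mod int CARD('p) ^ k"
  by (cases a rule: int_cases2) (auto simp: residue_arith residue_of_nat mod_simps mod_minus_eq)

lemma padic_seqE:
  assumes "\<And>k. 0 \<le> y k \<and> y k < int CARD('p) ^ k" "\<And>k. y (Suc k) mod int CARD('p) ^ k = y k"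
  obtains x :: "'p::prime_card padic_int" where "residue x = y"
proof
  show "residue (Abs_padic_int y :: 'p padic_int) = y"
    using assms by (intro Abs_padic_int_inverse) auto
qed

text \<open>
The residues of the quotient are those of \<open>x\<close>, shifted by \<open>m\<close> places and divided by \<open>p\<^sup>m\<close>.
\<close>

lemma residue_0_imp_dvd:
  assumes "residue (x :: 'p::prime_card padic_int) m = 0"
  obtains y where "x = of_nat (CARD('p) ^ m) * y"
proof -
  let ?p = "int CARD('p)"
  have p0: "0 < ?p" by simp
  have dvd: "?p ^ m dvd residue x (k + m)" for k
    using residue_mod_le[of m "k + m" x] assms by (simp add: mod_eq_0_iff_dvd)
  let ?y = "\<lambda>k. residue x (k + m) div ?p ^ m"
  obtain y :: "'p padic_int" where y: "residue y = ?y"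
  proof (rule padic_seqE[of ?y])
    fix k
    have "residue x (k + m) < ?p ^ k * ?p ^ m" using residue_range[of x "k + m"] by (simp add: power_add)
    moreover obtain c where c: "residue x (k + m) = ?p ^ m * c" using dvd[of k] by (elim dvdE)
    moreover have "0 \<le> ?p ^ m * c" using residue_range[of x "k + m"] c by simp
    then have "0 \<le> c" using zero_less_power[OF p0, of m] by (simp add: zero_le_mult_iff not_le[symmetric])
    ultimately show "0 \<le> ?y k \<and> ?y k < ?p ^ k"
      using p0 by (auto simp: mult.commute[of "?p ^ k"])
    have "residue x (k + m) = residue x (Suc k + m) mod (?p ^ m * ?p ^ k)"
      using residue_Suc_mod[of x "k + m"] by (simp add: power_add mult.commute)
    then have "residue x (k + m) div ?p ^ m = (residue x (Suc k + m) div ?p ^ m) mod ?p ^ k"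
      using zmod_zmult2_eq[of "?p ^ k" "residue x (Suc k + m)" "?p ^ m"] dvd[of "Suc k"] p0
      by (simp add: mod_eq_0_iff_dvd)
    then show "?y (Suc k) mod ?p ^ k = ?y k" by simp
  qed
  have "x = of_nat (CARD('p) ^ m) * y"
  proof (rule residue_eqI)
    fix k
    have "residue (of_nat (CARD('p) ^ m) * y) k = (?p ^ m * ?y k) mod ?p ^ k"
      unfolding residue_arith residue_of_nat y by (simp add: mod_simps)
    also have "\<dots> = residue x (k + m) mod ?p ^ k" using dvd[of k] by simp
    also have "\<dots> = residue x k" by (rule residue_mod_le) simp
    finally show "residue x k = residue (of_nat (CARD('p) ^ m) * y) k" by simp
  qed
  then show ?thesis by (rule that)
qed

lemma padic_reduction_eq_of_int: "padic_reduction x = of_int (residue x 1)"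
  by (simp add: padic_reduction_def of_int_of_int_mod_ring)

lemma of_int_mod_card: "(of_int (a mod int CARD('p)) :: 'p::prime_card mod_ring) = of_int a"
  unfolding of_int_of_int_mod_ring by transfer simp

lemma padic_reduction_hom: "comm_ring_hom (padic_reduction :: 'p::prime_card padic_int \<Rightarrow> 'p mod_ring)"
proof
  fix x y :: "'p padic_int"
  show "padic_reduction (x + y) = padic_reduction x + padic_reduction y"
    by (simp add: padic_reduction_eq_of_int residue_arith of_int_mod_card)
  show "padic_reduction (x * y) = padic_reduction x * padic_reduction y"
    by (simp add: padic_reduction_eq_of_int residue_arith of_int_mod_card)
  show "padic_reduction (1 :: 'p padic_int) = 1"
    by (simp add: padic_reduction_eq_of_int residue_arith of_int_mod_card)
  show "padic_reduction (0 :: 'p padic_int) = 0"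
    by (simp add: padic_reduction_eq_of_int residue_arith)
qed

interpretation padic_reduction: comm_ring_hom "padic_reduction :: 'p::prime_card padic_int \<Rightarrow> 'p mod_ring"
  by (rule padic_reduction_hom)

lemma padic_reduction_card: "padic_reduction (of_nat CARD('p) :: 'p::prime_card padic_int) = 0"
  by (simp add: padic_reduction_eq_of_int residue_of_nat)

text \<open>
The inverses modulo the powers of \<open>p\<close> are unique and therefore compatible.
\<close>

lemma padic_unit:
  assumes "padic_reduction (x :: 'p::prime_card padic_int) \<noteq> 0"
  obtains y where "x * y = 1"
proof -
  let ?p = "int CARD('p)"
  have prime: "Factorial_Ring.prime ?p" using prime_card[where 'a = 'p] by simp
  have "residue x 1 \<noteq> 0" using assms by (auto simp: padic_reduction_eq_of_int)
  have cop: "coprime (residue x k) (?p ^ k)" for k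
  proof (cases k)
    case (Suc j)
    then have "residue x k mod ?p = residue x 1" using residue_mod_le[of 1 k x] by simp
    then have "\<not> ?p dvd residue x k" using \<open>residue x 1 \<noteq> 0\<close> by (auto simp: mod_eq_0_iff_dvd)
    then have "coprime ?p (residue x k)" using prime by (simp add: prime_imp_coprime)
    then show ?thesis by (simp add: coprime_commute)
  qed simp
  have "\<exists>b. (residue x k * b) mod ?p ^ k = 1 mod ?p ^ k" for k
  proof -
    have "\<exists>u v. u * residue x k + v * ?p ^ k = 1"
      using bezout_int[of "residue x k" "?p ^ k"] cop[of k] by (simp add: coprime_iff_gcd_eq_1)
    then obtain u v where "u * residue x k + v * ?p ^ k = 1" by blast
    then have "1 mod ?p ^ k = (u * residue x k + v * ?p ^ k) mod ?p ^ k" by simp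
    also have "\<dots> = (residue x k * u) mod ?p ^ k" by (simp add: mult.commute)
    finally show ?thesis by metis
  qed
  then obtain b where b: "\<And>k. (residue x k * b k) mod ?p ^ k = 1 mod ?p ^ k" by metis
  let ?y = "\<lambda>k. b k mod ?p ^ k"
  obtain y :: "'p padic_int" where y: "residue y = ?y"
  proof (rule padic_seqE[of ?y])
    fix k
    show "0 \<le> ?y k \<and> ?y k < ?p ^ k" by simp
    have m: "a mod ?p ^ Suc k mod ?p ^ k = a mod ?p ^ k" for a by (rule mod_mod_cancel) simp
    have "(residue x (Suc k) * b (Suc k)) mod ?p ^ k = 1 mod ?p ^ k"
      using arg_cong[OF b[of "Suc k"], of "\<lambda>a. a mod ?p ^ k"] unfolding m .
    then have "(residue x k * b (Suc k)) mod ?p ^ k = 1 mod ?p ^ k"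
      using residue_Suc_mod[of x k] by (metis mod_mult_left_eq)
    then have "(residue x k * b (Suc k)) mod ?p ^ k = (residue x k * b k) mod ?p ^ k" using b[of k] by simp
    then have "?p ^ k dvd residue x k * (b (Suc k) - b k)" by (simp add: mod_eq_dvd_iff right_diff_distrib)
    then have "?p ^ k dvd b (Suc k) - b k"
      using cop[of k] by (simp add: coprime_dvd_mult_right_iff coprime_commute)
    then have "b (Suc k) mod ?p ^ k = b k mod ?p ^ k" by (simp add: mod_eq_dvd_iff)
    then show "?y (Suc k) mod ?p ^ k = ?y k" unfolding m .
  qed
  have "x * y = 1" by (rule residue_eqI) (simp add: residue_arith y mod_simps b)
  then show ?thesis by (rule that)
qed

lemma padic_mat_invertible:
  assumes A: "A \<in> carrier_mat n n" and det: "padic_reduction (Determinant.det (A :: 'p::prime_card padic_int mat)) \<noteq> 0"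
  obtains B where "B \<in> carrier_mat n n" "A * B = 1\<^sub>m n" "B * A = 1\<^sub>m n"
proof -
  obtain u where u: "Determinant.det A * u = 1" using padic_unit[OF det] .
  note adj = adj_mat[OF A]
  show ?thesis
  proof (rule that[of "u \<cdot>\<^sub>m adj_mat A"])
    show "A * (u \<cdot>\<^sub>m adj_mat A) = 1\<^sub>m n"
      using A adj u by (auto simp: mult_smult_distrib[OF A adj(1)] mult.commute)
    show "u \<cdot>\<^sub>m adj_mat A * A = 1\<^sub>m n"
      using A adj u by (auto simp: mult_smult_assoc_mat[OF adj(1) A] mult.commute)
  qed (use adj in auto)
qed

text \<open>
The equation says \<open>p\<^sup>m (1 - p W) = X V\<close>, and \<open>1 - p W\<close> is invertible because it reduces to the
identity.
\<close>

lemma padic_nakayama: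
  fixes X V W :: "'p::prime_card padic_int mat"
  assumes X: "X \<in> carrier_mat n n" and V: "V \<in> carrier_mat n n" and W: "W \<in> carrier_mat n n"
    and eq: "of_nat (CARD('p) ^ m) \<cdot>\<^sub>m 1\<^sub>m n = X * V + of_nat (CARD('p) ^ Suc m) \<cdot>\<^sub>m W"
  obtains C where "C \<in> carrier_mat n n" "of_nat (CARD('p) ^ m) \<cdot>\<^sub>m 1\<^sub>m n = X * C"
proof -
  let ?c = "of_nat (CARD('p) ^ m) :: 'p padic_int"
  let ?U = "1\<^sub>m n - of_nat CARD('p) \<cdot>\<^sub>m W"
  have U: "?U \<in> carrier_mat n n" using W by auto
  have "map_mat padic_reduction ?U = 1\<^sub>m n"
    using W by (intro eq_matI)
      (auto simp: padic_reduction.hom_minus padic_reduction.hom_mult padic_reduction_card)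
  then have "padic_reduction (Determinant.det ?U) = 1"
    using padic_reduction.hom_det[of ?U] by simp
  then obtain B where B: "B \<in> carrier_mat n n" "?U * B = 1\<^sub>m n" using padic_mat_invertible[OF U] by (metis zero_neq_one)
  have "?c \<cdot>\<^sub>m ?U = X * V"
  proof (rule eq_matI)
    fix i j assume ij: "i < dim_row (X * V)" "j < dim_col (X * V)"
    then have ij': "i < n" "j < n" using X V by auto
    have "(?c \<cdot>\<^sub>m 1\<^sub>m n) $$ (i, j) = (X * V + of_nat (CARD('p) ^ Suc m) \<cdot>\<^sub>m W) $$ (i, j)" by (simp only: eq)
    then show "(?c \<cdot>\<^sub>m ?U) $$ (i, j) = (X * V) $$ (i, j)"
      using ij ij' X V W by (simp add: algebra_simps)
  qed (use X V W in auto)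
  then have "?c \<cdot>\<^sub>m (?U * B) = X * V * B" using mult_smult_assoc_mat[OF U B(1), of ?c] by simp
  then have "?c \<cdot>\<^sub>m 1\<^sub>m n = X * (V * B)" using X V B by (simp add: assoc_mult_mat)
  then show ?thesis using that[of "V * B"] V B by auto
qed

section \<open>Cokernels of p-adic matrices modulo q\<close>

definition residue_vec :: "nat \<Rightarrow> nat \<Rightarrow> 'p::prime_card padic_int Matrix.vec \<Rightarrow> nat \<Rightarrow> int" where
  "residue_vec m n v = (\<lambda>i\<in>{..<n}. residue (v $ i) m)"

text \<open>
The value zero outside of the matrix agrees with the convention for entries outside of the support.
\<close>

definition residue_entries :: "nat \<Rightarrow> 'p::prime_card padic_int mat \<Rightarrow> nat \<times> nat \<Rightarrow> int" where
  "residue_entries m X = (\<lambda>(i, j). if i < dim_row X \<and> j < dim_col X then residue (X $$ (i, j)) m else 0)"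

lemma residue_vec_hom:
  "group_hom (monoid_vec TYPE('p::prime_card padic_int) n) (zmod_vec (CARD('p) ^ m) {..<n}) (residue_vec m n)"
proof -
  have "residue_vec m n \<in> hom (monoid_vec TYPE('p padic_int) n) (zmod_vec (CARD('p) ^ m) {..<n})"
  proof (rule homI)
    show "residue_vec m n x \<in> carrier (zmod_vec (CARD('p) ^ m) {..<n})" for x :: "'p padic_int vec"
      using residue_range by (auto simp: residue_vec_def carrier_zmod_vec)
    show "residue_vec m n (x \<otimes>\<^bsub>monoid_vec TYPE('p padic_int) n\<^esub> y) =
        residue_vec m n x \<otimes>\<^bsub>zmod_vec (CARD('p) ^ m) {..<n}\<^esub> residue_vec m n y"
      if "x \<in> carrier (monoid_vec TYPE('p padic_int) n)" "y \<in> carrier (monoid_vec TYPE('p padic_int) n)" for x y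
      using that unfolding residue_vec_def mult_zmod_vec monoid_vec_simps
      by (intro restrict_ext) (simp add: residue_arith)
  qed
  then show ?thesis
    by (intro group_hom.intro group_hom_axioms.intro comm_group.axioms(2) comm_group_vec comm_group_zmod_vec)
qed

lemma residue_vec_surj:
  "residue_vec m n ` (carrier_vec n :: 'p::prime_card padic_int vec set) = carrier (zmod_vec (CARD('p) ^ m) {..<n})"
proof
  show "residue_vec m n ` (carrier_vec n :: 'p padic_int vec set) \<subseteq> carrier (zmod_vec (CARD('p) ^ m) {..<n})"
    using group_hom.hom_closed[OF residue_vec_hom[where 'p = 'p, of n m]] by (auto simp: monoid_vec_simps)
  show "carrier (zmod_vec (CARD('p) ^ m) {..<n}) \<subseteq> residue_vec m n ` (carrier_vec n :: 'p padic_int vec set)"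
  proof
    fix f assume f: "f \<in> carrier (zmod_vec (CARD('p) ^ m) {..<n})"
    then have "residue_vec m n (vec n (\<lambda>i. of_int (f i)) :: 'p padic_int vec) = (\<lambda>i\<in>{..<n}. f i)"
      unfolding residue_vec_def by (intro restrict_ext) (auto simp: residue_of_int carrier_zmod_vec PiE_iff)
    also have "\<dots> = f" using f by (auto simp: carrier_zmod_vec PiE_iff extensional_restrict)
    finally show "f \<in> residue_vec m n ` (carrier_vec n :: 'p padic_int vec set)"
      by (metis imageI vec_carrier)
  qed
qed

lemma residue_vec_eq_one:
  fixes v :: "'p::prime_card padic_int Matrix.vec"
  assumes "v \<in> carrier_vec n" "residue_vec m n v = \<one>\<^bsub>zmod_vec (CARD('p) ^ m) {..<n}\<^esub>"
  obtains w where "w \<in> carrier_vec n" "v = of_nat (CARD('p) ^ m) \<cdot>\<^sub>v w"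
proof -
  have "\<exists>y. v $ i = of_nat (CARD('p) ^ m) * y" if "i < n" for i
  proof -
    have "residue (v $ i) m = 0" using fun_cong[OF assms(2), of i] that by (simp add: residue_vec_def one_zmod_vec)
    then show ?thesis using residue_0_imp_dvd by metis
  qed
  then obtain y where y: "\<And>i. i < n \<Longrightarrow> v $ i = of_nat (CARD('p) ^ m) * y i" by metis
  show ?thesis
    by (rule that[of "vec n y"]) (use assms(1) y in \<open>auto intro!: eq_vecI\<close>)
qed

lemma residue_vec_mult_mat:
  fixes X :: "'p::prime_card padic_int mat"
  assumes X: "X \<in> carrier_mat n n" and v: "v \<in> carrier_vec n"
  shows "residue_vec m n (X *\<^sub>v v) =
    lincomb (zmod_vec (CARD('p) ^ m) {..<n}) {..<n} (block_vec Pair {..<n} (residue_entries m X)) (residue_vec m n v)"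
proof -
  let ?q = "CARD('p) ^ m"
  let ?f = "block_vec Pair {..<n} (residue_entries m X)"
  have q0: "0 < ?q" by simp
  have fc: "?f j \<in> carrier (zmod_vec ?q {..<n})" for j
    using residue_range[where 'p = 'p] by (auto simp: block_vec_def residue_entries_def carrier_zmod_vec)
  have "lincomb (zmod_vec ?q {..<n}) {..<n} ?f (residue_vec m n v) =
      (\<lambda>i\<in>{..<n}. (\<Sum>j<n. (\<lambda>i\<in>{..<n}. (residue_vec m n v j * ?f j i) mod int ?q) i) mod int ?q)"
    unfolding lincomb_def int_pow_zmod_vec[OF q0 fc]
    by (rule finprod_zmod_vec[OF q0 finite_lessThan restrict_mod_in_zmod_vec[OF q0]])
  also have "\<dots> = residue_vec m n (X *\<^sub>v v)"
    unfolding residue_vec_def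
  proof (rule restrict_ext)
    fix i assume i: "i \<in> {..<n}"
    have "(X *\<^sub>v v) $ i = (\<Sum>j<n. X $$ (i, j) * v $ j)"
      using X v i by (auto simp: scalar_prod_def lessThan_atLeast0 intro!: sum.cong)
    then have "residue ((X *\<^sub>v v) $ i) m = (\<Sum>j<n. residue (X $$ (i, j) * v $ j) m) mod int CARD('p) ^ m"
      by (simp only: residue_sum)
    also have "(\<Sum>j<n. residue (X $$ (i, j) * v $ j) m) =
        (\<Sum>j<n. (\<lambda>i\<in>{..<n}. ((\<lambda>i\<in>{..<n}. residue (v $ i) m) j * ?f j i) mod int ?q) i)"
      using X i by (intro sum.cong refl)
        (auto simp: residue_arith block_vec_def residue_entries_def mult.commute)
    finally show "(\<Sum>j<n. (\<lambda>i\<in>{..<n}. ((\<lambda>i\<in>{..<n}. residue (v $ i) m) j * ?f j i) mod int ?q) i) mod int ?q =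
        residue ((X *\<^sub>v v) $ i) m" by simp
  qed
  finally show ?thesis ..
qed

lemma block_vec_residue_carrier:
  fixes X :: "'p::prime_card padic_int mat"
  shows "block_vec Pair {..<n} (residue_entries m X) j \<in> carrier (zmod_vec (CARD('p) ^ m) {..<n})"
  using residue_range[where 'p = 'p] by (auto simp: block_vec_def residue_entries_def carrier_zmod_vec)

lemma residue_vec_image:
  fixes X :: "'p::prime_card padic_int mat"
  assumes X: "X \<in> carrier_mat n n"
  shows "residue_vec m n ` (\<lambda>v. X *\<^sub>v v) ` carrier_vec n =
    generate (zmod_vec (CARD('p) ^ m) {..<n}) (block_vec Pair {..<n} (residue_entries m X) ` {..<n})"
proof -
  let ?q = "CARD('p) ^ m"
  let ?A = "zmod_vec ?q {..<n}"
  let ?f = "block_vec Pair {..<n} (residue_entries m X)"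
  interpret A: comm_group ?A by (rule comm_group_zmod_vec)
  have q0: "0 < ?q" by simp
  have "residue_vec m n ` (\<lambda>v. X *\<^sub>v v) ` carrier_vec n = lincomb ?A {..<n} ?f ` residue_vec m n ` (carrier_vec n :: 'p padic_int vec set)"
    unfolding image_image by (intro image_cong refl residue_vec_mult_mat[OF X])
  also have "residue_vec m n ` (carrier_vec n :: 'p padic_int vec set) = carrier ?A" by (rule residue_vec_surj)
  also have "lincomb ?A {..<n} ?f ` carrier ?A = generate ?A (?f ` {..<n})"
    by (rule A.lincomb_image[OF finite_lessThan q0 block_vec_residue_carrier
        zmod_vec_pow_card[OF q0 block_vec_residue_carrier]])
  finally show ?thesis .
qed

lemma pow_monoid_vec:
  fixes v :: "'a::comm_ring_1 vec"
  assumes "v \<in> carrier_vec n"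
  shows "v [^]\<^bsub>monoid_vec TYPE('a) n\<^esub> (k::nat) = of_nat k \<cdot>\<^sub>v v"
proof (induction k)
  case 0
  then show ?case using assms by (auto simp: monoid_vec_simps nat_pow_def intro!: eq_vecI)
next
  case (Suc k)
  then have "v [^]\<^bsub>monoid_vec TYPE('a) n\<^esub> Suc k = of_nat k \<cdot>\<^sub>v v + v"
    by (simp add: monoid_vec_simps nat_pow_def)
  also have "\<dots> = of_nat (Suc k) \<cdot>\<^sub>v v" using assms by (intro eq_vecI) (auto simp: algebra_simps)
  finally show ?case .
qed

text \<open>
The hypothesis for the unit vectors is the equation of matrices in \<open>padic_nakayama\<close>.
\<close>

lemma mat_image_contains_multiples:
  fixes X :: "'p::prime_card padic_int mat"
  assumes X: "X \<in> carrier_mat n n"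
    and sub: "\<And>v. v \<in> carrier_vec n \<Longrightarrow> \<exists>u\<in>carrier_vec n. \<exists>w\<in>carrier_vec n.
      of_nat (CARD('p) ^ m) \<cdot>\<^sub>v v = X *\<^sub>v u + of_nat (CARD('p) ^ Suc m) \<cdot>\<^sub>v w"
  obtains C where "C \<in> carrier_mat n n" "of_nat (CARD('p) ^ m) \<cdot>\<^sub>m 1\<^sub>m n = X * C"
proof -
  let ?c = "of_nat (CARD('p) ^ m) :: 'p padic_int" and ?d = "of_nat (CARD('p) ^ Suc m) :: 'p padic_int"
  have "\<forall>j. \<exists>u w. j < n \<longrightarrow> u \<in> carrier_vec n \<and> w \<in> carrier_vec n \<and> ?c \<cdot>\<^sub>v unit_vec n j = X *\<^sub>v u + ?d \<cdot>\<^sub>v w"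
    using sub[OF unit_vec_carrier] by blast
  then obtain u w where uw: "\<And>j. j < n \<Longrightarrow> u j \<in> carrier_vec n \<and> w j \<in> carrier_vec n \<and>
      ?c \<cdot>\<^sub>v unit_vec n j = X *\<^sub>v u j + ?d \<cdot>\<^sub>v w j" by metis
  let ?V = "mat n n (\<lambda>(i, j). u j $ i)" and ?W = "mat n n (\<lambda>(i, j). w j $ i)"
  have "?c \<cdot>\<^sub>m 1\<^sub>m n = X * ?V + ?d \<cdot>\<^sub>m ?W"
  proof (rule eq_matI)
    fix i j assume "i < dim_row (X * ?V + ?d \<cdot>\<^sub>m ?W)" "j < dim_col (X * ?V + ?d \<cdot>\<^sub>m ?W)"
    then have ij: "i < n" "j < n" using X by auto
    have col: "col ?V j = u j" using uw[OF ij(2)] ij by (intro eq_vecI) auto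
    have "(?c \<cdot>\<^sub>v unit_vec n j) $ i = (X *\<^sub>v u j + ?d \<cdot>\<^sub>v w j) $ i" using uw[OF ij(2)] by simp
    moreover have "(?c \<cdot>\<^sub>v unit_vec n j) $ i = (?c \<cdot>\<^sub>m 1\<^sub>m n) $$ (i, j)" using ij by simp
    moreover have "(X *\<^sub>v u j + ?d \<cdot>\<^sub>v w j) $ i = (X * ?V + ?d \<cdot>\<^sub>m ?W) $$ (i, j)"
    proof -
      have "dim_vec (w j) = n" using uw[OF ij(2)] by auto
      then show ?thesis using ij X col by simp
    qed
    ultimately show "(?c \<cdot>\<^sub>m 1\<^sub>m n) $$ (i, j) = (X * ?V + ?d \<cdot>\<^sub>m ?W) $$ (i, j)" by simp
  qed (use X in auto)
  from padic_nakayama[OF X _ _ this] show ?thesis using that by auto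
qed

lemma mat_image_subgroup:
  fixes X :: "'a::comm_ring_1 mat"
  assumes X: "X \<in> carrier_mat n n"
  shows "subgroup ((\<lambda>v. X *\<^sub>v v) ` carrier_vec n) (monoid_vec TYPE('a) n)"
proof -
  have "group_hom (monoid_vec TYPE('a) n) (monoid_vec TYPE('a) n) (\<lambda>v. X *\<^sub>v v)"
    using X by (intro group_hom.intro group_hom_axioms.intro comm_group.axioms(2) comm_group_vec homI)
      (auto simp: monoid_vec_simps mult_add_distrib_mat_vec)
  then show ?thesis using group_hom.img_is_subgroup by (fastforce simp: monoid_vec_simps)
qed

lemma residue_preimage_image:
  fixes X :: "'p::prime_card padic_int mat"
  assumes X: "X \<in> carrier_mat n n" and v: "v \<in> carrier_vec n"
    and mem: "residue_vec m n v \<in> generate (zmod_vec (CARD('p) ^ m) {..<n})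
      (block_vec Pair {..<n} (residue_entries m X) ` {..<n})"
  shows "\<exists>u\<in>carrier_vec n. \<exists>w\<in>carrier_vec n. v = X *\<^sub>v u + of_nat (CARD('p) ^ m) \<cdot>\<^sub>v w"
proof -
  let ?V = "monoid_vec TYPE('p padic_int) n"
  interpret r: group_hom ?V "zmod_vec (CARD('p) ^ m) {..<n}" "residue_vec m n" by (rule residue_vec_hom)
  obtain u where u: "u \<in> carrier_vec n" "residue_vec m n v = residue_vec m n (X *\<^sub>v u)"
    using mem unfolding residue_vec_image[OF X, symmetric] by auto
  have Xu: "X *\<^sub>v u \<in> carrier_vec n" using X u by auto
  have d: "v - X *\<^sub>v u \<in> carrier_vec n" using v Xu by auto
  have vs: "v = (v - X *\<^sub>v u) + X *\<^sub>v u" using v Xu X by (intro eq_vecI) auto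
  have "residue_vec m n v = residue_vec m n (v - X *\<^sub>v u) \<otimes>\<^bsub>zmod_vec (CARD('p) ^ m) {..<n}\<^esub> residue_vec m n (X *\<^sub>v u)"
    using r.hom_mult[of "v - X *\<^sub>v u" "X *\<^sub>v u"] d Xu vs by (simp add: monoid_vec_simps)
  moreover have "residue_vec m n (v - X *\<^sub>v u) \<in> carrier (zmod_vec (CARD('p) ^ m) {..<n})"
    "residue_vec m n (X *\<^sub>v u) \<in> carrier (zmod_vec (CARD('p) ^ m) {..<n})"
    using r.hom_closed d Xu by (auto simp: monoid_vec_simps)
  ultimately have "residue_vec m n (v - X *\<^sub>v u) = \<one>\<^bsub>zmod_vec (CARD('p) ^ m) {..<n}\<^esub>"
    unfolding u(2) by (simp add: r.H.l_cancel_one')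
  then obtain w where w: "w \<in> carrier_vec n" "v - X *\<^sub>v u = of_nat (CARD('p) ^ m) \<cdot>\<^sub>v w"
    using residue_vec_eq_one[OF d] by blast
  have "v = X *\<^sub>v u + of_nat (CARD('p) ^ m) \<cdot>\<^sub>v w"
    unfolding w(2)[symmetric] using v Xu X by (intro eq_vecI) auto
  then show ?thesis using u w by blast
qed

text \<open>
Both quotients are quotients of the module of vectors: the first by the image of \<open>X\<close>, the second by the
image of \<open>X\<close> and the multiples of \<open>p\<^sup>m\<^sup>+\<^sup>1\<close>. If either of them is isomorphic to \<open>K\<close>, then \<open>p\<^sup>m\<close>
kills it. In the first case \<open>p\<^sup>m\<close> times any vector lies in the image of \<open>X\<close>; in the second case so it does up to
multiples of \<open>p\<^sup>m\<^sup>+\<^sup>1\<close>, and Nakayama's lemma removes these. So the two submodules coincide.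
\<close>

lemma cok_iso_iff_residues:
  fixes X :: "'p::prime_card padic_int mat" and K :: "('k, 'l) monoid_scheme"
  assumes X: "X \<in> carrier_mat n n" and K: "group K"
    and exp: "\<And>x. x \<in> carrier K \<Longrightarrow> x [^]\<^bsub>K\<^esub> (CARD('p) ^ m) = \<one>\<^bsub>K\<^esub>"
  shows "cok X \<cong> K \<longleftrightarrow> zmod_vec (CARD('p) ^ Suc m) {..<n} Mod
    generate (zmod_vec (CARD('p) ^ Suc m) {..<n}) (block_vec Pair {..<n} (residue_entries (Suc m) X) ` {..<n}) \<cong> K"
proof -
  let ?V = "monoid_vec TYPE('p padic_int) n"
  let ?A = "zmod_vec (CARD('p) ^ Suc m) {..<n}"
  let ?g = "generate ?A (block_vec Pair {..<n} (residue_entries (Suc m) X) ` {..<n})"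
  let ?H = "(\<lambda>v. X *\<^sub>v v) ` carrier_vec n"
  let ?T = "{v \<in> carrier ?V. residue_vec (Suc m) n v \<in> ?g}"
  let ?c = "of_nat (CARD('p) ^ m) :: 'p padic_int" and ?d = "of_nat (CARD('p) ^ Suc m) :: 'p padic_int"
  interpret V: comm_group ?V by (rule comm_group_vec)
  interpret A: comm_group ?A by (rule comm_group_zmod_vec)
  interpret r: group_hom ?V ?A "residue_vec (Suc m) n" by (rule residue_vec_hom)
  interpret H: normal ?H ?V using mat_image_subgroup[OF X] by (rule V.subgroup_imp_normal)
  have sg: "subgroup ?g ?A" using block_vec_residue_carrier by (intro A.generate_is_subgroup image_subsetI)
  interpret g: normal ?g ?A using sg by (rule A.subgroup_imp_normal)
  have "subgroup ?T ?V" by (rule r.subgroup_vimage_hom[OF sg])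
  then interpret T: normal ?T ?V by (rule V.subgroup_imp_normal)
  have surj: "residue_vec (Suc m) n ` carrier ?V = carrier ?A"
    unfolding monoid_vec_simps by (rule residue_vec_surj)
  have TA: "?V Mod ?T \<cong> ?A Mod ?g" by (rule r.Mod_vimage_iso[OF surj g.normal_axioms])
  then have AT: "?A Mod ?g \<cong> ?V Mod ?T" by (rule group.iso_sym[OF T.factorgroup_is_group])
  have cok: "cok X = ?V Mod ?H" using X by (simp add: cok_def)
  have HT: "?T = ?H" if mult: "\<And>v. v \<in> carrier_vec n \<Longrightarrow> ?c \<cdot>\<^sub>v v \<in> ?H"
  proof
    show "?H \<subseteq> ?T"
      using residue_vec_image[OF X, of "Suc m"] H.subset by blast
    show "?T \<subseteq> ?H"
    proof
      fix v assume "v \<in> ?T"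
      then have "v \<in> carrier_vec n" "residue_vec (Suc m) n v \<in> ?g" by (simp_all only: mem_Collect_eq monoid_vec_simps)
      then obtain u w where uw: "u \<in> carrier_vec n" "w \<in> carrier_vec n" "v = X *\<^sub>v u + ?d \<cdot>\<^sub>v w"
        using residue_preimage_image[OF X] by blast
      have "?d \<cdot>\<^sub>v w = ?c \<cdot>\<^sub>v (of_nat CARD('p) \<cdot>\<^sub>v w)" by (simp add: smult_smult_assoc mult.commute)
      then have "?d \<cdot>\<^sub>v w \<in> ?H" using mult uw(2) by simp
      moreover have "X *\<^sub>v u \<in> ?H" using uw(1) by blast
      ultimately show "v \<in> ?H" using H.m_closed unfolding uw(3) monoid_vec_simps by blast
    qed
  qed
  show ?thesis
  proof
    assume "cok X \<cong> K"
    then have iso: "?V Mod ?H \<cong> K" unfolding cok .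
    have "?c \<cdot>\<^sub>v v \<in> ?H" if "v \<in> carrier_vec n" for v
      using H.power_mem_of_Mod_iso[OF iso K exp, of v] that unfolding monoid_vec_simps pow_monoid_vec[OF that] by simp
    then have "?T = ?H" by (rule HT)
    then have "?V Mod ?T \<cong> K" using iso by (simp only:)
    then show "?A Mod ?g \<cong> K" by (rule iso_trans[OF AT])
  next
    assume "?A Mod ?g \<cong> K"
    then have iso: "?V Mod ?T \<cong> K" by (rule iso_trans[OF TA])
    have "\<exists>u\<in>carrier_vec n. \<exists>w\<in>carrier_vec n. ?c \<cdot>\<^sub>v v = X *\<^sub>v u + ?d \<cdot>\<^sub>v w"
      if v: "v \<in> carrier_vec n" for v
    proof -
      have "v [^]\<^bsub>?V\<^esub> (CARD('p) ^ m) \<in> ?T"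
        by (rule T.power_mem_of_Mod_iso[OF iso K exp]) (simp_all only: monoid_vec_simps v)
      then have "?c \<cdot>\<^sub>v v \<in> ?T" by (simp only: pow_monoid_vec[OF v])
      then have "?c \<cdot>\<^sub>v v \<in> carrier_vec n" "residue_vec (Suc m) n (?c \<cdot>\<^sub>v v) \<in> ?g"
        by (simp_all only: mem_Collect_eq monoid_vec_simps)
      then show ?thesis by (rule residue_preimage_image[OF X])
    qed
    then obtain C where C: "C \<in> carrier_mat n n" "?c \<cdot>\<^sub>m 1\<^sub>m n = X * C"
      using mat_image_contains_multiples[OF X, of m] by blast
    have "?c \<cdot>\<^sub>v v \<in> ?H" if v: "v \<in> carrier_vec n" for v
    proof -
      have "?c \<cdot>\<^sub>v v = (?c \<cdot>\<^sub>m 1\<^sub>m n) *\<^sub>v v" using v by (intro eq_vecI) auto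
      also have "\<dots> = X *\<^sub>v (C *\<^sub>v v)" unfolding C(2) using X C(1) v by (intro assoc_mult_mat_vec)
      finally show ?thesis using C(1) v by auto
    qed
    then have "?T = ?H" by (rule HT)
    then show "cok X \<cong> K" using iso unfolding cok by (simp only:)
  qed
qed

lemma det_reduction_iff_cols_generate:
  fixes X :: "'p::prime_card padic_int mat"
  assumes X: "X \<in> carrier_mat n n"
  shows "Determinant.det (map_mat padic_reduction X) \<noteq> 0 \<longleftrightarrow>
    cols_generate (CARD('p) ^ Suc m) {..<n} {..<n} (residue_entries (Suc m) X)"
proof
  let ?A = "zmod_vec (CARD('p) ^ Suc m) {..<n}"
  assume "Determinant.det (map_mat padic_reduction X) \<noteq> 0"
  then have "padic_reduction (Determinant.det X) \<noteq> 0" by simp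
  then obtain B where B: "B \<in> carrier_mat n n" "X * B = 1\<^sub>m n" using padic_mat_invertible[OF X] by blast
  have "(\<lambda>v. X *\<^sub>v v) ` carrier_vec n = carrier_vec n"
  proof
    show "(\<lambda>v. X *\<^sub>v v) ` carrier_vec n \<subseteq> carrier_vec n" using X by auto
    show "carrier_vec n \<subseteq> (\<lambda>v. X *\<^sub>v v) ` carrier_vec n"
    proof
      fix v :: "'p padic_int vec" assume v: "v \<in> carrier_vec n"
      have "X *\<^sub>v (B *\<^sub>v v) = (X * B) *\<^sub>v v" by (rule assoc_mult_mat_vec[OF X B(1) v, symmetric])
      also have "\<dots> = v" unfolding B(2) using v by (rule one_mult_mat_vec)
      finally show "v \<in> (\<lambda>v. X *\<^sub>v v) ` carrier_vec n"
        using mult_mat_vec_carrier[OF B(1) v] by (rule image_eqI[OF sym])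
    qed
  qed
  then show "cols_generate (CARD('p) ^ Suc m) {..<n} {..<n} (residue_entries (Suc m) X)"
    using residue_vec_image[OF X, of "Suc m"] residue_vec_surj[where 'p = 'p, of "Suc m" n]
    unfolding cols_generate_def by simp
next
  assume gen: "cols_generate (CARD('p) ^ Suc m) {..<n} {..<n} (residue_entries (Suc m) X)"
  interpret r: group_hom "monoid_vec TYPE('p padic_int) n" "zmod_vec (CARD('p) ^ Suc m) {..<n}" "residue_vec (Suc m) n"
    by (rule residue_vec_hom)
  have "\<exists>u\<in>carrier_vec n. \<exists>w\<in>carrier_vec n. of_nat (CARD('p) ^ 0) \<cdot>\<^sub>v v = X *\<^sub>v u + of_nat (CARD('p) ^ Suc 0) \<cdot>\<^sub>v w"
    if v: "v \<in> carrier_vec n" for v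
  proof -
    have "residue_vec (Suc m) n v \<in> carrier (zmod_vec (CARD('p) ^ Suc m) {..<n})"
      using r.hom_closed v by (simp add: monoid_vec_simps)
    then obtain u w where uw: "u \<in> carrier_vec n" "w \<in> carrier_vec n" "v = X *\<^sub>v u + of_nat (CARD('p) ^ Suc m) \<cdot>\<^sub>v w"
      using residue_preimage_image[OF X v, of "Suc m"] gen unfolding cols_generate_def by blast
    have "of_nat (CARD('p) ^ Suc m) \<cdot>\<^sub>v w = of_nat (CARD('p) ^ Suc 0) \<cdot>\<^sub>v (of_nat (CARD('p) ^ m) \<cdot>\<^sub>v w)"
      by (simp add: smult_smult_assoc)
    then have "v = X *\<^sub>v u + of_nat (CARD('p) ^ Suc 0) \<cdot>\<^sub>v (of_nat (CARD('p) ^ m) \<cdot>\<^sub>v w)" using uw(3) by simp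
    then show ?thesis using uw(1,2) by (intro bexI[of _ u] bexI[of _ "of_nat (CARD('p) ^ m) \<cdot>\<^sub>v w"]) auto
  qed
  then obtain C where C: "C \<in> carrier_mat n n" "of_nat (CARD('p) ^ 0) \<cdot>\<^sub>m 1\<^sub>m n = X * C"
    using mat_image_contains_multiples[OF X, of 0] by blast
  have "of_nat (CARD('p) ^ 0) \<cdot>\<^sub>m 1\<^sub>m n = (1\<^sub>m n :: 'p padic_int mat)" by (intro eq_matI) auto
  then have "1\<^sub>m n = X * C" using C(2) by (simp only:)
  then have "Determinant.det X * Determinant.det C = 1" using det_mult[OF X C(1)] by (metis det_one)
  then have "padic_reduction (Determinant.det X) * padic_reduction (Determinant.det C) = 1"
    by (metis padic_reduction.hom_mult padic_reduction.hom_one)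
  then show "Determinant.det (map_mat padic_reduction X) \<noteq> 0" by auto
qed

lemma rows_generate_transpose:
  fixes X :: "'p::prime_card padic_int mat"
  assumes "X \<in> carrier_mat n n"
  shows "rows_generate q {..<n} {..<n} (residue_entries m X) \<longleftrightarrow>
    cols_generate q {..<n} {..<n} (residue_entries m (transpose_mat X))"
proof -
  have "block_vec (\<lambda>i j. (j, i)) {..<n} (residue_entries m X) ` {..<n} =
      block_vec Pair {..<n} (residue_entries m (transpose_mat X)) ` {..<n}"
    using assms by (intro image_cong refl) (auto simp: block_vec_def residue_entries_def intro!: restrict_ext)
  then show ?thesis by (simp add: rows_generate_def cols_generate_def)
qed

text \<open>
A matrix and its transpose have the same determinant.
\<close>

lemma det_reduction_iff_generate:
  fixes X :: "'p::prime_card padic_int mat"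
  assumes X: "X \<in> carrier_mat n n"
  shows "Determinant.det (map_mat padic_reduction X) \<noteq> 0 \<longleftrightarrow>
    cols_generate (CARD('p) ^ Suc m) {..<n} {..<n} (residue_entries (Suc m) X) \<and>
    rows_generate (CARD('p) ^ Suc m) {..<n} {..<n} (residue_entries (Suc m) X)"
  using det_reduction_iff_cols_generate[OF X, of m]
    det_reduction_iff_cols_generate[of "transpose_mat X" n m] X
  by (simp add: rows_generate_transpose[OF X] det_transpose[OF X])

section \<open>Haar measure and limits\<close>

text \<open>
The residue classes modulo \<open>p\<^sup>m\<close> are translates of each other.
\<close>

lemma haar_residue_class:
  fixes P :: "'p::prime_card padic_int measure"
  assumes P: "haar_prob_measure P" and a: "a \<in> {0..<int CARD('p) ^ m}"
  shows "{x. residue x m = a} \<in> sets P" "measure P {x. residue x m = a} = 1 / real (CARD('p) ^ m)"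
proof -
  let ?C = "\<lambda>a. {x :: 'p padic_int. residue x m = a}"
  let ?D = "{0..<int CARD('p) ^ m}"
  interpret P: prob_space P using P by (simp add: haar_prob_measure_def)
  have sets: "sets P = sets borel" using P by (simp add: haar_prob_measure_def)
  then have space: "space P = UNIV" by (metis sets_eq_imp_space_eq space_borel)
  have "open (?C b)" for b by (auto simp: open_padic_int_def)
  then have meas: "?C b \<in> sets P" for b unfolding sets by (rule borel_open)
  then show "?C a \<in> sets P" .
  have eq: "measure P (?C b) = measure P (?C 0)" if b: "b \<in> ?D" for b
  proof -
    have "(\<lambda>x. of_int b + x) ` ?C 0 = ?C b"
    proof
      show "(\<lambda>x. of_int b + x) ` ?C 0 \<subseteq> ?C b"
        using b by (auto simp: residue_arith residue_of_int)
      show "?C b \<subseteq> (\<lambda>x. of_int b + x) ` ?C 0"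
      proof
        fix x assume "x \<in> ?C b"
        then have "x - of_int b \<in> ?C 0" using b by (simp add: residue_arith residue_of_int)
        moreover have "x = of_int b + (x - of_int b)" by simp
        ultimately show "x \<in> (\<lambda>x. of_int b + x) ` ?C 0" by (rule image_eqI[rotated])
      qed
    qed
    then have "emeasure P (?C b) = emeasure P (?C 0)"
      using P meas[of 0] unfolding haar_prob_measure_def sets by metis
    then show ?thesis by (simp add: measure_def)
  qed
  have "1 = measure P (\<Union>b\<in>?D. ?C b)"
  proof -
    have "(\<Union>b\<in>?D. ?C b) = space P" using residue_range by (auto simp: space)
    then show ?thesis by (simp add: P.prob_space)
  qed
  also have "\<dots> = (\<Sum>b\<in>?D. measure P (?C b))"
    by (rule P.finite_measure_finite_Union) (use meas in \<open>auto simp: disjoint_family_on_def\<close>)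
  also have "\<dots> = (\<Sum>b\<in>?D. measure P (?C 0))" using eq by (intro sum.cong refl)
  also have "\<dots> = real (CARD('p) ^ m) * measure P (?C 0)" by (simp add: nat_power_eq)
  finally show "measure P (?C a) = 1 / real (CARD('p) ^ m)" using eq[OF a] by (simp add: field_simps)
qed

lemma haar_random_matrix_residue_prob:
  fixes X :: "'w \<Rightarrow> 'p::prime_card padic_int mat"
  assumes X: "haar_random_matrix_on M n \<sigma> X"
    and S: "S = {(i, j). i < n \<and> j < n \<and> i \<in> \<sigma> j}" "S \<noteq> {}"
  shows "measure M {\<omega> \<in> space M. Q (residue_entries m (X \<omega>))} =
    measure_pmf.prob (entry_pmf (CARD('p) ^ m) S) {f. Q f}"
proof -
  let ?q = "CARD('p) ^ m"
  let ?D = "PiE_dflt S 0 (\<lambda>_. {0..<int ?q})"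
  interpret M: prob_space M using X by (simp add: haar_random_matrix_on_def)
  have dim: "X \<omega> \<in> carrier_mat n n" if "\<omega> \<in> space M" for \<omega>
    using X that by (simp add: haar_random_matrix_on_def)
  have haar: "haar_random M (\<lambda>\<omega>. X \<omega> $$ e)" if "e \<in> S" for e
    using X that by (auto simp: haar_random_matrix_on_def S(1))
  have indep: "M.indep_vars (\<lambda>_. borel) (\<lambda>e \<omega>. X \<omega> $$ e) S"
    using X unfolding haar_random_matrix_on_def S(1) by (simp add: case_prod_unfold)
  have zero: "X \<omega> $$ (i, j) = 0" if "\<omega> \<in> space M" "i < n" "j < n" "(i, j) \<notin> S" for \<omega> i j
    using X that by (auto simp: haar_random_matrix_on_def S(1))
  have finS: "finite S" unfolding S(1) by (rule finite_subset[of _ "{..<n} \<times> {..<n}"]) auto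
  have finD: "finite ?D" "?D \<noteq> {}" using finS by (auto intro!: finite_PiE_dflt)
  have inD: "residue_entries m (X \<omega>) \<in> ?D" if \<omega>: "\<omega> \<in> space M" for \<omega>
  proof -
    have "residue_entries m (X \<omega>) (i, j) = 0" if "(i, j) \<notin> S" for i j
      using zero[OF \<omega> _ _ that] dim[OF \<omega>] by (auto simp: residue_entries_def residue_arith)
    moreover have "residue_entries m (X \<omega>) e \<in> {0..<int ?q}" for e
      using residue_range[where 'p = 'p] by (auto simp: residue_entries_def split: prod.split)
    ultimately show ?thesis by (auto simp: PiE_dflt_def)
  qed
  let ?E = "\<lambda>f. {\<omega> \<in> space M. residue_entries m (X \<omega>) = f}"
  have E: "?E f \<in> sets M" "measure M (?E f) = 1 / real ?q ^ card S" if f: "f \<in> ?D" for f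
  proof -
    let ?C = "\<lambda>e. {x :: 'p padic_int. residue x m = f e}"
    have fe: "f e \<in> {0..<int CARD('p) ^ m}" if "e \<in> S" for e
      using f that by (cases e) (auto simp: PiE_dflt_def)
    have eqE: "?E f = (\<Inter>e\<in>S. (\<lambda>\<omega>. X \<omega> $$ e) -` ?C e \<inter> space M)"
    proof
      show "?E f \<subseteq> (\<Inter>e\<in>S. (\<lambda>\<omega>. X \<omega> $$ e) -` ?C e \<inter> space M)"
        using dim by (fastforce simp: residue_entries_def S(1))
      show "(\<Inter>e\<in>S. (\<lambda>\<omega>. X \<omega> $$ e) -` ?C e \<inter> space M) \<subseteq> ?E f"
      proof
        fix \<omega> assume \<omega>: "\<omega> \<in> (\<Inter>e\<in>S. (\<lambda>\<omega>. X \<omega> $$ e) -` ?C e \<inter> space M)"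
        then have sp: "\<omega> \<in> space M" using S(2) by auto
        have "residue_entries m (X \<omega>) e = f e" for e
        proof (cases "e \<in> S")
          case True
          then have "residue (X \<omega> $$ e) m = f e" using \<omega> by blast
          then show ?thesis using True dim[OF sp] by (auto simp: residue_entries_def S(1))
        next
          case False
          then show ?thesis using inD[OF sp] f by (cases e) (auto simp: PiE_dflt_def)
        qed
        then show "\<omega> \<in> ?E f" using sp by auto
      qed
    qed
    have C: "?C e \<in> sets borel" if "e \<in> S" for e
    proof -
      have "haar_prob_measure (distr M borel (\<lambda>\<omega>. X \<omega> $$ e))"
        using haar[OF that] by (simp add: haar_random_def)
      from haar_residue_class(1)[OF this fe[OF that]] show ?thesis by simp
    qed
    have meas: "(\<lambda>\<omega>. X \<omega> $$ e) \<in> borel_measurable M" if "e \<in> S" for e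
      using haar[OF that] by (simp add: haar_random_def)
    have "M.prob ((\<lambda>\<omega>. X \<omega> $$ e) -` ?C e \<inter> space M) = 1 / real ?q" if e: "e \<in> S" for e
    proof -
      have "M.prob ((\<lambda>\<omega>. X \<omega> $$ e) -` ?C e \<inter> space M) = measure (distr M borel (\<lambda>\<omega>. X \<omega> $$ e)) (?C e)"
        by (rule measure_distr[OF meas[OF e] C[OF e], symmetric])
      then show ?thesis using haar_residue_class(2)[OF _ fe[OF e]] haar[OF e] by (simp add: haar_random_def)
    qed
    then have "M.prob (\<Inter>e\<in>S. (\<lambda>\<omega>. X \<omega> $$ e) -` ?C e \<inter> space M) = (\<Prod>e\<in>S. 1 / real ?q)"
      using M.indep_varsD_finite[OF indep S(2) finS C] by simp
    then show "measure M (?E f) = 1 / real ?q ^ card S" unfolding eqE by (simp add: power_one_over)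
    show "?E f \<in> sets M" unfolding eqE
      by (intro sets.finite_INT[OF finS S(2)] measurable_sets[OF meas C])
  qed
  have "{\<omega> \<in> space M. Q (residue_entries m (X \<omega>))} = (\<Union>f\<in>?D \<inter> {f. Q f}. ?E f)" using inD by auto
  also have "measure M \<dots> = (\<Sum>f\<in>?D \<inter> {f. Q f}. measure M (?E f))"
    using finD E by (intro M.finite_measure_finite_Union) (auto simp: disjoint_family_on_def)
  also have "\<dots> = (\<Sum>f\<in>?D \<inter> {f. Q f}. 1 / real ?q ^ card S)" using E by (intro sum.cong) auto
  also have "\<dots> = real (card (?D \<inter> {f. Q f})) / real (card ?D)"
    using finS by (simp add: card_PiE_dflt)
  also have "\<dots> = measure_pmf.prob (pmf_of_set ?D) {f. Q f}" by (rule measure_pmf_of_set[OF finD(2,1), symmetric])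
  also have "pmf_of_set ?D = entry_pmf ?q S"
    unfolding entry_pmf_def using finS by (intro Pi_pmf_of_set[symmetric]) auto
  finally show ?thesis .
qed

lemma inverse_power_prod_LIMSEQ:
  assumes "1 < p"
  shows "inverse_power_prod p \<longlonglongrightarrow> (\<Prod>i. 1 - 1 / real p ^ Suc i)" "0 < (\<Prod>i. 1 - 1 / real p ^ Suc i)"
proof -
  let ?f = "\<lambda>i. 1 + - (1 / real p ^ Suc i)"
  have "summable (\<lambda>i. (1 / real p) ^ Suc i)" using assms by (subst summable_Suc_iff) (auto intro!: summable_geometric)
  then have summable: "summable (\<lambda>i. \<bar>- (1 / real p ^ Suc i)\<bar>)"
    by (simp add: power_one_over del: power_Suc)
  have lt: "1 / real p ^ Suc i < 1" for i
    using one_less_power[of "real p" "Suc i"] assms by (simp del: power_Suc)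
  have conv: "convergent_prod ?f"
  proof (rule summable_imp_convergent_prod_real[OF summable])
    show "- (1 / real p ^ Suc k) \<noteq> - 1" for k using lt[of k] by linarith
  qed
  have lim: "(\<lambda>n. \<Prod>i\<le>n. ?f i) \<longlonglongrightarrow> prodinf ?f" by (rule convergent_prod_LIMSEQ[OF conv])
  have nz: "prodinf ?f \<noteq> 0"
  proof (rule prodinf_nonzero[OF conv])
    show "?f i \<noteq> 0" for i using lt[of i] by linarith
  qed
  have "(\<lambda>n. inverse_power_prod p (Suc n)) \<longlonglongrightarrow> prodinf ?f"
    using lim by (simp add: inverse_power_prod_def lessThan_Suc_atMost del: power_Suc)
  then show L: "inverse_power_prod p \<longlonglongrightarrow> (\<Prod>i. 1 - 1 / real p ^ Suc i)"
    by (subst (asm) filterlim_sequentially_Suc) simp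
  have "0 \<le> (\<Prod>i. 1 - 1 / real p ^ Suc i)"
    using inverse_power_prod_pos[OF assms] by (intro LIMSEQ_le_const[OF L]) (auto intro: less_imp_le)
  then show "0 < (\<Prod>i. 1 - 1 / real p ^ Suc i)" using nz by simp
qed

lemma square_cok_prob_LIMSEQ:
  fixes K :: "('k, 'l) monoid_scheme"
  assumes p: "Factorial_Ring.prime (p::nat)" and q: "q = p ^ Suc m"
    and K: "comm_group K" "finite (carrier K)"
    and exp: "\<And>x. x \<in> carrier K \<Longrightarrow> x [^]\<^bsub>K\<^esub> (p ^ m) = \<one>\<^bsub>K\<^esub>"
  shows "(\<lambda>k. square_cok_prob q k K) \<longlonglongrightarrow> CL p K"
proof -
  have "(\<lambda>k. inverse_power_prod p k / real (card (auto K)) *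
      (real (card {g \<in> PiE {..<k} (\<lambda>_. carrier K). generate K (g ` {..<k}) = carrier K}) / real (order K) ^ k))
      \<longlonglongrightarrow> (\<Prod>i. 1 - 1 / real p ^ Suc i) / real (card (auto K)) * 1"
    using inverse_power_prod_LIMSEQ(1)[OF prime_gt_1_nat[OF p]] comm_group.generating_tuples_ratio[OF K]
    unfolding divide_inverse[of _ "real (card (auto K))"] by (intro tendsto_mult tendsto_const)
  moreover have "square_cok_prob q k K = inverse_power_prod p k / real (card (auto K)) *
      (real (card {g \<in> PiE {..<k} (\<lambda>_. carrier K). generate K (g ` {..<k}) = carrier K}) / real (order K) ^ k)" for k
    using card_square_quotient_iso[OF p q finite_lessThan K exp, of k] by (simp add: square_cok_prob_def)
  ultimately show ?thesis by (simp add: CL_def)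
qed

section \<open>Convergence to the Cohen-Lenstra distribution\<close>

definition trivial_nat_group :: "nat monoid" where
  "trivial_nat_group = \<lparr>carrier = {0}, mult = (\<lambda>_ _. 0), one = 0\<rparr>"

lemma trivial_nat_group:
  "comm_group trivial_nat_group" "finite_abelian_p_group p trivial_nat_group"
  "CL p trivial_nat_group = (\<Prod>i. 1 - 1 / real p ^ Suc i)"
proof -
  show cg: "comm_group trivial_nat_group"
    by (rule comm_groupI) (auto simp: trivial_nat_group_def)
  then show "finite_abelian_p_group p trivial_nat_group"
    by (auto simp: finite_abelian_p_group_def trivial_nat_group_def order_def intro: exI[of _ 0])
  have "auto trivial_nat_group = {\<lambda>x\<in>{0}. 0}"
    by (auto simp: auto_def Bij_def trivial_nat_group_def hom_def bij_betw_def extensional_def fun_eq_iff)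
  then show "CL p trivial_nat_group = (\<Prod>i. 1 - 1 / real p ^ Suc i)" by (simp add: CL_def)
qed

lemma group_trivial_nat_group: "group trivial_nat_group"
  using trivial_nat_group(1) by (rule comm_group.axioms(2))

lemma const_hom_trivial_nat_group: "(\<lambda>_. 0) \<in> hom G trivial_nat_group"
  unfolding hom_def trivial_nat_group_def by simp

lemma (in comm_group) Mod_trivial_iff:
  assumes "subgroup H G"
  shows "G Mod H \<cong> trivial_nat_group \<longleftrightarrow> H = carrier G"
proof
  assume iso: "G Mod H \<cong> trivial_nat_group"
  interpret H: normal H G using assms by (rule subgroup_imp_normal)
  have one: "x [^]\<^bsub>trivial_nat_group\<^esub> (1::nat) = \<one>\<^bsub>trivial_nat_group\<^esub>" for x
    by (simp add: trivial_nat_group_def nat_pow_def)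
  have "x \<in> H" if "x \<in> carrier G" for x
    using H.power_mem_of_Mod_iso[OF iso group_trivial_nat_group one that] that by simp
  then show "H = carrier G" using H.subset by blast
next
  assume H: "H = carrier G"
  have h: "group_hom G trivial_nat_group (\<lambda>_. 0)"
    by (rule group_hom.intro[OF is_group group_trivial_nat_group group_hom_axioms.intro[OF const_hom_trivial_nat_group]])
  have "kernel G trivial_nat_group (\<lambda>_. 0) = H"
    unfolding H kernel_def trivial_nat_group_def by simp
  moreover have "(\<lambda>_. 0) ` carrier G = carrier trivial_nat_group"
    using one_closed unfolding trivial_nat_group_def by auto
  ultimately show "G Mod H \<cong> trivial_nat_group" using group_hom.FactGroup_iso[OF h] by simp
qed

lemma cok_trivial_iff_det:
  fixes X :: "'p::prime_card padic_int mat"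
  assumes X: "X \<in> carrier_mat n n"
  shows "cok X \<cong> trivial_nat_group \<longleftrightarrow> Determinant.det (map_mat padic_reduction X) \<noteq> 0"
proof -
  let ?A = "zmod_vec (CARD('p) ^ Suc 0) {..<n}"
  interpret A: comm_group ?A by (rule comm_group_zmod_vec)
  have sub: "subgroup (generate ?A (block_vec Pair {..<n} (residue_entries (Suc 0) X) ` {..<n})) ?A"
    using block_vec_residue_carrier by (intro A.generate_is_subgroup image_subsetI)
  have "cok X \<cong> trivial_nat_group \<longleftrightarrow>
      ?A Mod generate ?A (block_vec Pair {..<n} (residue_entries (Suc 0) X) ` {..<n}) \<cong> trivial_nat_group"
    by (rule cok_iso_iff_residues[OF X group_trivial_nat_group]) (simp add: trivial_nat_group_def nat_pow_def)
  also have "\<dots> \<longleftrightarrow> generate ?A (block_vec Pair {..<n} (residue_entries (Suc 0) X) ` {..<n}) = carrier ?A"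
    by (rule A.Mod_trivial_iff[OF sub])
  also have "\<dots> \<longleftrightarrow> Determinant.det (map_mat padic_reduction X) \<noteq> 0"
    unfolding det_reduction_iff_cols_generate[OF X, of 0] cols_generate_def ..
  finally show ?thesis .
qed

theorem theorem1p4:
  fixes t :: "nat \<Rightarrow> nat"
    and M :: "nat \<Rightarrow> 'w measure"
    and X :: "nat \<Rightarrow> 'w \<Rightarrow> 'p::prime_card padic_int Matrix.mat"
  assumes "\<And>n. 1 \<le> n \<Longrightarrow> 0 < t n \<and> t n \<le> n"
    and "\<And>n. 1 \<le> n \<Longrightarrow> haar_random_band_matrix (M n) n (t n) (X n)"
  shows "converges_to_CL CARD('p) M (\<lambda>n \<omega>. cok (X n \<omega>)) \<longleftrightarrow>
    (\<lambda>n. measure (M n) {\<omega> \<in> space (M n). Determinant.det (map_mat padic_reduction (X n \<omega>)) \<noteq> 0})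
      \<longlonglongrightarrow> (\<Prod>i. 1 - 1 / real CARD('p) ^ Suc i)"
proof -
  let ?p = "CARD('p)"
  let ?c = "\<Prod>i. 1 - 1 / real ?p ^ Suc i"
  let ?C = "inverse_power_prod ?p"
  define d where "d n = measure (M n) {\<omega> \<in> space (M n). Determinant.det (map_mat padic_reduction (X n \<omega>)) \<noteq> 0}" for n
  define S where "S n = {(i, j). i < n \<and> j < n \<and> i \<in> band_support n (t n) j}" for n
  have p: "Factorial_Ring.prime ?p" by (rule prime_card)
  have p1: "1 < ?p" using p by (rule prime_gt_1_nat)
  note C = inverse_power_prod_LIMSEQ[OF p1]
  have Cpos: "0 < ?C k" for k using p1 by (rule inverse_power_prod_pos)
  have haar: "haar_random_matrix_on (M n) n (band_support n (t n)) (X n)" if "1 \<le> n" for n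
    using assms(2)[OF that] by (simp add: haar_random_band_matrix_def)
  have dim: "X n \<omega> \<in> carrier_mat n n" if "1 \<le> n" "\<omega> \<in> space (M n)" for n \<omega>
    using haar[OF that(1)] that(2) by (simp add: haar_random_matrix_on_def)
  have mem: "(i, j) \<in> S n \<longleftrightarrow> i < n \<and> j < n \<and> \<bar>int i - int j\<bar> \<le> int (t n)" for n i j
    by (auto simp: S_def band_support_def)
  have SN: "S n \<subseteq> {..<n} \<times> {..<n}" for n by (auto simp: mem)
  have nonempty: "S n \<noteq> {}" if "1 \<le> n" for n using that mem[of 0 0 n] by auto
  have law: "measure (M n) {\<omega> \<in> space (M n). Q (residue_entries m (X n \<omega>))} =
      measure_pmf.prob (entry_pmf (?p ^ m) (S n)) {f. Q f}" if "1 \<le> n" for n m Q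
    by (rule haar_random_matrix_residue_prob[OF haar[OF that] S_def nonempty[OF that]])
  have d_law: "d n = measure_pmf.prob (entry_pmf (?p ^ Suc m) (S n))
      {f. cols_generate (?p ^ Suc m) {..<n} {..<n} f \<and> rows_generate (?p ^ Suc m) {..<n} {..<n} f}"
    if "1 \<le> n" for n m
    unfolding d_def law[OF that, symmetric]
    by (intro arg_cong[where f = "measure (M n)"] Collect_cong conj_cong refl
        det_reduction_iff_generate[OF dim[OF that]])

  have "d \<longlonglongrightarrow> ?c" if CL: "converges_to_CL ?p M (\<lambda>n \<omega>. cok (X n \<omega>))"
  proof -
    have "(\<lambda>n. measure (M n) {\<omega> \<in> space (M n). cok (X n \<omega>) \<cong> trivial_nat_group}) \<longlonglongrightarrow> ?c"
      using CL trivial_nat_group(2)[of ?p] unfolding converges_to_CL_def trivial_nat_group(3)[symmetric] by blast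
    moreover have "\<forall>\<^sub>F n in sequentially.
        measure (M n) {\<omega> \<in> space (M n). cok (X n \<omega>) \<cong> trivial_nat_group} = d n"
      using eventually_ge_at_top[of 1]
    proof eventually_elim
      case (elim n)
      show ?case unfolding d_def
        by (intro arg_cong[where f = "measure (M n)"] Collect_cong conj_cong refl cok_trivial_iff_det[OF dim[OF elim]])
    qed
    ultimately show ?thesis by (rule Lim_transform_eventually)
  qed
  moreover have "converges_to_CL ?p M (\<lambda>n \<omega>. cok (X n \<omega>))" if d: "d \<longlonglongrightarrow> ?c"
  proof -
    \<comment> \<open>A width of at most \<open>T\<close> would keep \<open>d\<close> below its limit by a fixed factor.\<close>
    have wide: "\<forall>\<^sub>F n in sequentially. T < t n" for T
    proof -
      let ?\<eta> = "(1 / real ?p) ^ Suc T"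
      have \<eta>: "0 < ?\<eta>" using p1 by simp
      have "(\<lambda>n. d (Suc n) - ?C n * (1 - ?\<eta>)) \<longlonglongrightarrow> ?c - ?c * (1 - ?\<eta>)"
        by (intro tendsto_diff tendsto_mult C(1) tendsto_const LIMSEQ_Suc[OF d])
      moreover have "0 < ?c - ?c * (1 - ?\<eta>)" using C(2) \<eta> by (simp add: right_diff_distrib)
      ultimately have "\<forall>\<^sub>F n in sequentially. 0 < d (Suc n) - ?C n * (1 - ?\<eta>)" by (rule order_tendstoD(1))
      then have "\<forall>\<^sub>F n in sequentially. T < t (Suc n)"
      proof eventually_elim
        case (elim n)
        show ?case
        proof (rule ccontr)
          assume "\<not> T < t (Suc n)"
          then have "n \<le> j + T" if "(n, j) \<in> S (Suc n)" for j using that unfolding mem by auto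
          then have "d (Suc n) \<le> ?C n * (1 - ?\<eta>)"
            unfolding d_law[OF le_add1[of 1 n, unfolded plus_1_eq_Suc], of 0]
            by (intro prob_full_rank_narrow_le[OF p refl SN])
          then show False using elim by simp
        qed
      qed
      then show ?thesis by (rule eventually_sequentially_Suc[THEN iffD1])
    qed
    have "(\<lambda>n. measure (M n) {\<omega> \<in> space (M n). cok (X n \<omega>) \<cong> K}) \<longlonglongrightarrow> CL ?p K"
      if K: "finite_abelian_p_group ?p K" for K :: "nat monoid"
    proof -
      obtain m where m: "order K = ?p ^ m" and cg: "comm_group K" and finK: "finite (carrier K)"
        using K by (auto simp: finite_abelian_p_group_def)
      interpret K: comm_group K by (rule cg)
      have exp: "x [^]\<^bsub>K\<^esub> (?p ^ m) = \<one>\<^bsub>K\<^esub>" if "x \<in> carrier K" for x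
        using K.pow_order_eq_1[OF that] m by simp
      let ?q = "?p ^ Suc m"
      let ?P = "\<lambda>n. measure (M n) {\<omega> \<in> space (M n). cok (X n \<omega>) \<cong> K}"
      have P_law: "?P n = measure_pmf.prob (entry_pmf ?q (S n))
          {f. zmod_vec ?q {..<n} Mod generate (zmod_vec ?q {..<n}) (block_vec Pair {..<n} f ` {..<n}) \<cong> K}"
        if "1 \<le> n" for n
        unfolding law[OF that, symmetric]
        by (intro arg_cong[where f = "measure (M n)"] Collect_cong conj_cong refl
            cok_iso_iff_residues[OF dim[OF that] K.is_group exp])
      have approx: "\<bar>?P n - square_cok_prob ?q k K\<bar> \<le> (1 - d n / ?C k) + real ?p ^ k * (1 - d n / ?C s)"
        if "1 \<le> n" "s \<le> t n" "k \<le> s" "s \<le> n" for n k s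
        unfolding P_law[OF that(1)]
      proof (rule prob_cok_approx[OF p refl SN])
        show "{..<s} \<times> {..<k} \<subseteq> S n" using that by (auto simp: mem)
      qed (use that d_law[OF that(1)] in auto)
      note \<kappa> = square_cok_prob_LIMSEQ[OF p refl cg finK exp]
      show ?thesis
      proof (rule LIMSEQ_I)
        fix \<epsilon> :: real assume \<epsilon>: "0 < \<epsilon>"
        \<comment> \<open>The size \<open>k\<close> of the square matrix comes first; \<open>s\<close> has to beat the factor \<open>p\<^sup>k\<close>.\<close>
        have "(\<lambda>k. 1 - ?c / ?C k) \<longlonglongrightarrow> 1 - ?c / ?c"
          using C by (intro tendsto_diff tendsto_divide tendsto_const) auto
        then have lim0: "(\<lambda>k. 1 - ?c / ?C k) \<longlonglongrightarrow> 0" using C(2) by simp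
        have "\<forall>\<^sub>F k in sequentially. 1 - ?c / ?C k < \<epsilon> / 4 \<and> norm (square_cok_prob ?q k K - CL ?p K) < \<epsilon> / 4"
          using \<epsilon> by (intro eventually_conj order_tendstoD(2)[OF lim0]
            tendstoD[OF \<kappa>, unfolded dist_norm]) auto
        then obtain k where k: "1 - ?c / ?C k < \<epsilon> / 4" "norm (square_cok_prob ?q k K - CL ?p K) < \<epsilon> / 4"
          by (metis (mono_tags, lifting) eventually_sequentially order_refl)
        have "(\<lambda>s. real ?p ^ k * (1 - ?c / ?C s)) \<longlonglongrightarrow> real ?p ^ k * 0"
          by (intro tendsto_mult tendsto_const lim0)
        then have "\<forall>\<^sub>F s in sequentially. real ?p ^ k * (1 - ?c / ?C s) < \<epsilon> / 4 \<and> k \<le> s"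
          using \<epsilon> by (intro eventually_conj order_tendstoD(2)[of _ "real ?p ^ k * 0"] eventually_ge_at_top) auto
        then obtain s where s: "real ?p ^ k * (1 - ?c / ?C s) < \<epsilon> / 4" "k \<le> s"
          by (metis (mono_tags, lifting) eventually_sequentially order_refl)
        have "(\<lambda>n. (1 - d n / ?C k) + real ?p ^ k * (1 - d n / ?C s)) \<longlonglongrightarrow>
            (1 - ?c / ?C k) + real ?p ^ k * (1 - ?c / ?C s)"
          using Cpos[of k] Cpos[of s]
          by (intro tendsto_add tendsto_diff tendsto_mult tendsto_divide tendsto_const d) auto
        moreover have "(1 - ?c / ?C k) + real ?p ^ k * (1 - ?c / ?C s) < \<epsilon> / 2" using k(1) s(1) by linarith
        ultimately have "\<forall>\<^sub>F n in sequentially. (1 - d n / ?C k) + real ?p ^ k * (1 - d n / ?C s) < \<epsilon> / 2"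
          by (rule order_tendstoD(2))
        then have "\<forall>\<^sub>F n in sequentially. norm (?P n - CL ?p K) < \<epsilon>"
          using wide[of s] eventually_ge_at_top[of s] eventually_ge_at_top[of 1]
        proof eventually_elim
          case (elim n)
          have "\<bar>?P n - square_cok_prob ?q k K\<bar> < \<epsilon> / 2"
            using approx[of n s k] elim s(2) by linarith
          moreover have "\<bar>square_cok_prob ?q k K - CL ?p K\<bar> < \<epsilon> / 4" using k(2) by (simp add: real_norm_def)
          ultimately have "\<bar>?P n - CL ?p K\<bar> < \<epsilon>" using \<epsilon> by linarith
          then show ?case by (simp add: real_norm_def)
        qed
        then show "\<exists>no. \<forall>n\<ge>no. norm (?P n - CL ?p K) < \<epsilon>" by (simp add: eventually_sequentially)
      qed
    qed
    then show ?thesis by (simp add: converges_to_CL_def)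
  qed
  ultimately show ?thesis unfolding d_def[abs_def, symmetric] by blast
qed

end
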